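(* Let $0<q<1$ and let $(c,d)$ be an admissible pair: either $d=\bar c\in\mathbb C\setminus\mathbb R$, or $c,d$ are real of the same sign with $q<cd^{-1}<q^{-1}$. Let $\Phi^{ASC}_\lambda=\Phi^{ASC}_\lambda(\cdot;q;c,d)$ be the Al-Salam--Carlitz symmetric functions, which form a basis of $\mathrm{Sym}$; let $\mathbb E:\mathrm{Sym}\to\mathbb C$ be the linear functional with $\mathbb E(\Phi^{ASC}_\lambda)=\delta_{\lambda,\emptyset}$ for all partitions $\lambda$, and put $(F,G):=\mathbb E(FG)$. Then for all partitions $\lambda,\mu$, $$(\Phi^{ASC}_\lambda,\Phi^{ASC}_\mu)=\delta_{\lambda,\mu}\,h^{ASC}_\lambda(q;c,d),\qquad h^{ASC}_\lambda(q;c,d)=\frac{q^{2\{n(\lambda)-n(\lambda')\}}}{(cdq)^{|\lambda|}}.$$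
   Context: Notation: $(x;q)_n=\prod_{k=0}^{n-1}(1-xq^k)$ for $n\ge0$. $\ell(\lambda)$ is the number of nonzero parts, $|\lambda|=\sum\lambda_i$, $n(\lambda)=\sum_i(i-1)\lambda_i$, $\lambda'$ is the transposed partition (so $n(\lambda')=\sum_i\binom{\lambda_i}2$), $\mathbb Y(N)$ is the set of partitions with at most $N$ nonzero parts. $\mathrm{Sym}$ is the algebra of symmetric functions over $\mathbb C$, $\mathrm{Sym}(N)$ the symmetric polynomials in $N$ variables, the subscript $\le d$ means degree at most $d$. $V(x_1,\dots,x_N)=\prod_{i<j}(x_i-x_j)$. For variables $X=(x_1,x_2,\dots)$, $F(Xc)=F(cx_1,cx_2,\dots)$. Interpolation functions: $(x\mid c_0,c_1,\dots)^m=\prod_{i=0}^{m-1}(x-c_i)$; for $\mu\in\mathbb Y(N)$, $s_{\mu|N}(x_1,\dots,x_N\mid c_0,c_1,\dots)=\det[(x_j\mid c_0,c_1,\dots)^{\mu_i+N-i}]_{i,j=1}^N/V(x_1,\dots,x_N)$. $I^A_\mu(\cdot;q)\in\mathrm{Sym}$ is the limit as $N\to\infty$ (which exists) of $s_{\mu|N}(\cdot\mid q^{N-1},q^{N-2},\dots)$, where $F_N\in\mathrm{Sym}(N)$ converges to $F\in\mathrm{Sym}$ if $\sup_N\deg F_N<\infty$ and, for every sufficiently large $d$, $\iota_{d,N}(F_N)\to F$ in $\mathrm{Sym}_{\le d}$; for $N\ge d$, $\iota_{d,N}:\mathrm{Sym}_{\le d}(N)\to\mathrm{Sym}_{\le d}$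 is the inverse of the isomorphism $F\mapsto F(x_1,\dots,x_N,0,0,\dots)$. Al-Salam--Carlitz symmetric functions: $\Phi^{ASC}_\lambda(X;q;c,d)=\sum_{\mu\subseteq\lambda}\sigma^{ASC}(\lambda,\mu;q;c,d)\,I^A_\mu(Xc;q)$ with $$\sigma^{ASC}(\lambda,\mu;q;c,d)=c^{-|\lambda|}\left(-\frac cd\right)^{|\lambda|-|\mu|}q^{n(\mu')-n(\mu)-n(\lambda')+n(\lambda)}\det\left[\frac1{(q;q)_{\lambda_j-j-\mu_k+k}}\right]_{j,k=1}^{\ell(\lambda)};$$ an entry with $\lambda_j-j-\mu_k+k<0$ is $0$, and the empty determinant is $1$. One has $\Phi^{ASC}_\lambda=S_\lambda+$ lower degree terms ($S_\lambda$ the Schur function). *)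

theory Defs
  imports
    Complex_Main
    "HOL-Library.Poly_Mapping"
    "HOL-Combinatorics.Permutations"
    "Jordan_Normal_Form.Determinant"
begin

section \<open>Partitions and q-Pochhammer symbols\<close>

text \<open>
  A partition is an eventually zero, weakly decreasing sequence. Indices start at 0, so
  \<open>lam i\<close> is the part usually written \<open>\<lambda>\<^sub>i\<^sub>+\<^sub>1\<close>.
\<close>

definition is_partition :: "(nat \<Rightarrow> nat) \<Rightarrow> bool" where
  "is_partition lam \<longleftrightarrow> antimono lam \<and> finite {i. lam i \<noteq> 0}"

definition plength :: "(nat \<Rightarrow> nat) \<Rightarrow> nat" where
  "plength lam = card {i. lam i \<noteq> 0}"

definition psize :: "(nat \<Rightarrow> nat) \<Rightarrow> nat" where
  "psize lam = (\<Sum>i<plength lam. lam i)"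

definition pweight :: "(nat \<Rightarrow> nat) \<Rightarrow> nat" where
  "pweight lam = (\<Sum>i<plength lam. i * lam i)"

definition ptranspose :: "(nat \<Rightarrow> nat) \<Rightarrow> (nat \<Rightarrow> nat)" where
  "ptranspose lam = (\<lambda>j. card {i. j < lam i})"

definition qpoch :: "complex \<Rightarrow> complex \<Rightarrow> nat \<Rightarrow> complex" where
  "qpoch x q n = (\<Prod>k<n. 1 - x * q ^ k)"

section \<open>Symmetric functions and symmetric polynomials\<close>

text \<open>
  Monomials in \<open>x\<^sub>0, x\<^sub>1, \<dots>\<close> are finitely supported exponent vectors. A formal power
  series is given by its coefficient function, a polynomial by a finitely supported one
  (so that polynomials carry the ring structure of \<^theory>\<open>HOL-Library.Poly_Mapping\<close>).
\<close>

type_synonym monom = "nat \<Rightarrow>\<^sub>0 nat"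
type_synonym series = "monom \<Rightarrow> complex"
type_synonym mpoly = "monom \<Rightarrow>\<^sub>0 complex"

definition mdeg :: "monom \<Rightarrow> nat" where
  "mdeg m = (\<Sum>i\<in>Poly_Mapping.keys m. Poly_Mapping.lookup m i)"

definition Sym_le :: "nat \<Rightarrow> series set" where
  "Sym_le d = {F. (\<forall>m. F m \<noteq> 0 \<longrightarrow> mdeg m \<le> d) \<and>
                  (\<forall>p m. bij p \<longrightarrow> F (Poly_Mapping.map_key p m) = F m)}"

definition Sym :: "series set" where
  "Sym = (\<Union>d. Sym_le d)"

definition smult_series :: "complex \<Rightarrow> series \<Rightarrow> series" where
  "smult_series a F = (\<lambda>m. a * F m)"

definition add_series :: "series \<Rightarrow> series \<Rightarrow> series" where
  "add_series F G = (\<lambda>m. F m + G m)"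

definition mult_series :: "series \<Rightarrow> series \<Rightarrow> series" where
  "mult_series F G = (\<lambda>m. \<Sum>(a, b) \<in> {(a, b). a + b = m}. F a * G b)"

lemma finite_monom_splittings: "finite {(a, b). a + b = (m :: monom)}"
proof -
  let ?S = "{f :: nat \<Rightarrow> nat. \<forall>i. (i \<in> Poly_Mapping.keys m \<longrightarrow> f i \<in> {..mdeg m}) \<and>
               (i \<notin> Poly_Mapping.keys m \<longrightarrow> f i = 0)}"
  have fin: "finite ?S"
    by (rule finite_set_of_finite_funs) auto
  have sub: "Poly_Mapping.lookup a \<in> ?S" if ex: "\<exists>b. a + b = m" for a
  proof -
    obtain b where b: "m = a + b" using ex by metis
    have le: "Poly_Mapping.lookup a i \<le> Poly_Mapping.lookup m i" for i
      by (simp add: b lookup_add)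
    have deg: "Poly_Mapping.lookup m i \<le> mdeg m" if "i \<in> Poly_Mapping.keys m" for i
      unfolding mdeg_def using that by (intro member_le_sum) auto
    then show ?thesis
      using le by (auto simp: in_keys_iff intro: order_trans[OF le deg]) (metis le_zero_eq)
  qed
  have inj: "inj_on (\<lambda>(a, b). Poly_Mapping.lookup a) {(a, b). a + b = m}"
    by (auto simp: inj_on_def poly_mapping.lookup_inject)
  show ?thesis
    by (rule inj_on_finite[OF inj _ fin]) (use sub in auto)
qed

text \<open>\<open>F(X c) = F(c x\<^sub>0, c x\<^sub>1, \<dots>)\<close>.\<close>

definition scale_vars :: "complex \<Rightarrow> series \<Rightarrow> series" where
  "scale_vars c F = (\<lambda>m. c ^ mdeg m * F m)"

text \<open>\<open>F(x\<^sub>0, \<dots>, x\<^bsub>N-1\<^esub>, 0, 0, \<dots>)\<close>.\<close>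

definition truncate_vars :: "nat \<Rightarrow> series \<Rightarrow> series" where
  "truncate_vars N F = (\<lambda>m. if Poly_Mapping.keys m \<subseteq> {..<N} then F m else 0)"

definition SymPoly_le :: "nat \<Rightarrow> nat \<Rightarrow> mpoly set" where
  "SymPoly_le d N = {P.
     (\<forall>m \<in> Poly_Mapping.keys P. Poly_Mapping.keys m \<subseteq> {..<N} \<and> mdeg m \<le> d) \<and>
     (\<forall>p m. p permutes {..<N} \<longrightarrow>
        Poly_Mapping.lookup P (Poly_Mapping.map_key p m) = Poly_Mapping.lookup P m)}"

text \<open>
  The inverse of the isomorphism \<open>F \<mapsto> F(x\<^sub>0, \<dots>, x\<^bsub>N-1\<^esub>, 0, 0, \<dots>)\<close> from \<open>Sym_le d\<close> onto
  \<open>SymPoly_le d N\<close>; it is meaningful for \<open>d \<le> N\<close>.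
\<close>

definition sym_iota :: "nat \<Rightarrow> nat \<Rightarrow> mpoly \<Rightarrow> series" where
  "sym_iota d N P = (THE F. F \<in> Sym_le d \<and> truncate_vars N F = Poly_Mapping.lookup P)"

text \<open>
  Convergence of symmetric polynomials \<open>P N\<close> in \<open>N\<close> variables to a symmetric function.
  \<open>Sym_le d\<close> is finite-dimensional, so convergence in it is convergence of all coefficients.
  The degree bound is only required for large \<open>N\<close> because \<open>P N\<close> below is only meaningful
  for large \<open>N\<close>.
\<close>

definition sym_converges :: "(nat \<Rightarrow> mpoly) \<Rightarrow> series \<Rightarrow> bool" where
  "sym_converges P F \<longleftrightarrow>
     (\<exists>D. \<forall>\<^sub>F N in sequentially. P N \<in> SymPoly_le D N) \<and>
     (\<forall>\<^sub>F d in sequentially. F \<in> Sym_le d \<and>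
        (\<forall>m. (\<lambda>N. sym_iota d N (P N) m) \<longlonglongrightarrow> F m))"

section \<open>Interpolation functions\<close>

definition mvar :: "nat \<Rightarrow> mpoly" where
  "mvar j = Poly_Mapping.single (Poly_Mapping.single j 1) 1"

definition mconst :: "complex \<Rightarrow> mpoly" where
  "mconst a = Poly_Mapping.single 0 a"

definition factorial_power :: "mpoly \<Rightarrow> (nat \<Rightarrow> complex) \<Rightarrow> nat \<Rightarrow> mpoly" where
  "factorial_power x cs m = (\<Prod>i<m. x - mconst (cs i))"

definition vandermonde :: "nat \<Rightarrow> mpoly" where
  "vandermonde N = (\<Prod>(i, j) \<in> {(i, j). i < j \<and> j < N}. mvar i - mvar j)"

text \<open>
  The quotient of the determinant by the Vandermonde polynomial is taken in the polynomial
  ring, which is an integral domain; the division is exact.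
\<close>

definition factorial_schur :: "(nat \<Rightarrow> nat) \<Rightarrow> nat \<Rightarrow> (nat \<Rightarrow> complex) \<Rightarrow> mpoly" where
  "factorial_schur mu N cs = (THE P. P * vandermonde N =
     det (mat N N (\<lambda>(i, j). factorial_power (mvar j) cs (mu i + (N - Suc i)))))"

text \<open>
  The parameter sequence \<open>q\<^bsup>N-1\<^esup>, q\<^bsup>N-2\<^esup>, \<dots>\<close> is infinite and continues with
  \<open>1, q\<^sup>-\<^sup>1, q\<^sup>-\<^sup>2, \<dots>\<close>, hence the integer exponents.
\<close>

definition interp_fun :: "complex \<Rightarrow> (nat \<Rightarrow> nat) \<Rightarrow> series" where
  "interp_fun q mu = (THE F.
     sym_converges (\<lambda>N. factorial_schur mu N (\<lambda>k. q powi (int N - 1 - int k))) F)"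

section \<open>Al-Salam--Carlitz symmetric functions\<close>

definition sigma_ASC ::
  "(nat \<Rightarrow> nat) \<Rightarrow> (nat \<Rightarrow> nat) \<Rightarrow> complex \<Rightarrow> complex \<Rightarrow> complex \<Rightarrow> complex" where
  "sigma_ASC lam mu q c d =
     c powi (- int (psize lam)) * (- c / d) powi (int (psize lam) - int (psize mu)) *
     q powi (int (pweight (ptranspose mu)) - int (pweight mu)
             - int (pweight (ptranspose lam)) + int (pweight lam)) *
     det (mat (plength lam) (plength lam) (\<lambda>(j, k).
       let e = int (lam j) - int j - int (mu k) + int k
       in if e < 0 then 0 else 1 / qpoch q q (nat e)))"

definition Phi_ASC ::
  "complex \<Rightarrow> complex \<Rightarrow> complex \<Rightarrow> (nat \<Rightarrow> nat) \<Rightarrow> series" where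
  "Phi_ASC q c d lam = (\<lambda>m. \<Sum>mu | is_partition mu \<and> (\<forall>i. mu i \<le> lam i).
     sigma_ASC lam mu q c d * scale_vars c (interp_fun q mu) m)"

definition h_ASC :: "complex \<Rightarrow> complex \<Rightarrow> complex \<Rightarrow> (nat \<Rightarrow> nat) \<Rightarrow> complex" where
  "h_ASC q c d lam =
     q powi (2 * (int (pweight lam) - int (pweight (ptranspose lam)))) / (c * d * q) ^ psize lam"

definition admissible_pair :: "real \<Rightarrow> complex \<Rightarrow> complex \<Rightarrow> bool" where
  "admissible_pair q c d \<longleftrightarrow>
     (c \<notin> \<real> \<and> d = cnj c) \<or>
     (\<exists>a b. c = complex_of_real a \<and> d = complex_of_real b \<and>
        (0 < a \<and> 0 < b \<or> a < 0 \<and> b < 0) \<and> q < a / b \<and> a / b < 1 / q)"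

definition linear_functional_on_Sym :: "(series \<Rightarrow> complex) \<Rightarrow> bool" where
  "linear_functional_on_Sym E \<longleftrightarrow>
     (\<forall>F \<in> Sym. \<forall>G \<in> Sym. E (add_series F G) = E F + E G) \<and>
     (\<forall>a. \<forall>F \<in> Sym. E (smult_series a F) = a * E F)"

end

theory Submission
  imports Defs "HOL-Library.FuncSet" "HOL-Computational_Algebra.Polynomial"
begin

text \<open>
  In \<open>N\<close> variables, the polynomials \<open>det [p\<^bsub>\<lambda>\<^sub>i + N - i\<^esub>(x\<^sub>j)] / V(x)\<close> built from univariate monic orthogonal
  polynomials \<open>p\<^sub>n\<close> are orthogonal with respect to \<open>F \<mapsto> L\<^bsup>\<otimes>N\<^esup>(F V\<^sup>2)\<close>, where \<open>L\<close> is the moment functional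
  of the \<open>p\<^sub>n\<close>. For the Al-Salam--Carlitz polynomials with parameters depending on \<open>N\<close> in the right
  way, Cauchy--Binet expands them in the factorial Schur polynomials at \<open>q\<^bsup>N-1\<^esup>, q\<^bsup>N-2\<^esup>, \<dots>\<close>, with
  coefficients that converge as \<open>N \<rightarrow> \<infinity>\<close> to those of \<open>\<Phi>\<^sup>A\<^sup>S\<^sup>C\<close> (after rescaling the variables, so that only
  \<open>\<beta> = c / d\<close> matters). Since the leading monomials are unitriangular for the lexicographic order, the
  normalized functionals converge to \<open>E\<close>, and the squared norms are the limits of the finite ones.
\<close>


section \<open>Determinants of functions\<close>

text \<open>\<open>E\<close> is given only by its values on a basis, which does not reveal how a
  product expands; finite \<open>N\<close> supplies functionals whose values on products are
  computable. No integral is involved: moments come from the recursion that forces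
  \<open>L (W 0) = 1\<close> and \<open>L (W n) = 0\<close> for n > 0, and orthogonality follows
  from the three-term recurrence. Taking Q = q^(N-1) does two things at once: the nodes Q, Q/q, ...
  become those of the interpolation functions, and every normalized ratio contains Q only as
  Q/q^(N-1-i) = q^i, so that only quotients of q-Pochhammer symbols still depend on
  \<open>N\<close>, and these tend to 1. The obstacle is that the functional itself changes with
  \<open>N\<close>, so convergence of coefficients does not by itself give convergence of
  expectations. Known for each \<open>N\<close> are the values on the generalized Schur polynomials
  of the orthogonal polynomials. Any sequence of symmetric polynomials of bounded degree is
  therefore reduced to zero by subtracting multiples of these: leading coefficients are exactly 1,
  so nothing is divided, and the number of steps does not depend on \<open>N\<close>.\<close>

definition fdet :: "nat \<Rightarrow> (nat \<Rightarrow> nat \<Rightarrow> 'a :: comm_ring_1) \<Rightarrow> 'a" where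
  "fdet n g = det (mat n n (\<lambda>(i, j). g i j))"

lemma permutes_less: "p permutes {..<n} \<Longrightarrow> p i < n \<longleftrightarrow> i < (n :: nat)"
  using permutes_in_image[of p "{..<n}" i] by simp

lemma fdet_sum:
  "fdet n g = (\<Sum>p | p permutes {..<n}. of_int (sign p) * (\<Prod>i<n. g i (p i)))"
proof -
  have "(\<Prod>i = 0..<n. mat n n (\<lambda>(i, j). g i j) $$ (i, p i)) = (\<Prod>i<n. g i (p i))"
    if "p permutes {..<n}" for p
    unfolding atLeast0LessThan
    by (rule prod.cong[OF refl]) (simp add: permutes_less[OF that])
  note eq = this
  have "fdet n g = (\<Sum>p | p permutes {0..<n}. of_int (sign p) *
      (\<Prod>i = 0..<n. mat n n (\<lambda>(i, j). g i j) $$ (i, p i)))"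
    unfolding fdet_def by (rule det_def'[of _ n]) simp
  also have "\<dots> = (\<Sum>p | p permutes {..<n}. of_int (sign p) * (\<Prod>i<n. g i (p i)))"
    unfolding atLeast0LessThan[of n, symmetric]
    by (rule sum.cong[OF refl], subst eq[unfolded atLeast0LessThan[of n, symmetric]]) auto
  finally show ?thesis .
qed

lemma fdet_cong:
  assumes "\<And>i j. i < n \<Longrightarrow> j < n \<Longrightarrow> g i j = h i j"
  shows "fdet n g = fdet n h"
  unfolding fdet_def by (rule arg_cong[of _ _ det]) (use assms in auto)

lemma fdet_transpose: "fdet n (\<lambda>i j. g j i) = fdet n g"
proof -
  have "mat n n (\<lambda>(i, j). g j i) = transpose_mat (mat n n (\<lambda>(i, j). g i j))"
    by auto
  then show ?thesis
    unfolding fdet_def using det_transpose[of "mat n n (\<lambda>(i, j). g i j)" n] by simp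
qed

lemma fdet_sum_col:
  "fdet n g = (\<Sum>p | p permutes {..<n}. of_int (sign p) * (\<Prod>j<n. g (p j) j))"
  by (subst fdet_transpose[symmetric]) (rule fdet_sum)

lemma fdet_permute_rows:
  assumes "p permutes {..<n}"
  shows "fdet n (\<lambda>i j. g (p i) j) = of_int (sign p) * fdet n g"
proof -
  have "mat n n (\<lambda>(i, j). g (p i) j) =
      mat n n (\<lambda>(i, j). mat n n (\<lambda>(i, j). g i j) $$ (p i, j))"
    by (intro eq_matI) (auto simp: permutes_less[OF assms])
  then show ?thesis
    unfolding fdet_def
    using det_permute_rows[of "mat n n (\<lambda>(i, j). g i j)" n p] assms
    by (simp add: atLeast0LessThan)
qed

lemma fdet_permute_cols:
  assumes "p permutes {..<n}"
  shows "fdet n (\<lambda>i j. g i (p j)) = of_int (sign p) * fdet n g"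
  using fdet_permute_rows[OF assms, of "\<lambda>i j. g j i"]
    fdet_transpose[of n g] fdet_transpose[of n "\<lambda>i j. g i (p j)"] by simp

lemma fdet_scale:
  "fdet n (\<lambda>i j. a i * g i j * b j) = (\<Prod>i<n. a i) * (\<Prod>j<n. b j) * fdet n g"
proof -
  have "(\<Prod>i<n. a i * g i (p i) * b (p i)) = (\<Prod>i<n. a i) * (\<Prod>j<n. b j) * (\<Prod>i<n. g i (p i))"
    if "p permutes {..<n}" for p
    using prod.permute[OF that, of b] by (simp add: prod.distrib o_def mult_ac)
  then show ?thesis
    unfolding fdet_sum sum_distrib_left by (intro sum.cong) (auto simp: mult_ac)
qed

lemma fdet_identical_rows:
  assumes "i < n" "j < n" "i \<noteq> j" "\<And>k. k < n \<Longrightarrow> g i k = g j k"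
  shows "fdet n g = 0"
  unfolding fdet_def
  by (rule det_identical_rows[of _ n i j]) (use assms in auto)

lemma fdet_identical_cols:
  assumes "i < n" "j < n" "i \<noteq> j" "\<And>k. k < n \<Longrightarrow> g k i = g k j"
  shows "fdet n g = 0"
  using fdet_identical_rows[of i n j "\<lambda>i j. g j i"] fdet_transpose[of n g] assms by simp

text \<open>The zero block has n - k rows and k + 1 columns, together more than n, so every
  permutation hits it. It serves both to bound leading monomials and to restrict the expansion of
  the orthogonal polynomials to \<open>mu\<close> inside \<open>lam\<close>.\<close>

lemma fdet_zero_block:
  assumes k: "k < n" and zero: "\<And>i j. k \<le> i \<Longrightarrow> i < n \<Longrightarrow> j \<le> k \<Longrightarrow> g i j = 0"
  shows "fdet n g = 0"
proof -
  have "(\<Prod>j<n. g (p j) j) = 0" if p: "p permutes {..<n}" for p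
  proof -
    have "\<exists>j\<le>k. k \<le> p j"
    proof (rule ccontr)
      assume "\<not> ?thesis"
      then have "p ` {..k} \<subseteq> {..<k}" by auto
      then have "card (p ` {..k}) \<le> card {..<k}" by (intro card_mono) auto
      moreover have "card (p ` {..k}) = card {..k}"
        by (intro card_image) (meson inj_on_subset permutes_inj[OF p] subset_UNIV)
      ultimately show False by simp
    qed
    then obtain j where "j \<le> k" "k \<le> p j" by blast
    moreover have "p j < n" using permutes_in_image[OF p, of j] \<open>j \<le> k\<close> k by auto
    ultimately have "g (p j) j = 0" "j < n" using zero k by auto
    then show ?thesis by (intro prod_zero) auto
  qed
  then show ?thesis unfolding fdet_sum_col by simp
qed

lemma fdet_upper:
  assumes "\<And>i j. j < i \<Longrightarrow> i < n \<Longrightarrow> g i j = 0"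
  shows "fdet n g = (\<Prod>i<n. g i i)"
proof -
  let ?A = "mat n n (\<lambda>(i, j). g i j)"
  have "det ?A = prod_list (diag_mat ?A)"
    by (rule det_upper_triangular[of _ n]) (use assms in \<open>auto simp: upper_triangular_def\<close>)
  also have "\<dots> = (\<Prod>i<n. g i i)"
    unfolding diag_mat_def
    by (simp add: prod.distinct_set_conv_list[symmetric] atLeast0LessThan)
  finally show ?thesis unfolding fdet_def .
qed

lemma fdet_drop_last_row:
  assumes "\<And>j. j < n \<Longrightarrow> g n j = 0"
  shows "fdet (Suc n) g = g n n * fdet n g"
proof -
  let ?A = "mat (Suc n) (Suc n) (\<lambda>(i, j). g i j)"
  have "det ?A = (\<Sum>j<Suc n. ?A $$ (n, j) * cofactor ?A n j)"
    by (rule laplace_expansion_row) auto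
  also have "\<dots> = g n n * cofactor ?A n n"
    using assms by simp
  also have "cofactor ?A n n = det (mat n n (\<lambda>(i, j). g i j))"
    unfolding cofactor_def mat_delete_def
    by (simp add: mult_2[symmetric]) (rule arg_cong[of _ _ det], auto)
  finally show ?thesis unfolding fdet_def .
qed

lemma fdet_drop_last_col:
  assumes "\<And>i. i < n \<Longrightarrow> g i n = 0"
  shows "fdet (Suc n) g = g n n * fdet n g"
  using fdet_drop_last_row[of n "\<lambda>i j. g j i"] assms
    fdet_transpose[of n g] fdet_transpose[of "Suc n" g] by simp

text \<open>From row \<open>l\<close> on the matrix is unitriangular, so the last rows can be peeled
  off one at a time. This turns a determinant of size \<open>N\<close> into one of size
  \<open>plength lam\<close>, as in \<open>sigma_ASC\<close>.\<close>

lemma fdet_stable: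
  assumes "l \<le> n" "\<And>i j. l \<le> i \<Longrightarrow> j < i \<Longrightarrow> g i j = 0" "\<And>i. l \<le> i \<Longrightarrow> g i i = 1"
  shows "fdet n g = fdet l g"
  using assms(1) by (induction n rule: dec_induct) (auto simp: fdet_drop_last_row assms)

section \<open>Partitions as strictly decreasing sequences\<close>

text \<open>The exponents of the bialternant formula, with indices from 0. For a partition they
  strictly decrease on i < N, so partitions of length at most \<open>N\<close> correspond to
  N-element sets of natural numbers.\<close>

definition shifted :: "nat \<Rightarrow> (nat \<Rightarrow> nat) \<Rightarrow> nat \<Rightarrow> nat" where
  "shifted N lam i = lam i + (N - Suc i)"

lemma partition_zero_iff:
  assumes "is_partition lam"
  shows "lam i = 0 \<longleftrightarrow> plength lam \<le> i"
proof -
  have anti: "antimono lam" and fin: "finite {i. lam i \<noteq> 0}"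
    using assms by (auto simp: is_partition_def)
  obtain n where n: "lam n = 0" using fin by (metis (mono_tags, lifting) infinite_UNIV_nat ex_new_if_finite mem_Collect_eq)
  define l where "l = (LEAST n. lam n = 0)"
  have "lam l = 0" unfolding l_def using n by (rule LeastI)
  then have z: "lam j = 0" if "l \<le> j" for j
    using antimonoD[OF anti that] by simp
  have nz: "lam j \<noteq> 0" if "j < l" for j
    using not_less_Least[of j "\<lambda>n. lam n = 0"] that unfolding l_def by blast
  have "lam i \<noteq> 0 \<longleftrightarrow> i < l" for i
    using z[of i] nz[of i] by linarith
  then have "{i. lam i \<noteq> 0} = {..<l}" by blast
  then have "plength lam = l" unfolding plength_def by simp
  then show ?thesis using z nz not_less by metis
qed

lemma partition_mono: "is_partition lam \<Longrightarrow> i \<le> j \<Longrightarrow> lam j \<le> lam i"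
  by (auto simp: is_partition_def dest: antimonoD)

lemma is_partition_zero: "is_partition (\<lambda>_. 0)"
  by (auto simp: is_partition_def antimono_def)

lemma shifted_less:
  assumes "is_partition lam" "i < j" "j < N"
  shows "shifted N lam j < shifted N lam i"
  using partition_mono[OF assms(1), of i j] assms(2,3) by (auto simp: shifted_def)

lemma shifted_le:
  assumes "is_partition lam" "i \<le> j" "j < N"
  shows "shifted N lam j \<le> shifted N lam i"
  using shifted_less[OF assms(1), of i j N] assms by (cases "i = j") auto

lemma shifted_less_iff:
  assumes "is_partition lam" "i < N" "j < N"
  shows "shifted N lam j < shifted N lam i \<longleftrightarrow> i < j"
  using shifted_less[OF assms(1), of i j N] shifted_le[OF assms(1), of j i N] assms(2,3)
  by (metis linorder_not_less)

lemma shifted_inj: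
  assumes "is_partition lam"
  shows "inj_on (shifted N lam) {..<N}"
  by (rule inj_onI) (metis assms lessThan_iff less_irrefl linorder_less_linear shifted_less)

text \<open>The position of an entry is recovered from the set alone, by counting the larger
  entries; hence the set determines the partition.\<close>

lemma card_shifted_greater:
  assumes "is_partition lam" "i < N"
  shows "card {x \<in> shifted N lam ` {..<N}. shifted N lam i < x} = i"
proof -
  have "{x \<in> shifted N lam ` {..<N}. shifted N lam i < x} = shifted N lam ` {..<i}"
    using assms by (auto simp: shifted_less_iff)
  moreover have "inj_on (shifted N lam) {..<i}"
    by (rule inj_on_subset[OF shifted_inj[OF assms(1), of N]]) (use assms(2) in auto)
  ultimately show ?thesis by (simp add: card_image)
qed

lemma shifted_image_cancel:
  assumes "is_partition lam" "is_partition mu" "plength lam \<le> N" "plength mu \<le> N"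
    and img: "shifted N lam ` {..<N} = shifted N mu ` {..<N}"
  shows "lam = mu"
proof
  fix i
  show "lam i = mu i"
  proof (cases "i < N")
    case True
    have "shifted N lam i \<in> shifted N mu ` {..<N}" using img True by blast
    then obtain j where j: "j < N" "shifted N lam i = shifted N mu j" by auto
    then have "i = j"
      using card_shifted_greater[OF assms(1) True] card_shifted_greater[OF assms(2) j(1)] img
      by simp
    then show ?thesis using j by (simp add: shifted_def)
  next
    case False
    then show ?thesis
      using partition_zero_iff[OF assms(1), of i] partition_zero_iff[OF assms(2), of i] assms(3,4)
      by simp
  qed
qed

text \<open>Sorting: the values of \<open>f\<close> in decreasing order, minus the staircase N - 1,
  ..., 0, form a partition, and \<open>p\<close> records where each value lands.\<close>

lemma ex_shifted_permutes:
  assumes inj: "inj_on f {..<N}"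
  obtains lam p where "is_partition lam" "plength lam \<le> N" "p permutes {..<N}"
    "\<And>i. i < N \<Longrightarrow> f i = shifted N lam (p i)"
proof -
  define S where "S = f ` {..<N}"
  have finS: "finite S" "card S = N" using inj by (auto simp: S_def card_image)
  define xs where "xs = rev (sorted_list_of_set S)"
  have xs: "length xs = N" "set xs = S" "distinct xs"
    using finS by (auto simp: xs_def)
  have desc: "xs ! j < xs ! i" if "i < j" "j < N" for i j
  proof -
    have "sorted_list_of_set S ! (N - Suc j) < sorted_list_of_set S ! (N - Suc i)"
      by (rule sorted_wrt_nth_less[of "(<)"]) (use that finS in auto)
    then show ?thesis
      using that xs(1) unfolding xs_def by (simp add: rev_nth)
  qed
  \<comment> \<open>After position i there are N - 1 - i smaller entries, all distinct, so the
    truncated subtraction in the definition of \<open>lam\<close> loses nothing.\<close>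
  have big_aux: "i < N \<Longrightarrow> N - Suc i = k \<Longrightarrow> k \<le> xs ! i" for k i
  proof (induction k arbitrary: i)
    case (Suc k)
    then have "Suc i < N" "N - Suc (Suc i) = k" by linarith+
    then have "k \<le> xs ! Suc i" by (rule Suc.IH)
    then show ?case using desc[of i "Suc i"] \<open>Suc i < N\<close> by linarith
  qed simp
  then have big: "N - Suc i \<le> xs ! i" if "i < N" for i
    using that by blast
  define lam where "lam i = (if i < N then xs ! i - (N - Suc i) else 0)" for i
  have sh: "shifted N lam i = xs ! i" if "i < N" for i
    using that big[OF that] by (simp add: shifted_def lam_def)
  have step: "lam (Suc i) \<le> lam i" for i
    using desc[of i "Suc i"] big[of i] big[of "Suc i"] unfolding lam_def by auto
  have part: "is_partition lam"
    unfolding is_partition_def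
  proof
    show "antimono lam" by (rule antimonoI) (use step in \<open>rule lift_Suc_antimono_le\<close>)
    show "finite {i. lam i \<noteq> 0}"
      by (rule finite_subset[of _ "{..<N}"]) (auto simp: lam_def)
  qed
  have len: "plength lam \<le> N"
    using partition_zero_iff[OF part, of N] by (simp add: lam_def)
  have ex: "\<exists>j<N. xs ! j = f i" if "i < N" for i
    using xs that unfolding S_def by (metis image_eqI in_set_conv_nth lessThan_iff)
  define p where "p i = (if i < N then (SOME j. j < N \<and> xs ! j = f i) else i)" for i
  have p: "p i < N \<and> xs ! p i = f i" if "i < N" for i
    using someI_ex[OF ex[OF that]] that unfolding p_def by simp
  have "inj_on p {..<N}"
    by (rule inj_onI) (metis inj inj_onD lessThan_iff p)
  then have "bij_betw p {..<N} {..<N}"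
    unfolding bij_betw_def
    by (metis card_image card_subset_eq finite_lessThan image_subsetI lessThan_iff p)
  then have "p permutes {..<N}"
    by (rule bij_imp_permutes) (simp add: p_def)
  then show ?thesis using that[OF part len] p sh by metis
qed

definition bounded_partitions :: "nat \<Rightarrow> nat \<Rightarrow> (nat \<Rightarrow> nat) set" where
  "bounded_partitions N M =
     {mu. is_partition mu \<and> plength mu \<le> N \<and> shifted N mu ` {..<N} \<subseteq> {..<M}}"

lemma finite_bounded_partitions: "finite (bounded_partitions N M)"
proof -
  have "bounded_partitions N M \<subseteq> {f. (\<forall>i. (i \<in> {..<N} \<longrightarrow> f i \<in> {..<M}) \<and> (i \<notin> {..<N} \<longrightarrow> f i = 0))}"
  proof
    fix mu assume mu: "mu \<in> bounded_partitions N M"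
    have "mu i < M" if "i < N" for i
    proof -
      have "shifted N mu i < M" using mu that by (auto simp: bounded_partitions_def)
      then show ?thesis by (simp add: shifted_def)
    qed
    moreover have "mu i = 0" if "\<not> i < N" for i
      using mu that partition_zero_iff[of mu i] by (simp add: bounded_partitions_def)
    ultimately show "mu \<in> {f. \<forall>i. (i \<in> {..<N} \<longrightarrow> f i \<in> {..<M}) \<and> (i \<notin> {..<N} \<longrightarrow> f i = 0)}"
      by simp
  qed
  then show ?thesis
    by (rule finite_subset) (rule finite_set_of_finite_funs, auto)
qed

text \<open>The N-element subsets of {0, ..., M-1} are labelled by partitions through
  \<open>shifted\<close>. Expanding by rows gives a sum over functions \<open>f\<close>; a repeated
  value kills its term, and an injective \<open>f\<close> is a permutation of a decreasing
  sequence.\<close>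

lemma cauchy_binet:
  fixes T U :: "nat \<Rightarrow> nat \<Rightarrow> 'a :: comm_ring_1"
  shows "fdet N (\<lambda>i j. \<Sum>k<M. T i k * U k j) =
    (\<Sum>mu\<in>bounded_partitions N M.
       fdet N (\<lambda>i j. T i (shifted N mu j)) * fdet N (\<lambda>i j. U (shifted N mu i) j))"
proof -
  define g where "g f = (\<Prod>i<N. T i (f i)) * fdet N (\<lambda>i j. U (f i) j)" for f
  let ?F = "PiE {..<N} (\<lambda>_. {..<M})"
  let ?G = "{f \<in> ?F. inj_on f {..<N}}"
  let ?P = "{p. p permutes {..<N}}"
  let ?c = "\<lambda>(mu, p). restrict (\<lambda>i. shifted N mu (p i)) {..<N}"
  have "fdet N (\<lambda>i j. \<Sum>k<M. T i k * U k j) =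
      (\<Sum>p\<in>?P. of_int (sign p) * (\<Sum>f\<in>?F. \<Prod>i<N. T i (f i) * U (f i) (p i)))"
    unfolding fdet_sum by (subst prod_sum_PiE) auto
  also have "\<dots> = (\<Sum>f\<in>?F. g f)"
    unfolding g_def fdet_sum sum_distrib_left
    by (subst sum.swap) (auto intro!: sum.cong simp: prod.distrib mult_ac)
  also have "\<dots> = (\<Sum>f\<in>?G. g f)"
  proof (rule sum.mono_neutral_right)
    show "finite ?F" by (auto intro: finite_PiE)
    show "\<forall>f\<in>?F - ?G. g f = 0"
    proof
      fix f assume "f \<in> ?F - ?G"
      then obtain i j where "i < N" "j < N" "i \<noteq> j" "f i = f j" by (auto simp: inj_on_def)
      then have "fdet N (\<lambda>i j. U (f i) j) = 0" by (intro fdet_identical_rows[of i N j]) auto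
      then show "g f = 0" by (simp add: g_def)
    qed
  qed auto
  also have "\<dots> = (\<Sum>x\<in>bounded_partitions N M \<times> ?P. g (?c x))"
  proof (rule sum.reindex_bij_betw[symmetric])
    show "bij_betw ?c (bounded_partitions N M \<times> ?P) ?G"
      unfolding bij_betw_def
    proof
      show "inj_on ?c (bounded_partitions N M \<times> ?P)"
      proof (rule inj_onI, clarify)
        fix mu p mu' p'
        assume mu: "mu \<in> bounded_partitions N M" and mu': "mu' \<in> bounded_partitions N M"
          and p: "p permutes {..<N}" and p': "p' permutes {..<N}"
          and "restrict (\<lambda>i. shifted N mu (p i)) {..<N} = restrict (\<lambda>i. shifted N mu' (p' i)) {..<N}"
        then have eq: "shifted N mu (p i) = shifted N mu' (p' i)" if "i < N" for i
          using that by (metis lessThan_iff restrict_apply')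
        have "shifted N mu ` p ` {..<N} = shifted N mu' ` p' ` {..<N}"
          unfolding image_image using eq by auto
        then have "mu = mu'"
          using mu mu' permutes_image[OF p] permutes_image[OF p']
          by (intro shifted_image_cancel[of mu mu' N]) (auto simp: bounded_partitions_def)
        have "p i = p' i" for i
        proof (cases "i < N")
          case True
          then have "p i < N" "p' i < N"
            using permutes_in_image[OF p, of i] permutes_in_image[OF p', of i] by auto
          then show ?thesis
            using eq[OF True] \<open>mu = mu'\<close> shifted_inj[of mu N] mu
            by (auto simp: bounded_partitions_def dest: inj_onD)
        next
          case False
          then show ?thesis using p p' by (simp add: permutes_def)
        qed
        then have "p = p'" ..
        with \<open>mu = mu'\<close> show "mu = mu' \<and> p = p'" ..
      qed
      show "?c ` (bounded_partitions N M \<times> ?P) = ?G"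
      proof (intro equalityI subsetI)
        fix f assume "f \<in> ?c ` (bounded_partitions N M \<times> ?P)"
        then obtain mu p where mu: "mu \<in> bounded_partitions N M" and p: "p permutes {..<N}"
          and f: "f = restrict (\<lambda>i. shifted N mu (p i)) {..<N}" by auto
        have pin: "p i < N" if "i < N" for i using permutes_in_image[OF p, of i] that by auto
        have part: "is_partition mu" and sub: "shifted N mu ` {..<N} \<subseteq> {..<M}"
          using mu by (auto simp: bounded_partitions_def)
        have "inj_on f {..<N}"
        proof (rule inj_onI)
          fix i j assume ij: "i \<in> {..<N}" "j \<in> {..<N}" "f i = f j"
          then have "shifted N mu (p i) = shifted N mu (p j)" by (simp add: f)
          then have "p i = p j"
            using inj_onD[OF shifted_inj[OF part]] pin ij by simp
          then show "i = j" using permutes_inj[OF p] by (simp add: inj_eq)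
        qed
        moreover have "f \<in> ?F" using sub pin by (auto simp: f)
        ultimately show "f \<in> ?G" by simp
      next
        fix f assume f: "f \<in> ?G"
        then have "inj_on f {..<N}" by simp
        then obtain mu p where mp: "is_partition mu" "plength mu \<le> N" "p permutes {..<N}"
          and fi: "\<And>i. i < N \<Longrightarrow> f i = shifted N mu (p i)"
          by (rule ex_shifted_permutes) blast
        have "shifted N mu ` p ` {..<N} = f ` {..<N}"
          unfolding image_image using fi by auto
        then have "shifted N mu ` {..<N} \<subseteq> {..<M}"
          using f permutes_image[OF mp(3)] by auto
        then have "mu \<in> bounded_partitions N M" using mp by (simp add: bounded_partitions_def)
        moreover have "f = ?c (mu, p)"
          using f fi by (simp add: PiE_def extensional_def restrict_def fun_eq_iff)
        ultimately show "f \<in> ?c ` (bounded_partitions N M \<times> ?P)"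
          using mp by blast
      qed
    qed
  qed
  also have "\<dots> = (\<Sum>mu\<in>bounded_partitions N M. \<Sum>p\<in>?P. g (?c (mu, p)))"
    unfolding sum.cartesian_product by (rule sum.cong[OF refl]) (simp add: split_beta)
  also have "\<dots> = (\<Sum>mu\<in>bounded_partitions N M.
       fdet N (\<lambda>i j. T i (shifted N mu j)) * fdet N (\<lambda>i j. U (shifted N mu i) j))"
  proof (rule sum.cong[OF refl])
    fix mu
    have "g (?c (mu, p)) = of_int (sign p) * (\<Prod>i<N. T i (shifted N mu (p i))) *
        fdet N (\<lambda>i j. U (shifted N mu i) j)" if "p permutes {..<N}" for p
    proof -
      have "fdet N (\<lambda>i j. U (?c (mu, p) i) j) = fdet N (\<lambda>i j. U (shifted N mu (p i)) j)"
        by (rule fdet_cong) auto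
      then show ?thesis
        unfolding g_def using fdet_permute_rows[OF that, of "\<lambda>i j. U (shifted N mu i) j"]
        by (simp add: mult_ac)
    qed
    then have "(\<Sum>p\<in>?P. g (?c (mu, p))) =
        (\<Sum>p\<in>?P. of_int (sign p) * (\<Prod>i<N. T i (shifted N mu (p i))) *
          fdet N (\<lambda>i j. U (shifted N mu i) j))"
      by (intro sum.cong[OF refl]) (unfold mem_Collect_eq)
    then show "(\<Sum>p\<in>?P. g (?c (mu, p))) =
        fdet N (\<lambda>i j. T i (shifted N mu j)) * fdet N (\<lambda>i j. U (shifted N mu i) j)"
      unfolding fdet_sum[of N "\<lambda>i j. T i (shifted N mu j)"] sum_distrib_right .
  qed
  finally show ?thesis .
qed

section \<open>Substitution in multivariate polynomials\<close>

lemma mpoly_induct [case_names single add]: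
  fixes P :: mpoly
  assumes "\<And>m c. R (Poly_Mapping.single m c)" "\<And>A B. R A \<Longrightarrow> R B \<Longrightarrow> R (A + B)"
  shows "R P"
proof (induction P rule: Poly_Mapping.update_induct)
  case const
  have "R (Poly_Mapping.single 0 0)" by (rule assms(1))
  then show ?case by simp
next
  case (update f a b)
  have "Poly_Mapping.update a b f = f + Poly_Mapping.single a b"
    using update(1)
    by (intro poly_mapping_eqI)
       (auto simp: lookup_update lookup_add lookup_single when_def in_keys_iff)
  then show ?case using assms update by simp
qed

lemma mconst_add: "mconst (a + b) = mconst a + mconst b"
  and mconst_mult: "mconst (a * b) = mconst a * mconst b"
  and mconst_0 [simp]: "mconst 0 = 0"
  and mconst_1 [simp]: "mconst 1 = 1"
  and mconst_uminus: "mconst (- a) = - mconst a"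
  by (simp_all add: mconst_def single_add mult_single single_uminus)

lemma lookup_mconst_mult [simp]:
  "Poly_Mapping.lookup (mconst c * P) m = c * Poly_Mapping.lookup P m"
proof (induction P rule: mpoly_induct)
  case (single k d)
  then show ?case by (simp add: mconst_def mult_single lookup_single when_def)
next
  case (add A B)
  then show ?case by (simp add: distrib_left lookup_add)
qed

lemma lookup_of_int_mult [simp]:
  "Poly_Mapping.lookup (of_int k * (P :: mpoly)) m = of_int k * Poly_Mapping.lookup P m"
  using lookup_mconst_mult[of "of_int k" P m] by (simp add: mconst_def)

definition mon_ev :: "(nat \<Rightarrow> mpoly) \<Rightarrow> monom \<Rightarrow> mpoly" where
  "mon_ev f m = (\<Prod>i\<in>Poly_Mapping.keys m. f i ^ Poly_Mapping.lookup m i)"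

lemma mon_ev_superset:
  assumes "finite A" "Poly_Mapping.keys m \<subseteq> A"
  shows "mon_ev f m = (\<Prod>i\<in>A. f i ^ Poly_Mapping.lookup m i)"
  unfolding mon_ev_def
  by (rule prod.mono_neutral_left) (use assms in \<open>auto simp: in_keys_iff\<close>)

lemma mon_ev_add: "mon_ev f (a + b) = mon_ev f a * mon_ev f b"
proof -
  let ?A = "Poly_Mapping.keys a \<union> Poly_Mapping.keys b"
  have "mon_ev f (a + b) = (\<Prod>i\<in>?A. f i ^ Poly_Mapping.lookup (a + b) i)"
    by (rule mon_ev_superset) (auto dest: subsetD[OF keys_add])
  also have "\<dots> = (\<Prod>i\<in>?A. f i ^ Poly_Mapping.lookup a i) * (\<Prod>i\<in>?A. f i ^ Poly_Mapping.lookup b i)"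
    by (simp add: lookup_add power_add prod.distrib)
  also have "\<dots> = mon_ev f a * mon_ev f b"
    by (subst (1 2) mon_ev_superset[of ?A]) auto
  finally show ?thesis .
qed

lemma mon_ev_0 [simp]: "mon_ev f 0 = 1"
  by (simp add: mon_ev_def)

lemma mon_ev_single: "mon_ev f (Poly_Mapping.single i k) = f i ^ k"
  by (subst mon_ev_superset[of "{i}"]) auto

text \<open>A ring endomorphism that fixes constants. It serves to permute variables, to identify
  two variables in the factor theorem, and to specialize one variable to a number.\<close>

definition msubst :: "(nat \<Rightarrow> mpoly) \<Rightarrow> mpoly \<Rightarrow> mpoly" where
  "msubst f P = (\<Sum>m\<in>Poly_Mapping.keys P. mconst (Poly_Mapping.lookup P m) * mon_ev f m)"

lemma msubst_add: "msubst f (P + Q) = msubst f P + msubst f Q"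
  unfolding msubst_def
  by (rule setsum_keys_plus_distrib) (auto simp: mconst_add distrib_right)

lemma msubst_single: "msubst f (Poly_Mapping.single m c) = mconst c * mon_ev f m"
  by (cases "c = 0") (auto simp: msubst_def)

lemma msubst_mconst [simp]: "msubst f (mconst c) = mconst c"
  by (simp add: mconst_def[of c] msubst_single)

lemma msubst_0 [simp]: "msubst f 0 = 0"
  by (simp add: msubst_def)

lemma msubst_1 [simp]: "msubst f 1 = 1"
  using msubst_mconst[of f 1] by simp

lemma msubst_mvar [simp]: "msubst f (mvar i) = f i"
  by (simp add: mvar_def msubst_single mon_ev_single)

lemma msubst_mult: "msubst f (P * Q) = msubst f P * msubst f Q"
proof (induction P rule: mpoly_induct)
  case (single m c)
  show ?case
  proof (induction Q rule: mpoly_induct)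
    case (single k d)
    then show ?case by (simp add: mult_single msubst_single mon_ev_add mconst_mult mult_ac)
  qed (simp add: distrib_left msubst_add)
qed (simp add: distrib_right msubst_add)

lemma msubst_uminus: "msubst f (- P) = - msubst f P"
  using msubst_add[of f P "- P"] by (simp add: eq_neg_iff_add_eq_0 add.commute)

lemma msubst_diff: "msubst f (P - Q) = msubst f P - msubst f Q"
  using msubst_add[of f P "- Q"] by (simp add: msubst_uminus)

lemma msubst_sum: "msubst f (\<Sum>x\<in>A. g x) = (\<Sum>x\<in>A. msubst f (g x))"
  by (induction A rule: infinite_finite_induct) (auto simp: msubst_add)

lemma msubst_prod: "msubst f (\<Prod>x\<in>A. g x) = (\<Prod>x\<in>A. msubst f (g x))"
  by (induction A rule: infinite_finite_induct) (auto simp: msubst_mult)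

lemma msubst_of_int: "msubst f (of_int k) = of_int k"
  using msubst_mconst[of f "of_int k"] by (simp add: mconst_def)

lemma msubst_fdet: "msubst f (fdet n g) = fdet n (\<lambda>i j. msubst f (g i j))"
  by (simp add: fdet_sum msubst_sum msubst_mult msubst_prod msubst_of_int)

lemma mvar_power: "mvar i ^ k = Poly_Mapping.single (Poly_Mapping.single i k) 1"
  by (induction k) (simp_all add: mvar_def mult_single single_add[symmetric])

lemma prod_single:
  "(\<Prod>i\<in>A. Poly_Mapping.single (f i) (g i)) =
    Poly_Mapping.single (\<Sum>i\<in>A. f i :: monom) (\<Prod>i\<in>A. g i :: complex)"
  by (induction A rule: infinite_finite_induct) (auto simp: mult_single)

lemma mon_ev_mvar_comp:
  "mon_ev (\<lambda>i. mvar (p i)) m =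
    Poly_Mapping.single (\<Sum>i\<in>Poly_Mapping.keys m. Poly_Mapping.single (p i) (Poly_Mapping.lookup m i)) 1"
  by (simp add: mon_ev_def mvar_power prod_single)

lemma lookup_map_key: "inj p \<Longrightarrow> Poly_Mapping.lookup (Poly_Mapping.map_key p m) i = Poly_Mapping.lookup m (p i)"
  by (simp add: map_key.rep_eq)

lemma sum_single_lookup:
  fixes m :: monom
  assumes "finite A" "Poly_Mapping.keys m \<subseteq> A"
  shows "(\<Sum>i\<in>A. Poly_Mapping.single i (Poly_Mapping.lookup m i)) = m"
proof (rule poly_mapping_eqI)
  fix k
  have "(\<Sum>i\<in>A. Poly_Mapping.lookup m i when i = k) = (if k \<in> A then Poly_Mapping.lookup m k else 0)"
    using assms(1) by (simp add: when_def sum.delta)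
  then show "Poly_Mapping.lookup (\<Sum>i\<in>A. Poly_Mapping.single i (Poly_Mapping.lookup m i)) k =
      Poly_Mapping.lookup m k"
    using assms by (auto simp: lookup_sum lookup_single in_keys_iff)
qed

lemma msubst_mvar_id: "msubst mvar P = P"
proof (induction P rule: mpoly_induct)
  case (single m c)
  then show ?case
    using mon_ev_mvar_comp[of "\<lambda>i. i" m]
    by (simp add: msubst_single sum_single_lookup mconst_def mult_single)
qed (simp add: msubst_add)

lemma sum_single_bij:
  fixes m :: monom
  assumes "bij p"
  shows "(\<Sum>i\<in>Poly_Mapping.keys m. Poly_Mapping.single (p i) (Poly_Mapping.lookup m i)) =
    Poly_Mapping.map_key (Hilbert_Choice.inv p) m"
proof (rule poly_mapping_eqI)
  fix k
  have "(\<Sum>i\<in>Poly_Mapping.keys m. Poly_Mapping.lookup m i when p i = k) =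
      (\<Sum>i\<in>Poly_Mapping.keys m. if i = Hilbert_Choice.inv p k then Poly_Mapping.lookup m i else 0)"
    using assms by (intro sum.cong) (auto simp: when_def bij_def surj_f_inv_f)
  also have "\<dots> = Poly_Mapping.lookup m (Hilbert_Choice.inv p k)"
    by (simp add: sum.delta in_keys_iff)
  finally show "Poly_Mapping.lookup (\<Sum>i\<in>Poly_Mapping.keys m. Poly_Mapping.single (p i) (Poly_Mapping.lookup m i)) k
      = Poly_Mapping.lookup (Poly_Mapping.map_key (Hilbert_Choice.inv p) m) k"
    using assms by (simp add: lookup_sum lookup_single lookup_map_key bij_imp_bij_inv bij_is_inj)
qed

lemma map_key_inv:
  assumes "bij p"
  shows "Poly_Mapping.map_key p (Poly_Mapping.map_key (Hilbert_Choice.inv p) m) = m"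
    and "Poly_Mapping.map_key (Hilbert_Choice.inv p) (Poly_Mapping.map_key p m) = m"
  using assms
  by (auto intro!: poly_mapping_eqI simp: lookup_map_key bij_is_inj bij_imp_bij_inv inv_f_f
      surj_f_inv_f bij_is_surj)

text \<open>Links two descriptions of symmetry: invariance of coefficients under
  \<open>map_key\<close>, as in \<open>SymPoly_le\<close>, and invariance under substitution, which
  is multiplicative and so passes to products and quotients.\<close>

lemma lookup_msubst_bij:
  assumes "bij p"
  shows "Poly_Mapping.lookup (msubst (\<lambda>i. mvar (p i)) P) m =
    Poly_Mapping.lookup P (Poly_Mapping.map_key p m)"
proof (induction P rule: mpoly_induct)
  case (single k c)
  have "(Poly_Mapping.map_key (Hilbert_Choice.inv p) k = m) = (k = Poly_Mapping.map_key p m)"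
    using map_key_inv[OF assms] by metis
  then show ?case
    by (simp add: msubst_single mon_ev_mvar_comp sum_single_bij[OF assms] lookup_single when_def)
qed (simp add: msubst_add lookup_add)

section \<open>Univariate polynomials in a chosen variable\<close>

definition at_var :: "nat \<Rightarrow> complex poly \<Rightarrow> mpoly" where
  "at_var j p = (\<Sum>k\<le>degree p. Poly_Mapping.single (Poly_Mapping.single j k) (coeff p k))"

lemma at_var_sum:
  assumes "degree p \<le> D"
  shows "at_var j p = (\<Sum>k\<le>D. Poly_Mapping.single (Poly_Mapping.single j k) (coeff p k))"
  unfolding at_var_def
  by (rule sum.mono_neutral_left) (use assms in \<open>auto simp: coeff_eq_0\<close>)

lemma at_var_0 [simp]: "at_var j 0 = 0"
  by (simp add: at_var_def)

lemma at_var_add: "at_var j (p + q) = at_var j p + at_var j q"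
proof -
  let ?D = "max (degree p) (degree q)"
  have "degree (p + q) \<le> ?D" by (simp add: degree_add_le_max)
  then show ?thesis
    by (subst (1 2 3) at_var_sum[of _ ?D]) (simp_all add: single_add sum.distrib)
qed

lemma at_var_pCons: "at_var j (pCons a p) = mconst a + mvar j * at_var j p"
proof -
  have "at_var j (pCons a p) =
      (\<Sum>k\<le>Suc (degree p). Poly_Mapping.single (Poly_Mapping.single j k) (coeff (pCons a p) k))"
    by (rule at_var_sum) (rule degree_pCons_le)
  also have "\<dots> = mconst a +
      (\<Sum>k\<le>degree p. Poly_Mapping.single (Poly_Mapping.single j (Suc k)) (coeff p k))"
    by (subst sum.atMost_Suc_shift) (simp add: mconst_def)
  also have "(\<Sum>k\<le>degree p. Poly_Mapping.single (Poly_Mapping.single j (Suc k)) (coeff p k)) =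
      mvar j * at_var j p"
    by (simp add: at_var_def sum_distrib_left mvar_def mult_single single_add[symmetric])
  finally show ?thesis .
qed

lemma at_var_smult: "at_var j (smult a p) = mconst a * at_var j p"
  by (induction p) (simp_all add: at_var_pCons mconst_mult distrib_left mult_ac)

lemma at_var_mult: "at_var j (p * q) = at_var j p * at_var j q"
  by (induction p) (simp_all add: at_var_pCons at_var_add at_var_smult algebra_simps)

lemma at_var_1 [simp]: "at_var j 1 = 1"
  by (simp add: one_pCons at_var_pCons)

lemma at_var_prod: "at_var j (\<Prod>x\<in>A. f x) = (\<Prod>x\<in>A. at_var j (f x))"
  by (induction A rule: infinite_finite_induct) (auto simp: at_var_mult)

lemma at_var_sum_distrib: "at_var j (\<Sum>x\<in>A. f x) = (\<Sum>x\<in>A. at_var j (f x))"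
  by (induction A rule: infinite_finite_induct) (auto simp: at_var_add)

lemma msubst_at_var_mvar: "s j = mvar k \<Longrightarrow> msubst s (at_var j p) = at_var k p"
  by (induction p) (simp_all add: at_var_pCons msubst_add msubst_mult)

lemma msubst_at_var_mconst: "s j = mconst a \<Longrightarrow> msubst s (at_var j p) = mconst (poly p a)"
  by (induction p) (simp_all add: at_var_pCons msubst_add msubst_mult mconst_add mconst_mult)

text \<open>The common bound \<open>D\<close> makes all factors sums over the same finite range, so
  that the product expands over one set of functions. The same expansion yields the factorization of
  coefficients and that of moments.\<close>

lemma prod_at_var:
  "\<exists>D. (\<forall>j<N. degree (f j) \<le> D) \<and> (\<Prod>j<N. at_var j (f j)) =
    (\<Sum>g\<in>PiE {..<N} (\<lambda>_. {..D}). Poly_Mapping.single (\<Sum>j<N. Poly_Mapping.single j (g j))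
        (\<Prod>j<N. coeff (f j) (g j)))"
proof (intro exI conjI)
  let ?D = "\<Sum>j<N. degree (f j)"
  have D: "degree (f j) \<le> ?D" if "j < N" for j
    using that by (intro member_le_sum) auto
  then show "\<forall>j<N. degree (f j) \<le> ?D" by blast
  have "(\<Prod>j<N. at_var j (f j)) =
      (\<Prod>j<N. \<Sum>k\<le>?D. Poly_Mapping.single (Poly_Mapping.single j k) (coeff (f j) k))"
    using D by (intro prod.cong[OF refl] at_var_sum) auto
  also have "\<dots> = (\<Sum>g\<in>PiE {..<N} (\<lambda>_. {..?D}).
      \<Prod>j<N. Poly_Mapping.single (Poly_Mapping.single j (g j)) (coeff (f j) (g j)))"
    by (rule prod_sum_PiE) auto
  finally show "(\<Prod>j<N. at_var j (f j)) =
    (\<Sum>g\<in>PiE {..<N} (\<lambda>_. {..?D}). Poly_Mapping.single (\<Sum>j<N. Poly_Mapping.single j (g j))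
        (\<Prod>j<N. coeff (f j) (g j)))"
    by (simp add: prod_single)
qed

lemma lookup_sum_single_lessThan:
  "Poly_Mapping.lookup (\<Sum>j<(N :: nat). Poly_Mapping.single j (g j)) i = (if i < N then g i else (0 :: nat))"
  by (simp add: lookup_sum lookup_single when_def sum.delta)

lemma lookup_prod_at_var:
  "Poly_Mapping.lookup (\<Prod>j<N. at_var j (f j)) m =
    (if Poly_Mapping.keys m \<subseteq> {..<N} then \<Prod>j<N. coeff (f j) (Poly_Mapping.lookup m j) else 0)"
proof -
  obtain D where D: "\<forall>j<N. degree (f j) \<le> D" and eq: "(\<Prod>j<N. at_var j (f j)) =
    (\<Sum>g\<in>PiE {..<N} (\<lambda>_. {..D}). Poly_Mapping.single (\<Sum>j<N. Poly_Mapping.single j (g j))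
        (\<Prod>j<N. coeff (f j) (g j)))"
    using prod_at_var[of N f] by blast
  let ?F = "PiE {..<N} (\<lambda>_. {..D})"
  let ?g = "restrict (Poly_Mapping.lookup m) {..<N}"
  have iff: "(\<Sum>j<N. Poly_Mapping.single j (g j)) = m \<longleftrightarrow> Poly_Mapping.keys m \<subseteq> {..<N} \<and> g = ?g"
    if g: "g \<in> ?F" for g
  proof
    assume eq: "(\<Sum>j<N. Poly_Mapping.single j (g j)) = m"
    have l: "Poly_Mapping.lookup m i = (if i < N then g i else 0)" for i
      unfolding eq[symmetric] by (rule lookup_sum_single_lessThan)
    have "g = ?g" using g by (auto simp: l PiE_def extensional_def fun_eq_iff)
    moreover have "Poly_Mapping.keys m \<subseteq> {..<N}"
      by (auto simp: in_keys_iff l split: if_splits)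
    ultimately show "Poly_Mapping.keys m \<subseteq> {..<N} \<and> g = ?g" by simp
  next
    assume *: "Poly_Mapping.keys m \<subseteq> {..<N} \<and> g = ?g"
    then have "(\<Sum>j<N. Poly_Mapping.single j (g j)) =
        (\<Sum>j<N. Poly_Mapping.single j (Poly_Mapping.lookup m j))" by simp
    then show "(\<Sum>j<N. Poly_Mapping.single j (g j)) = m"
      using * sum_single_lookup[of "{..<N}" m] by simp
  qed
  have "Poly_Mapping.lookup (\<Prod>j<N. at_var j (f j)) m =
      (\<Sum>g\<in>?F. if Poly_Mapping.keys m \<subseteq> {..<N} \<and> g = ?g then \<Prod>j<N. coeff (f j) (g j) else 0)"
    unfolding eq lookup_sum lookup_single when_def
    by (rule sum.cong[OF refl]) (simp only: iff)
  also have "\<dots> = (if Poly_Mapping.keys m \<subseteq> {..<N} \<and> ?g \<in> ?F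
      then \<Prod>j<N. coeff (f j) (Poly_Mapping.lookup m j) else 0)"
  proof (cases "Poly_Mapping.keys m \<subseteq> {..<N}")
    case True
    have "(\<Sum>g\<in>?F. if g = ?g then \<Prod>j<N. coeff (f j) (g j) else 0) =
        (if ?g \<in> ?F then \<Prod>j<N. coeff (f j) (?g j) else 0)"
      by (rule sum.delta) (simp add: finite_PiE)
    also have "(\<Prod>j<N. coeff (f j) (?g j)) = (\<Prod>j<N. coeff (f j) (Poly_Mapping.lookup m j))"
      by (rule prod.cong[OF refl]) simp
    finally show ?thesis using True by (simp only: simp_thms)
  qed (simp only: simp_thms if_False sum.neutral_const)
  also have "\<dots> = (if Poly_Mapping.keys m \<subseteq> {..<N}
      then \<Prod>j<N. coeff (f j) (Poly_Mapping.lookup m j) else 0)"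
  proof (cases "?g \<in> ?F")
    case False
    then obtain j where j: "j < N" "D < Poly_Mapping.lookup m j"
      by (auto simp: PiE_iff not_le)
    then have "degree (f j) < Poly_Mapping.lookup m j" using D le_less_trans by blast
    then have "(\<Prod>j<N. coeff (f j) (Poly_Mapping.lookup m j)) = 0"
      using j by (intro prod_zero bexI[of _ j]) (auto simp: coeff_eq_0)
    then show ?thesis by simp
  qed simp
  finally show ?thesis .
qed

section \<open>Product moment functionals\<close>

definition tensor :: "nat \<Rightarrow> (nat \<Rightarrow> complex) \<Rightarrow> mpoly \<Rightarrow> complex" where
  "tensor N M P = (\<Sum>m\<in>Poly_Mapping.keys P.
     Poly_Mapping.lookup P m * (\<Prod>j<N. M (Poly_Mapping.lookup m j)))"

definition moment_fun :: "(nat \<Rightarrow> complex) \<Rightarrow> complex poly \<Rightarrow> complex" where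
  "moment_fun M p = (\<Sum>k\<le>degree p. coeff p k * M k)"

lemma tensor_add: "tensor N M (P + Q) = tensor N M P + tensor N M Q"
  unfolding tensor_def by (rule setsum_keys_plus_distrib) (auto simp: distrib_right)

lemma tensor_single: "tensor N M (Poly_Mapping.single m c) = c * (\<Prod>j<N. M (Poly_Mapping.lookup m j))"
  by (cases "c = 0") (auto simp: tensor_def)

lemma tensor_0 [simp]: "tensor N M 0 = 0"
  by (simp add: tensor_def)

lemma tensor_sum: "tensor N M (\<Sum>x\<in>A. g x) = (\<Sum>x\<in>A. tensor N M (g x))"
  by (induction A rule: infinite_finite_induct) (auto simp: tensor_add)

lemma tensor_mconst: "tensor N M (mconst c * P) = c * tensor N M P"
proof (induction P rule: mpoly_induct)
  case (single m d)
  then show ?case by (simp add: mconst_def mult_single tensor_single)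
qed (simp add: distrib_left tensor_add)

lemma tensor_of_int: "tensor N M (of_int k * P) = of_int k * tensor N M P"
  using tensor_mconst[of N M "of_int k" P] by (simp add: mconst_def)

lemma moment_fun_sum:
  assumes "degree p \<le> D"
  shows "moment_fun M p = (\<Sum>k\<le>D. coeff p k * M k)"
  unfolding moment_fun_def
  by (rule sum.mono_neutral_left) (use assms in \<open>auto simp: coeff_eq_0\<close>)

lemma tensor_prod_at_var:
  "tensor N M (\<Prod>j<N. at_var j (f j)) = (\<Prod>j<N. moment_fun M (f j))"
proof -
  obtain D where D: "\<forall>j<N. degree (f j) \<le> D" and eq: "(\<Prod>j<N. at_var j (f j)) =
    (\<Sum>g\<in>PiE {..<N} (\<lambda>_. {..D}). Poly_Mapping.single (\<Sum>j<N. Poly_Mapping.single j (g j))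
        (\<Prod>j<N. coeff (f j) (g j)))"
    using prod_at_var[of N f] by blast
  have "(\<Prod>j<N. moment_fun M (f j)) = (\<Prod>j<N. \<Sum>k\<le>D. coeff (f j) k * M k)"
    using D by (intro prod.cong[OF refl] moment_fun_sum) auto
  also have "\<dots> = (\<Sum>g\<in>PiE {..<N} (\<lambda>_. {..D}). \<Prod>j<N. coeff (f j) (g j) * M (g j))"
    by (rule prod_sum_PiE) auto
  finally show ?thesis
    by (simp add: eq tensor_sum tensor_single prod.distrib lookup_sum_single_lessThan)
qed

section \<open>Alternants\<close>

definition alternant :: "nat \<Rightarrow> (nat \<Rightarrow> complex poly) \<Rightarrow> mpoly" where
  "alternant N f = fdet N (\<lambda>i j. at_var j (f i))"

lemma lookup_alternant:
  "Poly_Mapping.lookup (alternant N f) m =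
    (if Poly_Mapping.keys m \<subseteq> {..<N} then fdet N (\<lambda>i j. coeff (f i) (Poly_Mapping.lookup m j)) else 0)"
  by (simp add: alternant_def fdet_sum_col lookup_sum lookup_prod_at_var)

text \<open>Andreief's identity. The functional factors over the variables, so both determinants can
  be expanded into a double sum over permutations. For fixed \<open>p\<close> the sum over the
  second permutation is the determinant with rows permuted by \<open>p\<close>; its sign cancels the
  sign already present, and N! equal terms remain.\<close>

lemma tensor_alternant_mult:
  "tensor N M (alternant N f * alternant N g) =
    fact N * fdet N (\<lambda>i j. moment_fun M (f i * g j))"
proof -
  let ?P = "{p. p permutes {..<N}}"
  let ?B = "\<lambda>i j. moment_fun M (f i * g j)"
  have "alternant N f * alternant N g = (\<Sum>p\<in>?P. \<Sum>q\<in>?P. of_int (sign p) * (of_int (sign q) *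
      (\<Prod>j<N. at_var j (f (p j) * g (q j)))))"
    unfolding alternant_def fdet_sum_col sum_product
    by (intro sum.cong refl) (simp add: at_var_mult prod.distrib mult_ac)
  then have "tensor N M (alternant N f * alternant N g) =
      (\<Sum>p\<in>?P. \<Sum>q\<in>?P. of_int (sign p) * (of_int (sign q) * (\<Prod>j<N. ?B (p j) (q j))))"
    by (simp add: tensor_sum tensor_of_int tensor_prod_at_var)
  also have "\<dots> = (\<Sum>p\<in>?P. of_int (sign p) * fdet N (\<lambda>i j. ?B (p i) j))"
    by (simp add: fdet_sum sum_distrib_left)
  also have "\<dots> = (\<Sum>p\<in>?P. fdet N ?B)"
  proof (rule sum.cong[OF refl])
    fix p assume "p \<in> ?P"
    then have "fdet N (\<lambda>i j. ?B (p i) j) = of_int (sign p) * fdet N ?B"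
      using fdet_permute_rows[of p N ?B] by simp
    moreover have "of_int (sign p) * (of_int (sign p) * fdet N ?B) = fdet N ?B"
      by (simp add: sign_def)
    ultimately show "of_int (sign p) * fdet N (\<lambda>i j. ?B (p i) j) = fdet N ?B" by simp
  qed
  also have "\<dots> = fact N * fdet N ?B"
    by (simp add: card_permutations)
  finally show ?thesis .
qed

section \<open>Divisibility of alternants by the Vandermonde polynomial\<close>

lemma mvar_inject: "mvar i = mvar j \<longleftrightarrow> i = j"
proof
  assume "mvar i = mvar j"
  then have "Poly_Mapping.keys (mvar i) = Poly_Mapping.keys (mvar j)" by (rule arg_cong)
  then have "Poly_Mapping.single i (1 :: nat) = Poly_Mapping.single j 1"
    by (simp add: mvar_def)
  then have "Poly_Mapping.keys (Poly_Mapping.single i (1 :: nat)) = Poly_Mapping.keys (Poly_Mapping.single j (1 :: nat))"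
    by (rule arg_cong)
  then show "i = j" by simp
qed simp

lemma dvd_diff_mult:
  fixes d :: "'a :: comm_ring_1"
  assumes "d dvd a - b" "d dvd c - e"
  shows "d dvd a * c - b * e"
proof -
  have "a * c - b * e = a * (c - e) + (a - b) * e" by (simp add: algebra_simps)
  then show ?thesis using assms by simp
qed

text \<open>Congruences are preserved by sums and products. For the identity and the substitution of
  x_j for x_i this is the factor theorem for x_i - x_j.\<close>

lemma dvd_msubst_diff:
  assumes "\<And>i. d dvd f i - g i"
  shows "d dvd msubst f P - msubst g P"
proof (induction P rule: mpoly_induct)
  case (single m c)
  have pw: "d dvd f i ^ k - g i ^ k" for i k
    by (induction k) (auto intro: dvd_diff_mult assms)
  have "d dvd (\<Prod>i\<in>A. f i ^ h i) - (\<Prod>i\<in>A. g i ^ h i)" for A h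
    by (induction A rule: infinite_finite_induct) (auto intro: dvd_diff_mult pw)
  then have "d dvd mon_ev f m - mon_ev g m" by (simp add: mon_ev_def)
  then show ?case by (simp add: msubst_single right_diff_distrib[symmetric])
next
  case (add A B)
  then show ?case by (simp add: msubst_add add_diff_add)
qed

text \<open>Substitution replaces an argument by coprimality: the factors already divided out stay
  nonzero when x_i is set to x_j for a new pair (i, j), so in an integral domain the cofactor must
  vanish under this substitution, and x_i - x_j divides it.\<close>

lemma prod_var_diff_dvd:
  assumes kill: "\<And>i j. i < j \<Longrightarrow> j < N \<Longrightarrow> msubst (\<lambda>k. mvar (if k = i then j else k)) P = 0"
    and "finite S" "S \<subseteq> {(i, j). i < j \<and> j < N}"
  shows "(\<Prod>(i, j)\<in>S. mvar i - mvar j) dvd P"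
  using assms(2,3)
proof (induction S rule: finite_induct)
  case (insert x S)
  obtain i j where x: "x = (i, j)" by force
  have ij: "i < j" "j < N" using insert.prems x by auto
  let ?t = "\<lambda>k. if k = i then j else k"
  let ?s = "\<lambda>k. mvar (?t k)"
  obtain Q where Q: "P = (\<Prod>(i, j)\<in>S. mvar i - mvar j) * Q"
    using insert unfolding dvd_def by auto
  have "(\<Prod>(k, l)\<in>S. mvar (?t k) - mvar (?t l)) * msubst ?s Q = 0"
    using kill[OF ij] unfolding Q msubst_mult msubst_prod
    by (simp add: split_beta msubst_diff)
  moreover have "mvar (?t k) - mvar (?t l) \<noteq> 0" if "(k, l) \<in> S" for k l
  proof -
    have "k < l" "(k, l) \<noteq> (i, j)" using that insert x by auto
    then have "?t k \<noteq> ?t l" using ij by auto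
    then show ?thesis by (simp add: mvar_inject)
  qed
  then have "(\<Prod>(k, l)\<in>S. mvar (?t k) - mvar (?t l)) \<noteq> 0"
    using insert(1) by (auto simp: prod_zero_iff)
  ultimately have "msubst ?s Q = 0" by simp
  moreover have "mvar i - mvar j dvd msubst mvar Q - msubst ?s Q"
    by (rule dvd_msubst_diff) auto
  ultimately have "mvar i - mvar j dvd Q" by (simp add: msubst_mvar_id)
  then have "(\<Prod>(i, j)\<in>S. mvar i - mvar j) * (mvar i - mvar j) dvd P"
    unfolding Q by (intro mult_dvd_mono) auto
  then show ?case using insert(1,2) x by (simp add: mult.commute)
qed simp

lemma finite_pairs_less: "finite {(i, j). i < j \<and> j < (N :: nat)}"
  by (rule finite_subset[of _ "{..<N} \<times> {..<N}"]) auto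

lemma vandermonde_dvd_alternant: "vandermonde N dvd alternant N f"
  unfolding vandermonde_def
proof (rule prod_var_diff_dvd[OF _ finite_pairs_less subset_refl])
  fix i j assume ij: "i < j" "j < N"
  have "msubst (\<lambda>k. mvar (if k = i then j else k)) (alternant N f) =
      fdet N (\<lambda>r k. at_var (if k = i then j else k) (f r))"
    unfolding alternant_def msubst_fdet
    by (rule fdet_cong) (rule msubst_at_var_mvar, rule refl)
  also have "\<dots> = 0"
    by (rule fdet_identical_cols[of i N j]) (use ij in auto)
  finally show "msubst (\<lambda>k. mvar (if k = i then j else k)) (alternant N f) = 0" .
qed

lemma vandermonde_nonzero: "vandermonde N \<noteq> 0"
  unfolding vandermonde_def prod_zero_iff[OF finite_pairs_less] by (auto simp: mvar_inject)

definition bialternant :: "nat \<Rightarrow> (nat \<Rightarrow> complex poly) \<Rightarrow> mpoly" where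
  "bialternant N f = (THE P. P * vandermonde N = alternant N f)"

lemma bialternant_eqI:
  assumes "P * vandermonde N = alternant N f"
  shows "bialternant N f = P"
  unfolding bialternant_def
proof (rule the_equality)
  fix Q assume "Q * vandermonde N = alternant N f"
  then have "Q * vandermonde N = P * vandermonde N" using assms by simp
  then show "Q = P" by (simp only: mult_right_cancel[OF vandermonde_nonzero])
qed (rule assms)

lemma bialternant_mult_vandermonde: "bialternant N f * vandermonde N = alternant N f"
proof -
  obtain Q where "alternant N f = vandermonde N * Q"
    using vandermonde_dvd_alternant[of N f] by (auto simp: dvd_def)
  then show ?thesis using bialternant_eqI[of Q N f] by (simp add: mult.commute)
qed

section \<open>Leading monomials and degree bounds\<close>

lemma lookup_mult_splits:
  "Poly_Mapping.lookup (P * Q :: mpoly) = mult_series (Poly_Mapping.lookup P) (Poly_Mapping.lookup Q)"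
proof
  fix m
  show "Poly_Mapping.lookup (P * Q) m = mult_series (Poly_Mapping.lookup P) (Poly_Mapping.lookup Q) m"
  proof (induction P rule: mpoly_induct)
    case (single a c)
    show ?case
    proof (induction Q rule: mpoly_induct)
      case (single b d)
      let ?S = "{(x, y). x + y = m}"
      have "(\<Sum>(x, y)\<in>?S. Poly_Mapping.lookup (Poly_Mapping.single a c) x *
            Poly_Mapping.lookup (Poly_Mapping.single b d) y) =
          (\<Sum>z\<in>?S. if z = (a, b) then c * d else 0)"
        by (rule sum.cong[OF refl]) (auto simp: lookup_single when_def split_beta)
      also have "\<dots> = (if a + b = m then c * d else 0)"
        by (subst sum.delta[OF finite_monom_splittings]) simp
      finally show ?case
        by (simp add: mult_series_def mult_single lookup_single when_def)
    next
      case (add A B)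
      then show ?case
        by (simp add: mult_series_def distrib_left lookup_add split_beta sum.distrib)
    qed
  next
    case (add A B)
    then show ?case
      by (simp add: mult_series_def distrib_right lookup_add split_beta sum.distrib)
  qed
qed

text \<open>The degree in the variables indexed by \<open>I\<close>. With \<open>I = UNIV\<close> it
  bounds total degrees; with \<open>I = {N..}\<close> it shows that later variables do not occur.
  One argument about quotients covers both.\<close>

definition mweight :: "nat set \<Rightarrow> monom \<Rightarrow> nat" where
  "mweight I m = (\<Sum>i\<in>Poly_Mapping.keys m \<inter> I. Poly_Mapping.lookup m i)"

lemma mdeg_eq_mweight: "mdeg = mweight UNIV"
  by (rule ext) (simp add: mdeg_def mweight_def)

lemma mweight_superset:
  assumes "finite A" "Poly_Mapping.keys m \<subseteq> A"
  shows "mweight I m = (\<Sum>i\<in>A \<inter> I. Poly_Mapping.lookup m i)"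
  unfolding mweight_def
  by (rule sum.mono_neutral_left) (use assms in \<open>auto simp: in_keys_iff\<close>)

lemma mweight_add: "mweight I (a + b) = mweight I a + mweight I b"
proof -
  let ?A = "Poly_Mapping.keys a \<union> Poly_Mapping.keys b"
  have "mweight I (a + b) = (\<Sum>i\<in>?A \<inter> I. Poly_Mapping.lookup (a + b) i)"
    by (rule mweight_superset) (auto dest: subsetD[OF keys_add])
  then show ?thesis
    by (simp add: lookup_add sum.distrib mweight_superset[of ?A a] mweight_superset[of ?A b])
qed

lemma mdeg_add: "mdeg (a + b) = mdeg a + mdeg b"
  by (simp add: mdeg_eq_mweight mweight_add)

lemma mweight_single: "mweight I (Poly_Mapping.single i k) = (if i \<in> I then k else 0)"
  by (cases "k = 0") (auto simp: mweight_def)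

lemma mdeg_single [simp]: "mdeg (Poly_Mapping.single i k) = k"
  by (simp add: mdeg_eq_mweight mweight_single)

definition weight_le :: "nat set \<Rightarrow> nat \<Rightarrow> mpoly \<Rightarrow> bool" where
  "weight_le I d P \<longleftrightarrow> (\<forall>m. Poly_Mapping.lookup P m \<noteq> 0 \<longrightarrow> mweight I m \<le> d)"

definition weight_eq :: "nat set \<Rightarrow> nat \<Rightarrow> mpoly \<Rightarrow> bool" where
  "weight_eq I d P \<longleftrightarrow> (\<forall>m. Poly_Mapping.lookup P m \<noteq> 0 \<longrightarrow> mweight I m = d)"

text \<open>The order on \<open>monom\<close> is lexicographic, decided by the smallest index at
  which the exponents differ. It is not graded, so degree bounds need a separate argument.\<close>

definition lmonic :: "mpoly \<Rightarrow> monom \<Rightarrow> bool" where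
  "lmonic P m \<longleftrightarrow> Poly_Mapping.lookup P m = 1 \<and> (\<forall>k. Poly_Mapping.lookup P k \<noteq> 0 \<longrightarrow> k \<le> m)"

lemma lookup_mult_nonzeroE:
  assumes "Poly_Mapping.lookup (P * Q :: mpoly) m \<noteq> 0"
  obtains a b where "m = a + b" "Poly_Mapping.lookup P a \<noteq> 0" "Poly_Mapping.lookup Q b \<noteq> 0"
proof -
  have "\<exists>x\<in>{(x, y). x + y = m}. (case x of (x, y) \<Rightarrow>
      Poly_Mapping.lookup P x * Poly_Mapping.lookup Q y) \<noteq> 0"
  proof (rule ccontr)
    assume "\<not> ?thesis"
    then have "mult_series (Poly_Mapping.lookup P) (Poly_Mapping.lookup Q) m = 0"
      unfolding mult_series_def by (intro sum.neutral) simp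
    then show False using assms by (simp add: lookup_mult_splits)
  qed
  then show ?thesis using that by auto
qed

lemma lookup_mult_unique:
  assumes "\<And>x y. x + y = a + b \<Longrightarrow> Poly_Mapping.lookup P x \<noteq> 0 \<Longrightarrow> Poly_Mapping.lookup Q y \<noteq> 0
    \<Longrightarrow> x = a \<and> y = b"
  shows "Poly_Mapping.lookup (P * Q :: mpoly) (a + b) = Poly_Mapping.lookup P a * Poly_Mapping.lookup Q b"
proof -
  have "mult_series (Poly_Mapping.lookup P) (Poly_Mapping.lookup Q) (a + b) =
      (\<Sum>(x, y)\<in>{(a, b)}. Poly_Mapping.lookup P x * Poly_Mapping.lookup Q y)"
    unfolding mult_series_def
    by (rule sum.mono_neutral_right[OF finite_monom_splittings]) (use assms in auto)
  then show ?thesis by (simp add: lookup_mult_splits)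
qed

lemma add_le_eqD:
  fixes x y a b :: monom
  assumes "x + y = a + b" "x \<le> a" "y \<le> b"
  shows "x = a \<and> y = b"
proof (rule ccontr)
  assume "\<not> ?thesis"
  then have "x < a \<or> y < b" using assms(2,3) by (auto simp: less_le)
  then have "x + y < a + b"
    using assms(2,3) add_less_le_mono add_le_less_mono by blast
  then show False using assms(1) by simp
qed

lemma lmonic_mult:
  assumes "lmonic P a" "lmonic Q b"
  shows "lmonic (P * Q) (a + b)"
  unfolding lmonic_def
proof (intro conjI allI impI)
  have "Poly_Mapping.lookup (P * Q) (a + b) = Poly_Mapping.lookup P a * Poly_Mapping.lookup Q b"
    by (rule lookup_mult_unique, rule add_le_eqD) (use assms in \<open>auto simp: lmonic_def\<close>)
  then show "Poly_Mapping.lookup (P * Q) (a + b) = 1" using assms by (simp add: lmonic_def)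
  fix k assume "Poly_Mapping.lookup (P * Q) k \<noteq> 0"
  then obtain x y where "k = x + y" "Poly_Mapping.lookup P x \<noteq> 0" "Poly_Mapping.lookup Q y \<noteq> 0"
    by (rule lookup_mult_nonzeroE)
  then show "k \<le> a + b" using assms by (auto simp: lmonic_def intro: add_mono)
qed

lemma monom_zero_le: "(0 :: monom) \<le> m"
proof -
  have "\<not> m < 0" by (auto simp: less_poly_mapping.rep_eq less_fun_def)
  then show ?thesis by simp
qed

lemma lmonic_1: "lmonic 1 0"
  by (auto simp: lmonic_def lookup_one when_def)

lemma lmonic_prod:
  "finite A \<Longrightarrow> (\<And>x. x \<in> A \<Longrightarrow> lmonic (f x) (g x)) \<Longrightarrow> lmonic (\<Prod>x\<in>A. f x) (\<Sum>x\<in>A. g x)"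
  by (induction A rule: finite_induct) (auto simp: lmonic_1 intro: lmonic_mult)

lemma ex_max_key:
  assumes "P \<noteq> (0 :: mpoly)"
  obtains m where "Poly_Mapping.lookup P m \<noteq> 0" "\<And>k. Poly_Mapping.lookup P k \<noteq> 0 \<Longrightarrow> k \<le> m"
proof -
  have "Poly_Mapping.keys P \<noteq> {}" using assms by simp
  then have "Max (Poly_Mapping.keys P) \<in> Poly_Mapping.keys P" by (intro Max_in) auto
  moreover have "k \<le> Max (Poly_Mapping.keys P)" if "Poly_Mapping.lookup P k \<noteq> 0" for k
    using that by (intro Max_ge) (auto simp: in_keys_iff)
  ultimately show ?thesis using that by (auto simp: in_keys_iff)
qed

text \<open>Largest monomials add under multiplication, so that of the quotient is obtained by
  cancelling \<open>v\<close>.\<close>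

lemma lmonic_quotient:
  assumes V: "lmonic V v" and A: "lmonic (P * V) (a + v)"
  shows "lmonic P a"
proof -
  have "P \<noteq> 0" using A by (auto simp: lmonic_def)
  then obtain m where m: "Poly_Mapping.lookup P m \<noteq> 0" "\<And>k. Poly_Mapping.lookup P k \<noteq> 0 \<Longrightarrow> k \<le> m"
    by (rule ex_max_key) blast
  have top: "Poly_Mapping.lookup (P * V) (m + v) = Poly_Mapping.lookup P m * Poly_Mapping.lookup V v"
    by (rule lookup_mult_unique, rule add_le_eqD) (use V m in \<open>auto simp: lmonic_def\<close>)
  then have "Poly_Mapping.lookup (P * V) (m + v) \<noteq> 0" using m V by (simp add: lmonic_def)
  then have "m + v \<le> a + v" using A unfolding lmonic_def by blast
  moreover have "Poly_Mapping.lookup (P * V) (a + v) \<noteq> 0" using A by (simp add: lmonic_def)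
  then obtain x y where xy: "a + v = x + y" "Poly_Mapping.lookup P x \<noteq> 0" "Poly_Mapping.lookup V y \<noteq> 0"
    by (rule lookup_mult_nonzeroE)
  have "x \<le> m" "y \<le> v" using m(2) V xy by (auto simp: lmonic_def)
  then have "a + v \<le> m + v" unfolding xy(1) by (rule add_mono)
  ultimately have "m = a" by simp
  then show ?thesis using top A V m by (simp add: lmonic_def)
qed

lemma weight_eq_mult: "weight_eq I a P \<Longrightarrow> weight_eq I b Q \<Longrightarrow> weight_eq I (a + b) (P * Q)"
  unfolding weight_eq_def by (metis lookup_mult_nonzeroE mweight_add)

lemma weight_eq_prod:
  "finite A \<Longrightarrow> (\<And>x. x \<in> A \<Longrightarrow> weight_eq I (g x) (f x)) \<Longrightarrow> weight_eq I (\<Sum>x\<in>A. g x) (\<Prod>x\<in>A. f x)"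
proof (induction A rule: finite_induct)
  case empty
  then show ?case by (auto simp: weight_eq_def lookup_one when_def mweight_def)
qed (auto intro: weight_eq_mult)

text \<open>Since \<open>V\<close> is homogeneous for the weight, the part of \<open>P\<close> of
  top weight does not mix with the rest: the lexicographically largest monomial of that part, times
  that of \<open>V\<close>, survives in the product.\<close>

lemma weight_le_quotient:
  assumes V: "lmonic V v" "weight_eq I e V" and A: "weight_le I (d + e) (P * V)"
  shows "weight_le I d P"
proof (rule ccontr)
  assume "\<not> weight_le I d P"
  then obtain m where m: "Poly_Mapping.lookup P m \<noteq> 0" "d < mweight I m"
    by (auto simp: weight_le_def not_le)
  define D where "D = Max (mweight I ` Poly_Mapping.keys P)"
  have D_ge: "mweight I k \<le> D" if "Poly_Mapping.lookup P k \<noteq> 0" for k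
    unfolding D_def using that by (intro Max_ge) (auto simp: in_keys_iff)
  define K where "K = {k \<in> Poly_Mapping.keys P. mweight I k = D}"
  have "D \<in> mweight I ` Poly_Mapping.keys P"
    unfolding D_def using m by (intro Max_in) (auto simp: in_keys_iff)
  then have "K \<noteq> {}" "finite K" by (auto simp: K_def)
  then have "Max K \<in> K" and K_ge: "\<And>k. k \<in> K \<Longrightarrow> k \<le> Max K" by auto
  then have top: "Poly_Mapping.lookup P (Max K) \<noteq> 0" "mweight I (Max K) = D"
    by (auto simp: K_def in_keys_iff)
  have v: "mweight I v = e" using V by (auto simp: lmonic_def weight_eq_def)
  have "Poly_Mapping.lookup (P * V) (Max K + v) = Poly_Mapping.lookup P (Max K) * Poly_Mapping.lookup V v"
  proof (rule lookup_mult_unique)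
    fix x y assume xy: "x + y = Max K + v" "Poly_Mapping.lookup P x \<noteq> 0" "Poly_Mapping.lookup V y \<noteq> 0"
    then have "mweight I x + mweight I y = D + e"
      using mweight_add[of I x y] mweight_add[of I "Max K" v] top v by simp
    moreover have "mweight I y = e" using xy V by (auto simp: weight_eq_def)
    ultimately have "x \<in> K" using xy by (simp add: K_def in_keys_iff)
    then show "x = Max K \<and> y = v"
      using xy V K_ge by (intro add_le_eqD) (auto simp: lmonic_def)
  qed
  then have "mweight I (Max K + v) \<le> d + e"
    using A top V by (auto simp: weight_le_def lmonic_def)
  then show False using D_ge[OF m(1)] m(2) top v by (simp add: mweight_add)
qed

definition delta_mon :: "nat \<Rightarrow> monom" where
  "delta_mon N = (\<Sum>j<N. Poly_Mapping.single j (N - Suc j))"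

lemma lookup_delta_mon: "Poly_Mapping.lookup (delta_mon N) i = (if i < N then N - Suc i else 0)"
  by (simp add: delta_mon_def lookup_sum_single_lessThan)

lemma keys_delta_mon: "Poly_Mapping.keys (delta_mon N) \<subseteq> {..<N}"
proof
  fix i assume "i \<in> Poly_Mapping.keys (delta_mon N)"
  then have "Poly_Mapping.lookup (delta_mon N) i \<noteq> 0" by (simp only: in_keys_iff not_False_eq_True)
  then show "i \<in> {..<N}" by (simp add: lookup_delta_mon split: if_splits)
qed

lemma lmonic_var_diff:
  assumes "i < j"
  shows "lmonic (mvar i - mvar j) (Poly_Mapping.single i 1)"
proof -
  have lt: "Poly_Mapping.single j 1 < (Poly_Mapping.single i 1 :: monom)"
    unfolding less_poly_mapping.rep_eq less_fun_def
    by (rule exI[of _ i]) (use assms in \<open>auto simp: lookup_single when_def\<close>)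
  then show ?thesis
    by (auto simp: lmonic_def mvar_def lookup_minus lookup_single when_def split: if_splits)
qed

lemma weight_eq_var_diff:
  assumes "i \<in> I \<longleftrightarrow> j \<in> I"
  shows "weight_eq I (if i \<in> I then 1 else 0) (mvar i - mvar j)"
  using assms
  by (auto simp: weight_eq_def mvar_def lookup_minus lookup_single when_def mweight_single split: if_splits)

lemma lmonic_vandermonde: "lmonic (vandermonde N) (delta_mon N)"
proof -
  let ?S = "{(i, j). i < j \<and> j < N}"
  have "lmonic (\<Prod>(i, j)\<in>?S. mvar i - mvar j) (\<Sum>(i, j)\<in>?S. Poly_Mapping.single i 1)"
    by (rule lmonic_prod[OF finite_pairs_less]) (auto simp: lmonic_var_diff[simplified])
  moreover have "(\<Sum>(i, j)\<in>?S. Poly_Mapping.single i 1) = delta_mon N"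
  proof (rule poly_mapping_eqI)
    fix k
    have "Poly_Mapping.lookup (\<Sum>(i, j)\<in>?S. Poly_Mapping.single i (1 :: nat)) k =
        (\<Sum>x\<in>?S. if fst x = k then 1 else 0)"
      unfolding lookup_sum by (rule sum.cong[OF refl]) (auto simp: lookup_single when_def)
    also have "\<dots> = card {x \<in> ?S. fst x = k}"
      using finite_pairs_less[of N] by (simp add: sum.If_cases Int_def conj_commute)
    also have "{x \<in> ?S. fst x = k} = Pair k ` {k<..<N}" by auto
    also have "card \<dots> = N - Suc k" by (subst card_image) (auto simp: inj_on_def)
    finally show "Poly_Mapping.lookup (\<Sum>(i, j)\<in>?S. Poly_Mapping.single i 1) k =
        Poly_Mapping.lookup (delta_mon N) k"
      by (simp add: delta_mon_def lookup_sum_single_lessThan)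
  qed
  ultimately show ?thesis by (simp add: vandermonde_def)
qed

lemma weight_eq_vandermonde:
  assumes "{..<N} \<subseteq> I \<or> {..<N} \<inter> I = {}"
  shows "weight_eq I (mweight I (delta_mon N)) (vandermonde N)"
proof -
  let ?S = "{(i, j). i < j \<and> j < N}"
  let ?g = "\<lambda>x :: nat \<times> nat. if fst x \<in> I then 1 else 0 :: nat"
  have "weight_eq I (\<Sum>x\<in>?S. ?g x) (\<Prod>x\<in>?S. case x of (i, j) \<Rightarrow> mvar i - mvar j)"
  proof (rule weight_eq_prod[OF finite_pairs_less])
    fix x assume "x \<in> ?S"
    then obtain i j where "x = (i, j)" "i < j" "j < N" by auto
    then have "i \<in> {..<N}" "j \<in> {..<N}" by auto
    then have "i \<in> I \<longleftrightarrow> j \<in> I" using assms by blast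
    then show "weight_eq I (?g x) (case x of (i, j) \<Rightarrow> mvar i - mvar j)"
      using weight_eq_var_diff[of i I j] \<open>x = (i, j)\<close> by simp
  qed
  then have *: "weight_eq I (\<Sum>x\<in>?S. ?g x) (vandermonde N)"
    unfolding vandermonde_def .
  moreover have "Poly_Mapping.lookup (vandermonde N) (delta_mon N) \<noteq> 0"
    using lmonic_vandermonde[of N] by (simp add: lmonic_def)
  ultimately have "mweight I (delta_mon N) = (\<Sum>x\<in>?S. ?g x)"
    unfolding weight_eq_def by blast
  then show ?thesis using * by simp
qed

lemma weight_le_bialternant:
  assumes "{..<N} \<subseteq> I \<or> {..<N} \<inter> I = {}"
    and "weight_le I (d + mweight I (delta_mon N)) (alternant N f)"
  shows "weight_le I d (bialternant N f)"
  by (rule weight_le_quotient[OF lmonic_vandermonde weight_eq_vandermonde[OF assms(1)]])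
     (simp only: bialternant_mult_vandermonde assms(2))

section \<open>Generalized Schur polynomials\<close>

definition monic_seq :: "(nat \<Rightarrow> complex poly) \<Rightarrow> bool" where
  "monic_seq W \<longleftrightarrow> (\<forall>n. degree (W n) = n \<and> coeff (W n) n = 1)"

definition gschur :: "nat \<Rightarrow> (nat \<Rightarrow> complex poly) \<Rightarrow> (nat \<Rightarrow> nat) \<Rightarrow> mpoly" where
  "gschur N W lam = bialternant N (\<lambda>i. W (shifted N lam i))"

definition part_mon :: "(nat \<Rightarrow> nat) \<Rightarrow> monom" where
  "part_mon lam = Abs_poly_mapping lam"

lemma lookup_part_mon: "is_partition lam \<Longrightarrow> Poly_Mapping.lookup (part_mon lam) = lam"
  unfolding part_mon_def is_partition_def by (simp add: lookup_Abs_poly_mapping)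

lemma part_mon_zero [simp]: "part_mon (\<lambda>_. 0) = 0"
  by (simp add: part_mon_def)

lemma psize_eq_sum:
  assumes "is_partition lam" "plength lam \<le> N"
  shows "psize lam = (\<Sum>j<N. lam j)"
  unfolding psize_def
  by (rule sum.mono_neutral_left) (use assms in \<open>auto simp: partition_zero_iff\<close>)

lemma mdeg_part_mon:
  assumes "is_partition lam"
  shows "mdeg (part_mon lam) = psize lam"
proof -
  have "mdeg (part_mon lam) = (\<Sum>i\<in>{..<plength lam} \<inter> UNIV. Poly_Mapping.lookup (part_mon lam) i)"
    unfolding mdeg_eq_mweight
    by (rule mweight_superset)
       (use assms partition_zero_iff[OF assms] in \<open>auto simp: in_keys_iff lookup_part_mon not_le[symmetric]\<close>)
  then show ?thesis by (simp add: psize_def lookup_part_mon[OF assms])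
qed

context
  fixes N :: nat and W :: "nat \<Rightarrow> complex poly" and lam :: "nat \<Rightarrow> nat"
  assumes W: "monic_seq W" and lam: "is_partition lam" and len: "plength lam \<le> N"
begin

lemma lmonic_alternant:
  "lmonic (alternant N (\<lambda>i. W (shifted N lam i))) (part_mon lam + delta_mon N)"
  unfolding lmonic_def
proof (intro conjI allI impI)
  let ?s = "shifted N lam" and ?m = "part_mon lam + delta_mon N"
  have lk: "Poly_Mapping.lookup ?m i = (if i < N then ?s i else 0)" for i
    using partition_zero_iff[OF lam, of i] len
    by (auto simp: lookup_add lookup_part_mon[OF lam] delta_mon_def lookup_sum_single_lessThan shifted_def)
  have keys: "Poly_Mapping.keys ?m \<subseteq> {..<N}"
    by (rule subsetI) (auto simp only: in_keys_iff lk split: if_splits)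
  have "fdet N (\<lambda>i j. coeff (W (?s i)) (Poly_Mapping.lookup ?m j)) =
      (\<Prod>i<N. coeff (W (?s i)) (Poly_Mapping.lookup ?m i))"
  proof (rule fdet_upper)
    fix i j :: nat assume ij: "j < i" "i < N"
    then show "coeff (W (?s i)) (Poly_Mapping.lookup ?m j) = 0"
      using W shifted_less[OF lam, of j i N] by (auto simp: lk monic_seq_def intro: coeff_eq_0)
  qed
  also have "\<dots> = 1" using W by (auto simp: lk monic_seq_def intro: prod.neutral)
  finally show "Poly_Mapping.lookup (alternant N (\<lambda>i. W (?s i))) ?m = 1"
    using keys by (simp add: lookup_alternant)
  fix k assume "Poly_Mapping.lookup (alternant N (\<lambda>i. W (?s i))) k \<noteq> 0"
  then have k: "Poly_Mapping.keys k \<subseteq> {..<N}"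
    and nz: "fdet N (\<lambda>i j. coeff (W (?s i)) (Poly_Mapping.lookup k j)) \<noteq> 0"
    by (auto simp: lookup_alternant split: if_splits)
  show "k \<le> ?m"
  proof (rule ccontr)
    assume "\<not> k \<le> ?m"
    then have "?m < k" by simp
    then obtain r where r: "Poly_Mapping.lookup ?m r < Poly_Mapping.lookup k r"
      and eq: "\<And>r'. r' < r \<Longrightarrow> Poly_Mapping.lookup ?m r' = Poly_Mapping.lookup k r'"
      by (auto simp: less_poly_mapping.rep_eq less_fun_def)
    have "r \<in> Poly_Mapping.keys k" using r by (simp add: in_keys_iff)
    then have "r < N" using k by auto
    \<comment> \<open>\<open>k\<close> agrees with \<open>?m\<close> before \<open>r\<close> and
      exceeds it at \<open>r\<close>. So the polynomials in rows from \<open>r\<close> on have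
      degrees below the exponents in columns up to \<open>r\<close>, which is a zero block.\<close>
    then have "fdet N (\<lambda>i j. coeff (W (?s i)) (Poly_Mapping.lookup k j)) = 0"
    proof (rule fdet_zero_block)
      fix i j assume ij: "r \<le> i" "i < N" "j \<le> r"
      have "?s i < Poly_Mapping.lookup k j"
      proof (cases "j = r")
        case True
        have "?s i \<le> ?s r" using ij by (intro shifted_le lam) auto
        also have "\<dots> < Poly_Mapping.lookup k r" using r \<open>r < N\<close> by (simp add: lk)
        finally show ?thesis using True by simp
      next
        case False
        then have "?s i < ?s j" using ij by (intro shifted_less lam) auto
        also have "?s j = Poly_Mapping.lookup k j" using eq[of j] False ij \<open>r < N\<close> by (simp add: lk)
        finally show ?thesis .
      qed
      then show "coeff (W (?s i)) (Poly_Mapping.lookup k j) = 0"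
        using W by (auto simp: monic_seq_def intro: coeff_eq_0)
    qed
    then show False using nz by simp
  qed
qed

lemma lmonic_gschur: "lmonic (gschur N W lam) (part_mon lam)"
  unfolding gschur_def
  by (rule lmonic_quotient[OF lmonic_vandermonde[of N]])
     (simp only: bialternant_mult_vandermonde lmonic_alternant)

lemma gschur_mdeg_le:
  assumes "Poly_Mapping.lookup (gschur N W lam) m \<noteq> 0"
  shows "mdeg m \<le> psize lam"
proof -
  let ?s = "shifted N lam"
  have "weight_le UNIV (psize lam + mweight UNIV (delta_mon N)) (alternant N (\<lambda>i. W (?s i)))"
    unfolding weight_le_def
  proof (intro allI impI)
    fix k assume "Poly_Mapping.lookup (alternant N (\<lambda>i. W (?s i))) k \<noteq> 0"
    then have k: "Poly_Mapping.keys k \<subseteq> {..<N}"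
      and nz: "fdet N (\<lambda>i j. coeff (W (?s i)) (Poly_Mapping.lookup k j)) \<noteq> 0"
      by (auto simp: lookup_alternant split: if_splits)
    obtain p where p: "p permutes {..<N}" and pnz: "(\<Prod>j<N. coeff (W (?s (p j))) (Poly_Mapping.lookup k j)) \<noteq> 0"
      using nz unfolding fdet_sum_col by (metis (mono_tags, lifting) mem_Collect_eq mult_zero_right sum.neutral)
    have "Poly_Mapping.lookup k j \<le> ?s (p j)" if "j < N" for j
    proof -
      have "coeff (W (?s (p j))) (Poly_Mapping.lookup k j) \<noteq> 0"
        using pnz that by (auto simp: prod_zero_iff)
      then show ?thesis using W le_degree by (metis monic_seq_def)
    qed
    then have "(\<Sum>j<N. Poly_Mapping.lookup k j) \<le> (\<Sum>j<N. ?s (p j))"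
      by (intro sum_mono) auto
    also have "\<dots> = (\<Sum>j<N. ?s j)"
      using sum.permute[OF p, of ?s] by (simp add: o_def)
    also have "\<dots> = psize lam + (\<Sum>j<N. N - Suc j)"
      by (simp only: shifted_def sum.distrib psize_eq_sum[OF lam len])
    also have "(\<Sum>j<N. N - Suc j) = mweight UNIV (delta_mon N)"
      by (simp add: mweight_superset[OF finite_lessThan keys_delta_mon] lookup_delta_mon)
    finally show "mweight UNIV k \<le> psize lam + mweight UNIV (delta_mon N)"
      by (simp add: mweight_superset[OF finite_lessThan k])
  qed
  then have "weight_le UNIV (psize lam) (gschur N W lam)"
    unfolding gschur_def by (intro weight_le_bialternant) auto
  then show ?thesis using assms by (simp add: weight_le_def mdeg_eq_mweight)
qed

end

lemma bialternant_keys: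
  assumes "Poly_Mapping.lookup (bialternant N f) m \<noteq> 0"
  shows "Poly_Mapping.keys m \<subseteq> {..<N}"
proof -
  let ?I = "{N..}"
  have d: "mweight ?I k = 0" if "Poly_Mapping.keys k \<subseteq> {..<N}" for k
    unfolding mweight_def by (rule sum.neutral) (use that in auto)
  have "weight_le ?I (0 + mweight ?I (delta_mon N)) (alternant N f)"
    unfolding weight_le_def by (auto simp: lookup_alternant d split: if_splits)
  then have "weight_le ?I 0 (bialternant N f)"
    by (intro weight_le_bialternant) auto
  then have "mweight ?I m = 0" using assms by (simp add: weight_le_def)
  then have z: "Poly_Mapping.lookup m i = 0" if "i \<in> Poly_Mapping.keys m" "N \<le> i" for i
    using that by (simp add: mweight_def)
  show ?thesis
  proof
    fix i assume i: "i \<in> Poly_Mapping.keys m"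
    then show "i \<in> {..<N}" using z[OF i] by (cases "N \<le> i") (auto simp: in_keys_iff)
  qed
qed

text \<open>0 is the least monomial, so a polynomial with leading monomial 0 and leading coefficient
  1 has no other term. Consequently every monic sequence produces the same Vandermonde
  polynomial.\<close>

lemma gschur_zero:
  assumes "monic_seq W"
  shows "gschur N W (\<lambda>_. 0) = 1"
proof (rule poly_mapping_eqI)
  fix m :: monom
  have "plength (\<lambda>_. 0) = 0" by (simp add: plength_def)
  then have "lmonic (gschur N W (\<lambda>_. 0)) 0"
    using lmonic_gschur[OF assms is_partition_zero] by simp
  moreover have "m \<le> 0 \<Longrightarrow> m = 0" using monom_zero_le[of m] by simp
  ultimately show "Poly_Mapping.lookup (gschur N W (\<lambda>_. 0)) m = Poly_Mapping.lookup 1 m"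
    by (auto simp: lmonic_def lookup_one when_def)
qed

lemma vandermonde_eq_alternant:
  assumes "monic_seq W"
  shows "vandermonde N = alternant N (\<lambda>i. W (N - Suc i))"
  using bialternant_mult_vandermonde[of N "\<lambda>i. W (shifted N (\<lambda>_. 0) i)"] gschur_zero[OF assms, of N]
  by (simp add: gschur_def shifted_def)

lemma msubst_alternant:
  assumes "p permutes {..<N}"
  shows "msubst (\<lambda>i. mvar (p i)) (alternant N f) = of_int (sign p) * alternant N f"
proof -
  have "msubst (\<lambda>i. mvar (p i)) (alternant N f) = fdet N (\<lambda>i j. at_var (p j) (f i))"
    unfolding alternant_def msubst_fdet by (rule fdet_cong) (rule msubst_at_var_mvar, rule refl)
  then show ?thesis
    unfolding alternant_def using fdet_permute_cols[OF assms, of "\<lambda>i j. at_var j (f i)"] by simp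
qed

lemma monic_seq_monom: "monic_seq (monom 1)"
  by (simp add: monic_seq_def degree_monom_eq)

text \<open>Numerator and denominator change by the same sign; the Vandermonde polynomial does so
  because it is itself an alternant.\<close>

lemma msubst_bialternant:
  assumes "p permutes {..<N}"
  shows "msubst (\<lambda>i. mvar (p i)) (bialternant N f) = bialternant N f"
proof -
  let ?B = "bialternant N f" and ?V = "vandermonde N" and ?s = "\<lambda>i. mvar (p i)"
  let ?e = "of_int (sign p) :: mpoly"
  have V: "msubst ?s ?V = ?e * ?V"
    unfolding vandermonde_eq_alternant[OF monic_seq_monom] by (rule msubst_alternant[OF assms])
  have "msubst ?s (?B * ?V) = ?e * (?B * ?V)"
    unfolding bialternant_mult_vandermonde by (rule msubst_alternant[OF assms])
  then have "?e * msubst ?s ?B * ?V = ?e * ?B * ?V"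
    by (simp add: msubst_mult V mult_ac)
  then have "?e * msubst ?s ?B = ?e * ?B"
    by (simp only: mult_right_cancel[OF vandermonde_nonzero])
  then show ?thesis by (cases "evenperm p") (simp_all add: sign_def)
qed

lemma gschur_SymPoly_le:
  assumes "monic_seq W" "is_partition lam" "plength lam \<le> N"
  shows "gschur N W lam \<in> SymPoly_le (psize lam) N"
  unfolding SymPoly_le_def
proof (intro CollectI conjI ballI allI impI)
  fix m assume "m \<in> Poly_Mapping.keys (gschur N W lam)"
  then have m: "Poly_Mapping.lookup (gschur N W lam) m \<noteq> 0" by (simp add: in_keys_iff)
  then show "Poly_Mapping.keys m \<subseteq> {..<N}"
    unfolding gschur_def by (rule bialternant_keys)
  show "mdeg m \<le> psize lam" using gschur_mdeg_le[OF assms m] .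
next
  fix p m assume p: "p permutes {..<N}"
  show "Poly_Mapping.lookup (gschur N W lam) (Poly_Mapping.map_key p m) =
      Poly_Mapping.lookup (gschur N W lam) m"
    using lookup_msubst_bij[OF permutes_bij[OF p], of "gschur N W lam" m] msubst_bialternant[OF p]
    by (simp add: gschur_def)
qed

section \<open>Rearranging monomials\<close>

lemma ex_permutes_extending:
  assumes "finite S" "A \<subseteq> S" "B \<subseteq> S" "bij_betw g A B"
  obtains p where "p permutes S" "\<And>x. x \<in> A \<Longrightarrow> p x = g x"
proof -
  have "card A = card B" using assms(4) by (rule bij_betw_same_card)
  then have "card (S - A) = card (S - B)"
    using assms(1-3) by (simp add: card_Diff_subset finite_subset)
  then obtain h where h: "bij_betw h (S - A) (S - B)"
    using assms(1) finite_same_card_bij by blast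
  define p where "p x = (if x \<in> A then g x else if x \<in> S then h x else x)" for x
  have "bij_betw p A B" using assms(4) by (rule bij_betw_cong[THEN iffD1, rotated]) (simp add: p_def)
  moreover have "bij_betw p (S - A) (S - B)"
    using h by (rule bij_betw_cong[THEN iffD1, rotated]) (simp add: p_def)
  ultimately have "bij_betw p (A \<union> (S - A)) (B \<union> (S - B))"
    by (rule bij_betw_combine) auto
  moreover have "A \<union> (S - A) = S" "B \<union> (S - B) = S" using assms by auto
  ultimately have "p permutes S"
    by (intro bij_imp_permutes) (auto simp: p_def dest: subsetD[OF assms(2)])
  then show ?thesis using that by (simp add: p_def)
qed

lemma bij_betw_keys_map_key:
  assumes "bij p"
  shows "bij_betw p (Poly_Mapping.keys (Poly_Mapping.map_key p m)) (Poly_Mapping.keys m)"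
  unfolding bij_betw_def keys_map_key[OF bij_is_inj[OF assms]]
  by (simp add: surj_image_vimage_eq bij_is_surj[OF assms] inj_on_subset[OF bij_is_inj[OF assms]])

text \<open>\<open>Sym_le\<close> asks for invariance under all bijections of the indices,
  \<open>SymPoly_le\<close> only under permutations of the first \<open>N\<close>. On monomials in
  the first \<open>N\<close> variables the two agree, since only the induced bijection between the
  supports matters.\<close>

lemma map_key_permutes_within:
  fixes m :: monom and p :: "nat \<Rightarrow> nat"
  assumes "bij p" "Poly_Mapping.keys m \<subseteq> {..<N}" "Poly_Mapping.keys (Poly_Mapping.map_key p m) \<subseteq> {..<N}"
  obtains p' where "p' permutes {..<N}" "Poly_Mapping.map_key p' m = Poly_Mapping.map_key p m"
proof -
  let ?A = "Poly_Mapping.keys (Poly_Mapping.map_key p m)" and ?B = "Poly_Mapping.keys m"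
  have A: "?A = p -` ?B" using assms(1) by (simp add: keys_map_key bij_is_inj)
  have bb: "bij_betw p ?A ?B" using assms(1) by (rule bij_betw_keys_map_key)
  then have "p ` ?A = ?B" by (simp add: bij_betw_def)
  obtain p' where p': "p' permutes {..<N}" "\<And>x. x \<in> ?A \<Longrightarrow> p' x = p x"
    by (rule ex_permutes_extending[OF finite_lessThan assms(3) assms(2) bb]) blast
  have "Poly_Mapping.lookup m (p' i) = Poly_Mapping.lookup m (p i)" for i
  proof (cases "i \<in> ?A")
    case False
    have "p' i \<notin> ?B"
    proof
      assume "p' i \<in> ?B"
      then obtain j where "j \<in> ?A" "p' i = p j" using \<open>p ` ?A = ?B\<close> by (metis imageE)
      then have "p' i = p' j" using p' by simp
      then show False using False \<open>j \<in> ?A\<close> permutes_inj[OF p'(1)] by (simp add: inj_eq)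
    qed
    moreover have "p i \<notin> ?B" using False A by simp
    ultimately show ?thesis by (simp add: in_keys_iff)
  qed (simp add: p')
  then have "Poly_Mapping.map_key p' m = Poly_Mapping.map_key p m"
    using assms(1) p'(1)
    by (intro poly_mapping_eqI) (simp add: lookup_map_key bij_is_inj permutes_inj)
  then show ?thesis using that p'(1) by blast
qed

lemma card_keys_le_mdeg: "card (Poly_Mapping.keys m) \<le> mdeg m"
proof -
  have "(\<Sum>i\<in>Poly_Mapping.keys m. 1) \<le> (\<Sum>i\<in>Poly_Mapping.keys m. Poly_Mapping.lookup m i)"
    by (rule sum_mono) (auto simp: in_keys_iff Suc_le_eq)
  then show ?thesis by (simp add: mdeg_def)
qed

lemma ex_map_key_lessThan:
  fixes m :: monom
  assumes "card (Poly_Mapping.keys m) \<le> N"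
  obtains p where "bij p" "Poly_Mapping.keys (Poly_Mapping.map_key p m) \<subseteq> {..<N}"
proof -
  let ?K = "Poly_Mapping.keys m"
  let ?S = "?K \<union> {..<N}"
  obtain g where g: "bij_betw g {..<card ?K} ?K"
    using ex_bij_betw_nat_finite[of ?K] by (auto simp: atLeast0LessThan)
  obtain p where p: "p permutes ?S" "\<And>x. x \<in> {..<card ?K} \<Longrightarrow> p x = g x"
  proof (rule ex_permutes_extending[of ?S "{..<card ?K}" ?K g])
    show "{..<card ?K} \<subseteq> ?S" using assms by auto
  qed (use g in auto)
  have "bij p" using p(1) by (rule permutes_bij)
  moreover have "Poly_Mapping.keys (Poly_Mapping.map_key p m) \<subseteq> {..<N}"
  proof
    fix i assume "i \<in> Poly_Mapping.keys (Poly_Mapping.map_key p m)"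
    then have "p i \<in> ?K" using \<open>bij p\<close> by (simp add: keys_map_key bij_is_inj)
    then obtain j where j: "j < card ?K" "p i = g j" using g by (auto simp: bij_betw_def)
    then have "p i = p j" using p by simp
    then have "i = j" using permutes_inj[OF p(1)] by (simp add: inj_eq)
    then show "i \<in> {..<N}" using j assms by simp
  qed
  ultimately show ?thesis using that by blast
qed

lemma mdeg_map_key:
  fixes m :: monom
  assumes "bij p"
  shows "mdeg (Poly_Mapping.map_key p m) = mdeg m"
proof -
  from sum.reindex_bij_betw[OF bij_betw_keys_map_key[OF assms], of "Poly_Mapping.lookup m" m]
  show ?thesis using assms by (simp add: mdeg_def lookup_map_key bij_is_inj)
qed

lemma ex_map_key_partition:
  fixes m :: monom
  assumes "Poly_Mapping.keys m \<subseteq> {..<N}"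
  obtains p kap where "p permutes {..<N}" "is_partition kap" "plength kap \<le> N"
    "Poly_Mapping.map_key p m = part_mon kap"
proof -
  \<comment> \<open>Sorting the distinct numbers \<open>f i\<close> sorts the exponents, with ties broken by the index.\<close>
  define f where "f i = Poly_Mapping.lookup m i * N + i" for i
  have div: "f i div N = Poly_Mapping.lookup m i" and md: "f i mod N = i" if "i < N" for i
    using that by (auto simp: f_def)
  have "inj_on f {..<N}" by (rule inj_onI) (metis lessThan_iff md)
  then obtain lam p where lam: "is_partition lam" and p: "p permutes {..<N}"
    and fp: "\<And>i. i < N \<Longrightarrow> f i = shifted N lam (p i)"
    by (rule ex_shifted_permutes) blast
  let ?r = "Hilbert_Choice.inv p"
  have r: "?r permutes {..<N}" using p by (rule permutes_inv)
  have pr: "p (?r i) = i" for i using permutes_inverses[OF p] by simp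
  define kap where "kap = Poly_Mapping.lookup (Poly_Mapping.map_key ?r m)"
  have kap: "kap i = Poly_Mapping.lookup m (?r i)" for i
    by (simp add: kap_def lookup_map_key permutes_inj[OF r])
  have zero: "kap i = 0" if "N \<le> i" for i
  proof -
    have "?r i = i" using r that by (simp add: permutes_def)
    moreover have "i \<notin> Poly_Mapping.keys m" using assms that by auto
    ultimately show ?thesis by (simp add: kap in_keys_iff)
  qed
  have "kap j \<le> kap i" if "i \<le> j" for i j
  proof (cases "j < N")
    case True
    then have "?r i < N" "?r j < N" using that by (simp_all add: permutes_less[OF r])
    then have "f (?r j) \<le> f (?r i)"
      using fp[of "?r i"] fp[of "?r j"] shifted_le[OF lam that True] by (simp add: pr)
    then have "f (?r j) div N \<le> f (?r i) div N" by (rule div_le_mono)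
    then show ?thesis using div \<open>?r i < N\<close> \<open>?r j < N\<close> by (simp add: kap)
  qed (simp add: zero)
  moreover have "finite {i. kap i \<noteq> 0}" by (simp add: kap_def)
  ultimately have part: "is_partition kap" by (simp add: is_partition_def antimono_def)
  have "plength kap \<le> N" using partition_zero_iff[OF part, of N] zero[of N] by simp
  moreover have "Poly_Mapping.map_key ?r m = part_mon kap"
    by (simp add: part_mon_def kap_def)
  ultimately show ?thesis using that[OF r part] by blast
qed

section \<open>Convergence of symmetric polynomials\<close>

lemma SymPoly_le_lookup_map_key:
  assumes "P \<in> SymPoly_le D N" "bij p" "Poly_Mapping.keys m \<subseteq> {..<N}"
    "Poly_Mapping.keys (Poly_Mapping.map_key p m) \<subseteq> {..<N}"
  shows "Poly_Mapping.lookup P (Poly_Mapping.map_key p m) = Poly_Mapping.lookup P m"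
proof -
  obtain p' where "p' permutes {..<N}" "Poly_Mapping.map_key p' m = Poly_Mapping.map_key p m"
    using assms(2-4) by (rule map_key_permutes_within)
  then show ?thesis using assms(1) unfolding SymPoly_le_def by (metis (mono_tags, lifting) mem_Collect_eq)
qed

lemma SymPoly_le_mdeg:
  "P \<in> SymPoly_le D N \<Longrightarrow> Poly_Mapping.lookup P m \<noteq> 0 \<Longrightarrow> mdeg m \<le> D"
  by (simp add: SymPoly_le_def in_keys_iff)

lemma SymPoly_le_keys:
  "P \<in> SymPoly_le D N \<Longrightarrow> Poly_Mapping.lookup P m \<noteq> 0 \<Longrightarrow> Poly_Mapping.keys m \<subseteq> {..<N}"
  by (simp add: SymPoly_le_def in_keys_iff)

lemma Sym_le_unique:
  assumes "F \<in> Sym_le d" "G \<in> Sym_le d" "d \<le> N" "truncate_vars N F = truncate_vars N G"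
  shows "F = G"
proof
  fix m
  show "F m = G m"
  proof (cases "mdeg m \<le> d")
    case True
    then have "card (Poly_Mapping.keys m) \<le> N" using card_keys_le_mdeg[of m] assms(3) by simp
    then obtain p where p: "bij p" "Poly_Mapping.keys (Poly_Mapping.map_key p m) \<subseteq> {..<N}"
      by (rule ex_map_key_lessThan)
    then have "F (Poly_Mapping.map_key p m) = G (Poly_Mapping.map_key p m)"
      using fun_cong[OF assms(4), of "Poly_Mapping.map_key p m"] by (simp add: truncate_vars_def)
    then show ?thesis using assms(1,2) p(1) by (simp add: Sym_le_def)
  next
    case False
    then show ?thesis using assms(1,2) by (metis (mono_tags, lifting) Sym_le_def mem_Collect_eq)
  qed
qed

text \<open>A monomial of degree at most \<open>d\<close> involves at most \<open>d \<le> N\<close>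
  variables, so it can be moved into the first \<open>N\<close>; the coefficient found there does
  not depend on the chosen move.\<close>

lemma ex_Sym_le_extension:
  assumes P: "P \<in> SymPoly_le D N" and "D \<le> d" "d \<le> N"
  shows "\<exists>F. F \<in> Sym_le d \<and> truncate_vars N F = Poly_Mapping.lookup P"
proof -
  let ?good = "\<lambda>m p. bij p \<and> Poly_Mapping.keys (Poly_Mapping.map_key p m) \<subseteq> {..<N}"
  define F where "F m = (if mdeg m \<le> d
    then Poly_Mapping.lookup P (Poly_Mapping.map_key (SOME p. ?good m p) m) else 0)" for m
  have ex: "\<exists>p. ?good m p" if "mdeg m \<le> d" for m
    using ex_map_key_lessThan[of m N] card_keys_le_mdeg[of m] that assms(3) by (metis le_trans)
  have F: "F m = Poly_Mapping.lookup P (Poly_Mapping.map_key p m)" if "mdeg m \<le> d" "?good m p" for m p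
  proof -
    let ?p = "SOME p. ?good m p"
    let ?r = "Hilbert_Choice.inv p \<circ> ?p"
    have good: "?good m ?p" by (rule someI_ex[OF ex[OF that(1)]])
    have r: "bij ?r" using good that(2) by (simp add: bij_comp bij_imp_bij_inv)
    have p: "bij p" and p': "bij ?p" using good that(2) by blast+
    have eq: "Poly_Mapping.map_key ?p m = Poly_Mapping.map_key ?r (Poly_Mapping.map_key p m)"
      by (rule poly_mapping_eqI)
         (simp add: lookup_map_key[OF bij_is_inj[OF p]] lookup_map_key[OF bij_is_inj[OF p']]
          lookup_map_key[OF bij_is_inj[OF r]] surj_f_inv_f[OF bij_is_surj[OF p]])
    have "F m = Poly_Mapping.lookup P (Poly_Mapping.map_key ?p m)"
      unfolding F_def using that(1) by (simp only: if_True)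
    also have "\<dots> = Poly_Mapping.lookup P (Poly_Mapping.map_key p m)"
      unfolding eq
    proof (rule SymPoly_le_lookup_map_key[OF P r])
      show "Poly_Mapping.keys (Poly_Mapping.map_key p m) \<subseteq> {..<N}" using that(2) by blast
      show "Poly_Mapping.keys (Poly_Mapping.map_key ?r (Poly_Mapping.map_key p m)) \<subseteq> {..<N}"
        unfolding eq[symmetric] using good by blast
    qed
    finally show ?thesis .
  qed
  have "F (Poly_Mapping.map_key p m) = F m" if p: "bij p" for p m
  proof (cases "mdeg m \<le> d")
    case True
    then have d: "mdeg (Poly_Mapping.map_key p m) \<le> d" using p by (simp add: mdeg_map_key)
    then obtain r where r: "?good (Poly_Mapping.map_key p m) r" using ex by blast
    have eq: "Poly_Mapping.map_key r (Poly_Mapping.map_key p m) = Poly_Mapping.map_key (p \<circ> r) m"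
      using p r by (simp add: map_key_compose bij_is_inj)
    have "F (Poly_Mapping.map_key p m) = Poly_Mapping.lookup P (Poly_Mapping.map_key (p \<circ> r) m)"
      using F[OF d r] eq by simp
    also have "\<dots> = F m" using r p eq by (intro F[OF True, symmetric]) (simp add: bij_comp)
    finally show ?thesis .
  qed (simp add: F_def mdeg_map_key[OF p])
  then have "F \<in> Sym_le d" by (simp add: Sym_le_def F_def)
  moreover have "truncate_vars N F = Poly_Mapping.lookup P"
  proof
    fix m
    show "truncate_vars N F m = Poly_Mapping.lookup P m"
    proof (cases "Poly_Mapping.keys m \<subseteq> {..<N}")
      case True
      show ?thesis
      proof (cases "mdeg m \<le> d")
        case d: True
        then show ?thesis
          using F[OF d, of "\<lambda>x. x"] True by (simp add: truncate_vars_def map_key_id bij_id[unfolded id_def])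
      next
        case False
        then have "Poly_Mapping.lookup P m = 0"
          using SymPoly_le_mdeg[OF P, of m] assms(2) by force
        then show ?thesis using False by (simp add: truncate_vars_def F_def)
      qed
    next
      case False
      then show ?thesis using SymPoly_le_keys[OF P, of m] by (auto simp: truncate_vars_def)
    qed
  qed
  ultimately show ?thesis by blast
qed

lemma sym_iota_lookup:
  assumes "P \<in> SymPoly_le D N" "D \<le> d" "d \<le> N" "Poly_Mapping.keys m \<subseteq> {..<N}"
  shows "sym_iota d N P m = Poly_Mapping.lookup P m"
proof -
  obtain F where F: "F \<in> Sym_le d \<and> truncate_vars N F = Poly_Mapping.lookup P"
    using ex_Sym_le_extension[OF assms(1-3)] by blast
  have "sym_iota d N P = F"
    unfolding sym_iota_def
  proof (rule the_equality)
    show "F \<in> Sym_le d \<and> truncate_vars N F = Poly_Mapping.lookup P" by (rule F)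
    fix G assume "G \<in> Sym_le d \<and> truncate_vars N G = Poly_Mapping.lookup P"
    then show "G = F" using F by (auto intro!: Sym_le_unique[OF _ _ assms(3), of G F])
  qed
  then have "truncate_vars N (sym_iota d N P) m = Poly_Mapping.lookup P m" using F by simp
  then show ?thesis using assms(4) by (simp add: truncate_vars_def)
qed

lemma eventually_keys_subset: "\<forall>\<^sub>F N in sequentially. Poly_Mapping.keys (m :: monom) \<subseteq> {..<N}"
proof -
  obtain n where "\<forall>i\<in>Poly_Mapping.keys m. i < n"
    using finite_nat_set_iff_bounded[of "Poly_Mapping.keys m"] by auto
  then have "Poly_Mapping.keys m \<subseteq> {..<N}" if "n \<le> N" for N using that by fastforce
  then show ?thesis unfolding eventually_sequentially by blast
qed

lemma sym_limit_in_Sym_le: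
  assumes P: "\<forall>\<^sub>F N in sequentially. P N \<in> SymPoly_le D N"
    and lim: "\<And>m. (\<lambda>N. Poly_Mapping.lookup (P N) m) \<longlonglongrightarrow> F m"
  shows "F \<in> Sym_le D"
  unfolding Sym_le_def
proof (intro CollectI conjI allI impI)
  fix m assume "F m \<noteq> 0"
  show "mdeg m \<le> D"
  proof (rule ccontr)
    assume "\<not> mdeg m \<le> D"
    then have "\<forall>\<^sub>F N in sequentially. Poly_Mapping.lookup (P N) m = 0"
      using P by (auto elim!: eventually_mono dest: SymPoly_le_mdeg)
    then have "(\<lambda>N. Poly_Mapping.lookup (P N) m) \<longlonglongrightarrow> 0" by (rule tendsto_eventually)
    then show False using LIMSEQ_unique[OF lim] \<open>F m \<noteq> 0\<close> by blast
  qed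
next
  fix p :: "nat \<Rightarrow> nat" and m assume p: "bij p"
  have "\<forall>\<^sub>F N in sequentially. Poly_Mapping.lookup (P N) (Poly_Mapping.map_key p m) = Poly_Mapping.lookup (P N) m"
    using P eventually_keys_subset[of m] eventually_keys_subset[of "Poly_Mapping.map_key p m"]
    by eventually_elim (rule SymPoly_le_lookup_map_key[OF _ p])
  then have "(\<lambda>N. Poly_Mapping.lookup (P N) m) \<longlonglongrightarrow> F (Poly_Mapping.map_key p m)"
    using lim[of "Poly_Mapping.map_key p m"] by (rule Lim_transform_eventually[rotated])
  then show "F (Poly_Mapping.map_key p m) = F m" using lim LIMSEQ_unique by blast
qed

lemma eventually_sym_iota:
  assumes P: "\<forall>\<^sub>F N in sequentially. P N \<in> SymPoly_le D N" and "D \<le> d"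
  shows "\<forall>\<^sub>F N in sequentially. sym_iota d N (P N) m = Poly_Mapping.lookup (P N) m"
  using P eventually_keys_subset[of m] eventually_ge_at_top[of d]
  by eventually_elim (rule sym_iota_lookup[OF _ assms(2)])

text \<open>\<open>sym_iota d N\<close> with d at least \<open>D\<close> only adds coefficients at
  monomials outside the first \<open>N\<close> variables, and any given monomial lies inside once
  \<open>N\<close> is large. So \<open>d\<close> drops out of the definition.\<close>

lemma sym_converges_iff:
  assumes P: "\<forall>\<^sub>F N in sequentially. P N \<in> SymPoly_le D N"
  shows "sym_converges P F \<longleftrightarrow> (\<forall>m. (\<lambda>N. Poly_Mapping.lookup (P N) m) \<longlonglongrightarrow> F m)"
proof
  assume "sym_converges P F"
  then have "\<forall>\<^sub>F d in sequentially. \<forall>m. (\<lambda>N. sym_iota d N (P N) m) \<longlonglongrightarrow> F m"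
    unfolding sym_converges_def by (auto elim: eventually_mono)
  then have "\<forall>\<^sub>F d in sequentially. D \<le> d \<and> (\<forall>m. (\<lambda>N. sym_iota d N (P N) m) \<longlonglongrightarrow> F m)"
    using eventually_ge_at_top[of D] by eventually_elim auto
  then obtain d where d: "D \<le> d" "\<And>m. (\<lambda>N. sym_iota d N (P N) m) \<longlonglongrightarrow> F m"
    by (auto simp: eventually_sequentially)
  show "\<forall>m. (\<lambda>N. Poly_Mapping.lookup (P N) m) \<longlonglongrightarrow> F m"
    using Lim_transform_eventually[OF d(2) eventually_sym_iota[OF P d(1)]] by blast
next
  assume lim: "\<forall>m. (\<lambda>N. Poly_Mapping.lookup (P N) m) \<longlonglongrightarrow> F m"
  have F: "F \<in> Sym_le D" using P lim by (intro sym_limit_in_Sym_le) auto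
  have "F \<in> Sym_le d" "\<forall>m. (\<lambda>N. sym_iota d N (P N) m) \<longlonglongrightarrow> F m" if "D \<le> d" for d
  proof -
    show "F \<in> Sym_le d" using F that unfolding Sym_le_def by force
    show "\<forall>m. (\<lambda>N. sym_iota d N (P N) m) \<longlonglongrightarrow> F m"
    proof
      fix m
      have "\<forall>\<^sub>F N in sequentially. Poly_Mapping.lookup (P N) m = sym_iota d N (P N) m"
        by (rule eventually_mono[OF eventually_sym_iota[OF P that, of m]]) (erule sym)
      then show "(\<lambda>N. sym_iota d N (P N) m) \<longlonglongrightarrow> F m"
        using spec[OF lim, of m] by (rule Lim_transform_eventually[rotated])
    qed
  qed
  then show "sym_converges P F"
    unfolding sym_converges_def by (intro conjI exI[of _ D] P eventually_sequentiallyI[of D])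
qed

section \<open>The interpolation functions as limits\<close>

definition fpow_poly :: "(nat \<Rightarrow> complex) \<Rightarrow> nat \<Rightarrow> complex poly" where
  "fpow_poly cs m = (\<Prod>i<m. [:- cs i, 1:])"

lemma monic_seq_fpow_poly: "monic_seq (fpow_poly cs)"
proof -
  have "degree (fpow_poly cs n) = n \<and> coeff (fpow_poly cs n) n = 1" for n
  proof (induction n)
    case (Suc n)
    have eq: "fpow_poly cs (Suc n) = fpow_poly cs n * [:- cs n, 1:]" by (simp add: fpow_poly_def)
    have "degree (fpow_poly cs (Suc n)) = Suc n"
      unfolding eq using Suc by (subst degree_mult_eq) auto
    moreover have "coeff (fpow_poly cs (Suc n)) (Suc n) = 1"
      unfolding eq using Suc coeff_mult_degree_sum[of "fpow_poly cs n" "[:- cs n, 1:]"] by simp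
    ultimately show ?case by simp
  qed (simp add: fpow_poly_def)
  then show ?thesis by (simp add: monic_seq_def)
qed

lemma at_var_fpow_poly: "at_var j (fpow_poly cs m) = factorial_power (mvar j) cs m"
  by (simp add: fpow_poly_def factorial_power_def at_var_prod at_var_pCons mconst_uminus)

lemma factorial_schur_eq_gschur: "factorial_schur mu N cs = gschur N (fpow_poly cs) mu"
  unfolding factorial_schur_def gschur_def bialternant_def alternant_def fdet_def shifted_def
    at_var_fpow_poly ..

section \<open>Quasi-stability of the factorial Schur polynomials\<close>

definition qnodes :: "complex \<Rightarrow> nat \<Rightarrow> nat \<Rightarrow> complex" where
  "qnodes q N = (\<lambda>k. q powi (int N - 1 - int k))"

definition eval_var :: "nat \<Rightarrow> complex \<Rightarrow> nat \<Rightarrow> mpoly" where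
  "eval_var N a i = (if i = N then mconst a else mvar i)"

lemma mvar_neq_mconst: "mvar j \<noteq> mconst a"
proof
  assume "mvar j = mconst a"
  then have "Poly_Mapping.lookup (mvar j) (Poly_Mapping.single j 1) =
      Poly_Mapping.lookup (mconst a) (Poly_Mapping.single j 1)" by simp
  moreover have "(Poly_Mapping.single j 1 :: monom) \<noteq> 0"
    by (metis lookup_single_eq lookup_zero zero_neq_one)
  ultimately show False by (simp add: mvar_def mconst_def lookup_single when_def)
qed

lemma fpow_poly_Suc_qnodes:
  "fpow_poly (qnodes q (Suc N)) (Suc m) = [:- (q ^ N), 1:] * fpow_poly (qnodes q N) m"
proof -
  have "fpow_poly (qnodes q (Suc N)) (Suc m) =
      [:- qnodes q (Suc N) 0, 1:] * (\<Prod>i<m. [:- qnodes q (Suc N) (Suc i), 1:])"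
    unfolding fpow_poly_def by (rule prod.lessThan_Suc_shift)
  moreover have "qnodes q (Suc N) (Suc i) = qnodes q N i" for i
    by (simp add: qnodes_def diff_diff_eq)
  moreover have "qnodes q (Suc N) 0 = q ^ N" by (simp add: qnodes_def)
  ultimately show ?thesis unfolding fpow_poly_def by (simp only:)
qed

text \<open>The node gained on passing from \<open>N\<close> to N + 1 variables is q^N, and it comes
  first. At x_N = q^N every row of positive degree vanishes, and only the last row has degree 0; in
  the other columns the common root comes out as x_j - q^N. The Vandermonde polynomial, as the case
  of the empty partition, yields the same product, which therefore cancels in the quotient.\<close>

lemma msubst_alternant_fpow_poly:
  assumes mu: "is_partition mu" and len: "plength mu \<le> N"
  shows "msubst (eval_var N (q ^ N))
      (alternant (Suc N) (\<lambda>i. fpow_poly (qnodes q (Suc N)) (shifted (Suc N) mu i))) =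
    (\<Prod>j<N. mvar j - mconst (q ^ N)) *
      alternant N (\<lambda>i. fpow_poly (qnodes q N) (shifted N mu i))"
proof -
  let ?f = "\<lambda>i. fpow_poly (qnodes q (Suc N)) (shifted (Suc N) mu i)"
  let ?g = "\<lambda>i j. if j = N then mconst (poly (?f i) (q ^ N)) else at_var j (?f i)"
  have sh: "shifted (Suc N) mu i = Suc (shifted N mu i)" if "i < N" for i
    using that by (simp add: shifted_def Suc_diff_Suc)
  have shN: "shifted (Suc N) mu N = 0"
    using partition_zero_iff[OF mu, of N] len by (simp add: shifted_def)
  have "msubst (eval_var N (q ^ N)) (alternant (Suc N) ?f) = fdet (Suc N) ?g"
    unfolding alternant_def msubst_fdet
    by (rule fdet_cong) (auto simp: eval_var_def msubst_at_var_mvar msubst_at_var_mconst)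
  also have "\<dots> = ?g N N * fdet N ?g"
    by (rule fdet_drop_last_col) (simp add: sh fpow_poly_Suc_qnodes)
  also have "?g N N = 1" by (simp add: shN fpow_poly_def)
  also have "fdet N ?g = fdet N (\<lambda>i j. 1 * at_var j (fpow_poly (qnodes q N) (shifted N mu i)) *
      (mvar j - mconst (q ^ N)))"
    by (rule fdet_cong) (simp add: sh fpow_poly_Suc_qnodes at_var_mult at_var_pCons mconst_uminus mult_ac
        del: mult_pCons_left)
  also have "\<dots> = (\<Prod>j<N. mvar j - mconst (q ^ N)) *
      alternant N (\<lambda>i. fpow_poly (qnodes q N) (shifted N mu i))"
    unfolding fdet_scale alternant_def by simp
  finally show ?thesis by simp
qed

lemma msubst_gschur_qnodes:
  assumes "is_partition mu" "plength mu \<le> N"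
  shows "msubst (eval_var N (q ^ N)) (gschur (Suc N) (fpow_poly (qnodes q (Suc N))) mu) =
    gschur N (fpow_poly (qnodes q N)) mu"
proof -
  let ?s = "msubst (eval_var N (q ^ N))" and ?b = "\<Prod>j<N. mvar j - mconst (q ^ N)"
  let ?P = "\<lambda>N. gschur N (fpow_poly (qnodes q N)) mu"
  let ?A = "\<lambda>N mu. alternant N (\<lambda>i. fpow_poly (qnodes q N) (shifted N mu i))"
  have V: "vandermonde N = ?A N (\<lambda>_. 0)" for N
    using vandermonde_eq_alternant[OF monic_seq_fpow_poly, of N] by (simp add: shifted_def)
  have sV: "?s (vandermonde (Suc N)) = ?b * vandermonde N"
    unfolding V by (rule msubst_alternant_fpow_poly) (auto simp: is_partition_zero plength_def)
  have "?s (?P (Suc N)) * ?s (vandermonde (Suc N)) = ?s (?A (Suc N) mu)"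
    unfolding msubst_mult[symmetric] gschur_def bialternant_mult_vandermonde ..
  also have "\<dots> = ?b * ?A N mu" by (rule msubst_alternant_fpow_poly[OF assms])
  also have "?A N mu = ?P N * vandermonde N"
    by (simp add: gschur_def bialternant_mult_vandermonde)
  finally have "?s (?P (Suc N)) * (?b * vandermonde N) = ?P N * (?b * vandermonde N)"
    unfolding sV by (simp add: mult_ac)
  moreover have "?b \<noteq> 0" by (auto simp: prod_zero_iff mvar_neq_mconst)
  then have "?b * vandermonde N \<noteq> 0" using vandermonde_nonzero[of N] by simp
  ultimately show ?thesis using mult_right_cancel by blast
qed

lemma lookup_mon_ev_eval_var:
  assumes m: "Poly_Mapping.lookup m N = 0" and D: "Poly_Mapping.lookup m' N \<le> D"
  shows "Poly_Mapping.lookup (mon_ev (eval_var N a) m') m =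
    (\<Sum>k\<le>D. a ^ k when m' = m + Poly_Mapping.single N k)"
proof -
  define k where "k = Poly_Mapping.lookup m' N"
  define r where "r = m' - Poly_Mapping.single N k"
  have m': "m' = r + Poly_Mapping.single N k"
    by (rule poly_mapping_eqI) (auto simp: r_def k_def lookup_add lookup_minus lookup_single when_def)
  have rN: "Poly_Mapping.lookup r N = 0" by (simp add: r_def k_def lookup_minus)
  have "mon_ev (eval_var N a) r = mon_ev mvar r"
    unfolding mon_ev_def by (rule prod.cong) (use rN in \<open>auto simp: eval_var_def in_keys_iff\<close>)
  also have "\<dots> = Poly_Mapping.single r 1"
    using mon_ev_mvar_comp[of "\<lambda>i. i" r] by (simp add: sum_single_lookup)
  finally have "mon_ev (eval_var N a) m' = mconst a ^ k * Poly_Mapping.single r 1"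
    unfolding m' by (simp add: mon_ev_add mon_ev_single eval_var_def mult.commute)
  also have "mconst a ^ k = mconst (a ^ k)" by (induction k) (simp_all add: mconst_mult)
  finally have "Poly_Mapping.lookup (mon_ev (eval_var N a) m') m = (a ^ k when r = m)"
    by (simp add: lookup_single when_def)
  also have "\<dots> = (\<Sum>k'\<le>D. if k' = k then a ^ k when r = m else 0)"
    using D by (simp add: k_def)
  also have "\<dots> = (\<Sum>k'\<le>D. a ^ k' when m' = m + Poly_Mapping.single N k')"
  proof (rule sum.cong[OF refl])
    fix k'
    have "m' = m + Poly_Mapping.single N k' \<longleftrightarrow> r = m \<and> k' = k"
    proof
      assume eq: "m' = m + Poly_Mapping.single N k'"
      then have "k = k'" using m by (simp add: k_def lookup_add)
      then show "r = m \<and> k' = k" using eq m' by simp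
    qed (simp add: m')
    then show "(if k' = k then a ^ k when r = m else 0) = (a ^ k' when m' = m + Poly_Mapping.single N k')"
      by (simp add: when_def)
  qed
  finally show ?thesis .
qed

lemma lookup_le_mdeg: "Poly_Mapping.lookup m i \<le> mdeg m"
  unfolding mdeg_def by (cases "i \<in> Poly_Mapping.keys m") (auto intro: member_le_sum simp: in_keys_iff)

text \<open>The term k = 0 is the coefficient of \<open>P\<close> at \<open>m\<close> itself, so the
  remaining terms measure by how much specialization fails to be truncation.\<close>

lemma lookup_msubst_eval_var:
  assumes m: "Poly_Mapping.lookup m N = 0"
    and D: "\<And>k. Poly_Mapping.lookup P k \<noteq> 0 \<Longrightarrow> mdeg k \<le> D"
  shows "Poly_Mapping.lookup (msubst (eval_var N a) P) m =
    (\<Sum>k\<le>D. Poly_Mapping.lookup P (m + Poly_Mapping.single N k) * a ^ k)"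
proof -
  have "Poly_Mapping.lookup (msubst (eval_var N a) P) m =
      (\<Sum>m'\<in>Poly_Mapping.keys P. Poly_Mapping.lookup P m' *
        (\<Sum>k\<le>D. a ^ k when m' = m + Poly_Mapping.single N k))"
    unfolding msubst_def lookup_sum lookup_mconst_mult
  proof (rule sum.cong[OF refl])
    fix m' assume "m' \<in> Poly_Mapping.keys P"
    then have "Poly_Mapping.lookup m' N \<le> D"
      using D[of m'] lookup_le_mdeg[of m' N] by (simp add: in_keys_iff)
    then show "Poly_Mapping.lookup P m' * Poly_Mapping.lookup (mon_ev (eval_var N a) m') m =
        Poly_Mapping.lookup P m' * (\<Sum>k\<le>D. a ^ k when m' = m + Poly_Mapping.single N k)"
      by (simp add: lookup_mon_ev_eval_var[OF m])
  qed
  also have "\<dots> = (\<Sum>k\<le>D. \<Sum>m'\<in>Poly_Mapping.keys P.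
      if m' = m + Poly_Mapping.single N k then Poly_Mapping.lookup P m' * a ^ k else 0)"
    unfolding sum_distrib_left by (subst sum.swap) (auto simp: when_def intro!: sum.cong)
  also have "\<dots> = (\<Sum>k\<le>D. Poly_Mapping.lookup P (m + Poly_Mapping.single N k) * a ^ k)"
    by (intro sum.cong refl) (auto simp: sum.delta in_keys_iff)
  finally show ?thesis .
qed

lemma convergent_of_geometric_steps:
  fixes x :: "nat \<Rightarrow> complex"
  assumes "0 \<le> r" "r < 1" and "\<forall>\<^sub>F n in sequentially. norm (x (Suc n) - x n) \<le> B * r ^ n"
  shows "convergent x"
proof -
  have "summable (\<lambda>n. B * r ^ n)"
    using assms(1,2) by (intro summable_mult summable_geometric) simp
  then have "summable (\<lambda>n. x (Suc n) - x n)"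
    by (rule summable_comparison_test_ev[OF assms(3)])
  then have "convergent (\<lambda>n. \<Sum>k<n. x (Suc k) - x k)"
    by (simp add: summable_iff_convergent)
  then have "convergent (\<lambda>n. x n - x 0)" by (simp only: sum_lessThan_telescope)
  then have "convergent (\<lambda>n. (x n - x 0) + x 0)" by (intro convergent_add convergent_const)
  then show ?thesis by simp
qed

text \<open>
  By symmetry the variable \<open>x\<^sub>N\<close> that is specialized to \<open>q\<^sup>N\<close> may be exchanged for a fixed variable
  outside \<open>m\<close>. So consecutive coefficients at \<open>m\<close> differ by \<open>O(|q|\<^sup>N)\<close> once the coefficients at
  monomials of higher degree are bounded, whence the downward induction on the degree.
\<close>

lemma convergent_lookup_quasistable:
  fixes q :: complex
  assumes q: "norm q < 1"
    and P: "\<forall>\<^sub>F N in sequentially. P N \<in> SymPoly_le D N"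
    and step: "\<forall>\<^sub>F N in sequentially. msubst (eval_var N (q ^ N)) (P (Suc N)) = P N"
  shows "convergent (\<lambda>N. Poly_Mapping.lookup (P N) m)"
proof (induction "Suc D - mdeg m" arbitrary: m rule: less_induct)
  case less
  show ?case
  proof (cases "mdeg m \<le> D")
    case False
    then have "\<forall>\<^sub>F N in sequentially. Poly_Mapping.lookup (P N) m = 0"
      using P by (auto elim!: eventually_mono dest: SymPoly_le_mdeg)
    then show ?thesis by (intro convergentI tendsto_eventually)
  next
    case True
    obtain r where r: "r \<notin> Poly_Mapping.keys m"
      using ex_new_if_finite[OF infinite_UNIV_nat finite_keys] by blast
    define y where "y k N = Poly_Mapping.lookup (P N) (m + Poly_Mapping.single r k)" for k N
    have "convergent (y k)" if "k \<noteq> 0" for k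
      unfolding y_def by (rule less) (use that True in \<open>simp add: mdeg_add\<close>)
    then have "\<exists>b. \<forall>N. norm (y k N) \<le> b" if "k \<noteq> 0" for k
      using that convergent_imp_Bseq[of "y k"] by (auto simp: Bseq_def)
    then obtain b where b: "\<And>k N. k \<noteq> 0 \<Longrightarrow> norm (y k N) \<le> b k" by metis
    have P_Suc: "\<forall>\<^sub>F N in sequentially. P (Suc N) \<in> SymPoly_le D (Suc N)"
      using P eventually_sequentially_Suc[of "\<lambda>N. P N \<in> SymPoly_le D N"] by blast
    have "\<forall>\<^sub>F N in sequentially. norm (Poly_Mapping.lookup (P (Suc N)) m - Poly_Mapping.lookup (P N) m)
        \<le> (\<Sum>k=1..D. b k) * norm q ^ N"
      using P_Suc step eventually_keys_subset[of m] eventually_gt_at_top[of r]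
    proof eventually_elim
      case (elim N)
      have mN: "Poly_Mapping.lookup m N = 0" using elim(3) not_in_keys_iff_lookup_eq_zero by fastforce
      have mr: "Poly_Mapping.lookup m r = 0" using r by (simp add: in_keys_iff)
      have swap: "Poly_Mapping.lookup (P (Suc N)) (m + Poly_Mapping.single N k) = y k (Suc N)" for k
      proof -
        let ?t = "Transposition.transpose r N"
        have t: "?t permutes {..<Suc N}" using elim(4) by (intro permutes_swap_id) auto
        have "Poly_Mapping.map_key ?t (m + Poly_Mapping.single r k) = m + Poly_Mapping.single N k"
          using mN mr by (intro poly_mapping_eqI)
            (auto simp: lookup_map_key permutes_inj[OF t] lookup_add lookup_single when_def
              Transposition.transpose_def)
        moreover have "Poly_Mapping.lookup (P (Suc N)) (Poly_Mapping.map_key ?t k) =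
            Poly_Mapping.lookup (P (Suc N)) k" for k
          using elim(1) t by (simp add: SymPoly_le_def)
        ultimately show ?thesis unfolding y_def by metis
      qed
      have "Poly_Mapping.lookup (P N) m =
          (\<Sum>k\<le>D. Poly_Mapping.lookup (P (Suc N)) (m + Poly_Mapping.single N k) * (q ^ N) ^ k)"
        unfolding elim(2)[symmetric]
        by (rule lookup_msubst_eval_var[OF mN]) (rule SymPoly_le_mdeg[OF elim(1)])
      also have "\<dots> = y 0 (Suc N) + (\<Sum>k=1..D. y k (Suc N) * (q ^ N) ^ k)"
        unfolding swap atMost_atLeast0 by (subst sum.atLeast_Suc_atMost) auto
      also have "y 0 (Suc N) = Poly_Mapping.lookup (P (Suc N)) m" by (simp add: y_def)
      finally have "norm (Poly_Mapping.lookup (P (Suc N)) m - Poly_Mapping.lookup (P N) m) =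
          norm (\<Sum>k=1..D. y k (Suc N) * (q ^ N) ^ k)" by simp
      also have "\<dots> \<le> (\<Sum>k=1..D. b k * norm q ^ N)"
      proof (rule sum_norm_le)
        fix k assume k: "k \<in> {1..D}"
        have "norm q ^ (N * k) \<le> norm q ^ N"
          using q k by (intro power_decreasing) auto
        moreover have "norm (y k 0) \<le> b k" using b k by simp
        then have "0 \<le> b k" by (rule order_trans[OF norm_ge_zero])
        ultimately show "norm (y k (Suc N) * (q ^ N) ^ k) \<le> b k * norm q ^ N"
          unfolding norm_mult norm_power power_mult[symmetric]
          using k by (intro mult_mono b) auto
      qed
      finally show ?case by (simp add: sum_distrib_right)
    qed
    then show ?thesis using q by (intro convergent_of_geometric_steps) auto
  qed
qed

lemma gschur_qnodes_SymPoly_le: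
  assumes "is_partition mu"
  shows "\<forall>\<^sub>F N in sequentially. gschur N (fpow_poly (qnodes q N)) mu \<in> SymPoly_le (psize mu) N"
  using eventually_ge_at_top[of "plength mu"]
  by eventually_elim (rule gschur_SymPoly_le[OF monic_seq_fpow_poly assms])

lemma interp_fun_limit:
  assumes q: "norm q < 1" and mu: "is_partition mu"
  shows "(\<lambda>N. Poly_Mapping.lookup (gschur N (fpow_poly (qnodes q N)) mu) m) \<longlonglongrightarrow> interp_fun q mu m"
proof -
  let ?P = "\<lambda>N. gschur N (fpow_poly (qnodes q N)) mu"
  define F where "F m = lim (\<lambda>N. Poly_Mapping.lookup (?P N) m)" for m
  have step: "\<forall>\<^sub>F N in sequentially. msubst (eval_var N (q ^ N)) (?P (Suc N)) = ?P N"
    using eventually_ge_at_top[of "plength mu"]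
    by eventually_elim (rule msubst_gschur_qnodes[OF mu])
  have lim: "(\<lambda>N. Poly_Mapping.lookup (?P N) m) \<longlonglongrightarrow> F m" for m
    unfolding F_def convergent_LIMSEQ_iff[symmetric]
    by (rule convergent_lookup_quasistable[OF q gschur_qnodes_SymPoly_le[OF mu] step])
  have iff: "sym_converges ?P G \<longleftrightarrow> (\<forall>m. (\<lambda>N. Poly_Mapping.lookup (?P N) m) \<longlonglongrightarrow> G m)" for G
    by (rule sym_converges_iff[OF gschur_qnodes_SymPoly_le[OF mu]])
  have "interp_fun q mu = F"
    unfolding interp_fun_def factorial_schur_eq_gschur qnodes_def[symmetric]
  proof (rule the_equality)
    show "sym_converges ?P F" unfolding iff using lim by blast
    fix G assume "sym_converges ?P G"
    then have "(\<lambda>N. Poly_Mapping.lookup (?P N) m) \<longlonglongrightarrow> G m" for m unfolding iff by blast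
    then show "G = F" using lim LIMSEQ_unique by blast
  qed
  then show ?thesis using lim by simp
qed

section \<open>Orthogonality from a three-term recurrence\<close>

lemma moment_fun_add: "moment_fun M (p + r) = moment_fun M p + moment_fun M r"
proof -
  let ?D = "max (degree p) (degree r)"
  have "degree (p + r) \<le> ?D" by (rule degree_add_le_max)
  then show ?thesis
    by (simp add: moment_fun_sum[of _ ?D] distrib_right sum.distrib)
qed

lemma moment_fun_smult: "moment_fun M (smult a p) = a * moment_fun M p"
  by (simp add: moment_fun_sum[OF degree_smult_le] moment_fun_def sum_distrib_left mult_ac)

lemma moment_fun_0 [simp]: "moment_fun M 0 = 0"
  by (simp add: moment_fun_def)

lemma moment_fun_sum_distrib: "moment_fun M (\<Sum>x\<in>A. f x) = (\<Sum>x\<in>A. moment_fun M (f x))"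
  by (induction A rule: infinite_finite_induct) (auto simp: moment_fun_add)

text \<open>The leading coefficient of \<open>W n\<close> is 1, so requiring the functional to be 1
  on \<open>W 0\<close> and 0 on all later \<open>W n\<close> determines one moment after the
  other.\<close>

function moments :: "(nat \<Rightarrow> complex poly) \<Rightarrow> nat \<Rightarrow> complex" where
  "moments W n = (if n = 0 then 1 else 0) - (\<Sum>k<n. coeff (W n) k * moments W k)"
  by auto
termination by (relation "measure snd") auto

declare moments.simps [simp del]

lemma moment_fun_moments:
  assumes "monic_seq W"
  shows "moment_fun (moments W) (W n) = (if n = 0 then 1 else 0)"
proof -
  have "moment_fun (moments W) (W n) = (\<Sum>k\<le>n. coeff (W n) k * moments W k)"
    using assms by (intro moment_fun_sum) (simp add: monic_seq_def)
  also have "\<dots> = moments W n + (\<Sum>k<n. coeff (W n) k * moments W k)"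
    using assms by (simp add: lessThan_Suc_atMost[symmetric] monic_seq_def)
  also have "\<dots> = (if n = 0 then 1 else 0)"
    by (subst moments.simps) simp
  finally show ?thesis .
qed

text \<open>For n = 0 the index n - 1 is truncated to 0, and \<open>a_0\<close> removes that
  term.\<close>

locale three_term =
  fixes W :: "nat \<Rightarrow> complex poly" and b a :: "nat \<Rightarrow> complex"
  assumes monic: "monic_seq W"
    and rec: "\<And>n. [:0, 1:] * W n = W (Suc n) + smult (b n) (W n) + smult (a n) (W (n - 1))"
    and a_0: "a 0 = 0"
begin

abbreviation L :: "complex poly \<Rightarrow> complex" where
  "L \<equiv> moment_fun (moments W)"

lemma L_monom_Suc:
  "L (monom 1 (Suc k) * W n) =
    L (monom 1 k * W (Suc n)) + b n * L (monom 1 k * W n) + a n * L (monom 1 k * W (n - 1))"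
proof -
  have "monom 1 (Suc k) * W n = monom 1 k * ([:0, 1:] * W n)"
    by (simp add: monom_Suc)
  also have "\<dots> = monom 1 k * W (Suc n) + smult (b n) (monom 1 k * W n) +
      smult (a n) (monom 1 k * W (n - 1))"
    unfolding rec by (simp add: distrib_left)
  finally show ?thesis by (simp only: moment_fun_add moment_fun_smult)
qed

lemma L_monom_less: "k < n \<Longrightarrow> L (monom 1 k * W n) = 0"
proof (induction k arbitrary: n)
  case 0
  then show ?case by (simp add: moment_fun_moments[OF monic] monom_0 flip: one_pCons)
next
  case (Suc k)
  then show ?case by (simp add: L_monom_Suc)
qed

text \<open>Of the three terms of the recurrence only the lowering one reaches an index not above
  the exponent of x; each step thus contributes one \<open>a\<close>.\<close>

lemma L_monom_eq: "L (monom 1 n * W n) = (\<Prod>i<n. a (Suc i))"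
proof (induction n)
  case 0
  then show ?case by (simp add: moment_fun_moments[OF monic] monom_0 flip: one_pCons)
next
  case (Suc n)
  have "L (monom 1 (Suc n) * W (Suc n)) = a (Suc n) * L (monom 1 n * W n)"
    by (simp add: L_monom_Suc L_monom_less)
  then show ?case by (simp only: Suc prod.lessThan_Suc mult.commute[of "a (Suc n)"])
qed

lemma L_mult_le:
  assumes "m \<le> n"
  shows "L (W m * W n) = (if m = n then \<Prod>i<n. a (Suc i) else 0)"
proof -
  have deg: "degree (W m) = m" and lead: "coeff (W m) m = 1" using monic by (auto simp: monic_seq_def)
  have "W m = (\<Sum>k\<le>m. smult (coeff (W m) k) (monom 1 k))"
    using poly_as_sum_of_monoms'[of "W m" m] deg by (simp add: smult_monom)
  then have "W m * W n = (\<Sum>k\<le>m. smult (coeff (W m) k) (monom 1 k * W n))"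
    by (metis (no_types, lifting) mult_smult_left sum.cong sum_distrib_right)
  then have "L (W m * W n) = (\<Sum>k\<le>m. coeff (W m) k * L (monom 1 k * W n))"
    by (simp add: moment_fun_sum_distrib moment_fun_smult)
  also have "\<dots> = L (monom 1 m * W n)"
    using assms lead by (simp add: lessThan_Suc_atMost[symmetric] L_monom_less)
  also have "\<dots> = (if m = n then \<Prod>i<n. a (Suc i) else 0)"
    using assms by (simp add: L_monom_less L_monom_eq)
  finally show ?thesis .
qed

lemma L_mult: "L (W m * W n) = (if m = n then \<Prod>i<n. a (Suc i) else 0)"
  using L_mult_le[of m n] L_mult_le[of n m] by (cases "m \<le> n") (auto simp: mult.commute)

end

section \<open>Al-Salam--Carlitz polynomials\<close>

lemma qpoch_0 [simp]: "qpoch x q 0 = 1"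
  and qpoch_Suc: "qpoch x q (Suc n) = qpoch x q n * (1 - x * q ^ n)"
  by (simp_all add: qpoch_def)

lemma smult_sum_right: "smult c (\<Sum>x\<in>A. f x) = (\<Sum>x\<in>A. smult c (f x))"
  by (induction A rule: infinite_finite_induct) (auto simp: smult_add_right)

lemma choose_2_Suc: "Suc n choose 2 = (n choose 2) + n"
  by (simp add: numeral_2_eq_2)

text \<open>
  \<open>asc_poly\<close> below are the monic Al-Salam--Carlitz polynomials of the second kind, expanded at the
  nodes \<open>Q, Q/q, Q/q\<^sup>2, \<dots>\<close>; in \<open>N\<close> variables \<open>Q = q\<^bsup>N-1\<^esup>\<close>. The coefficients are
  \<open>(-\<beta>Q)\<^bsup>n-k\<^esup> q\<^bsup>C(k,2)-C(n,2)\<^esup>\<close> times a \<open>q\<close>-binomial, written as a quotient \<open>asc_scale n / asc_scale k\<close>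
  times \<open>1 / (q;q)\<^bsub>n-k\<^esub>\<close>, so that the factors \<open>asc_scale\<close> can be pulled out of determinants.
\<close>

locale asc =
  fixes q \<beta> Q :: complex
  assumes q_norm: "norm q < 1" and q_nz: "q \<noteq> 0" and \<beta>_nz: "\<beta> \<noteq> 0" and Q_nz: "Q \<noteq> 0"
begin

lemma power_neq_1: "q * q ^ n \<noteq> 1"
proof
  assume "q * q ^ n = 1"
  then have "q ^ Suc n = 1" by simp
  then have "norm (q ^ Suc n) = 1" by (metis norm_one)
  moreover have "norm (q ^ Suc n) < 1"
    unfolding norm_power using power_decreasing[of 1 "Suc n" "norm q"] q_norm by simp
  ultimately show False by simp
qed

lemma one_minus_power_nz: "1 - q * q ^ n \<noteq> 0"
  using power_neq_1[of n] by simp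

lemma qpoch_nz: "qpoch q q n \<noteq> 0"
  by (induction n) (simp_all add: qpoch_Suc power_neq_1)

definition asc_scale :: "nat \<Rightarrow> complex" where
  "asc_scale n = (- \<beta> * Q) ^ n * (1 / q) ^ (n choose 2) * qpoch q q n"

lemma asc_scale_nz: "asc_scale n \<noteq> 0"
  using q_nz \<beta>_nz Q_nz qpoch_nz by (simp add: asc_scale_def)

lemma asc_scale_Suc: "asc_scale (Suc n) = asc_scale n * (- \<beta> * Q) * (1 - q * q ^ n) / q ^ n"
  by (simp add: asc_scale_def qpoch_Suc choose_2_Suc power_add power_one_over field_simps)

definition asc_entry :: "nat \<Rightarrow> nat \<Rightarrow> complex" where
  "asc_entry n k = (if k \<le> n then 1 / qpoch q q (n - k) else 0)"

definition asc_coeff :: "nat \<Rightarrow> nat \<Rightarrow> complex" where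
  "asc_coeff n k = asc_scale n / asc_scale k * asc_entry n k"

definition node_poly :: "nat \<Rightarrow> complex poly" where
  "node_poly = fpow_poly (\<lambda>k. Q / q ^ k)"

definition asc_poly :: "nat \<Rightarrow> complex poly" where
  "asc_poly n = (\<Sum>k\<le>n. smult (asc_coeff n k) (node_poly k))"

text \<open>After x is rescaled by Q, \<open>asc_b\<close> and \<open>asc_a\<close> become the
  standard recurrence coefficients (1 + \<beta>) q^(-n) and \<beta> q^(1-2n) (1 - q^n) of the
  Al-Salam--Carlitz polynomials of the second kind with parameter \<beta>.\<close>

definition asc_b :: "nat \<Rightarrow> complex" where
  "asc_b n = Q * (1 + \<beta>) / q ^ n"

definition asc_a :: "nat \<Rightarrow> complex" where
  "asc_a n = Q ^ 2 * \<beta> * q * (1 - q ^ n) / q ^ (2 * n)"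

lemma asc_coeff_zero: "n < k \<Longrightarrow> asc_coeff n k = 0"
  by (simp add: asc_coeff_def asc_entry_def)

lemma asc_coeff_self: "asc_coeff n n = 1"
  using asc_scale_nz by (simp add: asc_coeff_def asc_entry_def)

lemma asc_poly_sum: "n < K \<Longrightarrow> asc_poly n = (\<Sum>k<K. smult (asc_coeff n k) (node_poly k))"
  unfolding asc_poly_def
  by (rule sum.mono_neutral_left) (auto simp: asc_coeff_zero not_le)

lemma x_mult_node_poly: "[:0, 1:] * node_poly k = node_poly (Suc k) + smult (Q / q ^ k) (node_poly k)"
proof -
  have "node_poly (Suc k) = node_poly k * [:- (Q / q ^ k), 1:]" by (simp add: node_poly_def fpow_poly_def)
  then show ?thesis by (simp add: mult.commute)
qed

lemma monic_seq_asc_poly: "monic_seq asc_poly"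
proof -
  have node_poly: "degree (node_poly k) = k" "coeff (node_poly k) k = 1" for k
    using monic_seq_fpow_poly unfolding node_poly_def monic_seq_def by blast+
  have "degree (asc_poly n) = n \<and> coeff (asc_poly n) n = 1" for n
  proof -
    have "coeff (asc_poly n) n = (\<Sum>k\<le>n. asc_coeff n k * coeff (node_poly k) n)"
      by (simp add: asc_poly_def coeff_sum)
    also have "\<dots> = (\<Sum>k\<le>n. if k = n then 1 else 0)"
      by (intro sum.cong) (auto simp: node_poly asc_coeff_self coeff_eq_0)
    finally have "coeff (asc_poly n) n = 1" by simp
    moreover have "degree (asc_poly n) \<le> n"
      unfolding asc_poly_def by (rule degree_sum_le) (auto simp: node_poly intro: order_trans[OF degree_smult_le])
    ultimately show ?thesis using le_degree[of "asc_poly n" n] by simp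
  qed
  then show ?thesis by (simp add: monic_seq_def)
qed

text \<open>The three-term recurrence compared at \<open>node_poly k\<close>: multiplication by x
  raises the index k by one and adds Q/q^k times the same node polynomial, whence the shifted
  coefficient in the case distinction.\<close>

lemma asc_coeff_recurrence:
  "(case k of 0 \<Rightarrow> 0 | Suc k' \<Rightarrow> asc_coeff n k') + asc_coeff n k * (Q / q ^ k) =
    asc_coeff (Suc n) k + asc_b n * asc_coeff n k + asc_a n * asc_coeff (n - 1) k"
proof (cases "k \<le> n")
  case True
  define m where "m = n - k"
  have n: "n = m + k" using True by (simp add: m_def)
  \<comment> \<open>All coefficients become multiples of \<open>?r\<close>. Its denominator
    (q;q)_(m+1) is the largest that occurs, since lowering k or raising n increases the distance m
    by one.\<close>
  let ?r = "asc_scale n / asc_scale k / qpoch q q (Suc m)"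
  have qm: "1 / qpoch q q m = (1 - q * q ^ m) / qpoch q q (Suc m)"
    using one_minus_power_nz[of m] by (simp add: qpoch_Suc)
  have 1: "(case k of 0 \<Rightarrow> 0 | Suc k' \<Rightarrow> asc_coeff n k') = ?r * (- \<beta> * Q * q * (1 - q ^ k) / q ^ k)"
  proof (cases k)
    case (Suc k')
    have "n - k' = Suc m" using Suc n by simp
    then have "asc_coeff n k' = asc_scale n / asc_scale k' / qpoch q q (Suc m)" by (simp add: asc_coeff_def asc_entry_def n Suc)
    moreover have "1 / asc_scale k' = - \<beta> * Q * q * (1 - q ^ k) / q ^ k / asc_scale k"
      using asc_scale_nz[of k'] q_nz \<beta>_nz Q_nz one_minus_power_nz[of k']
      by (simp add: Suc asc_scale_Suc field_simps)
    then have "asc_scale n / asc_scale k' = asc_scale n / asc_scale k * (- \<beta> * Q * q * (1 - q ^ k) / q ^ k)"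
      by (simp add: divide_inverse mult_ac)
    ultimately show ?thesis by (simp add: Suc)
  qed simp
  have 2: "asc_coeff n k = ?r * (1 - q * q ^ m)"
  proof -
    have "asc_coeff n k = asc_scale n / asc_scale k * (1 / qpoch q q m)"
      using True by (simp add: asc_coeff_def asc_entry_def m_def)
    then show ?thesis unfolding qm by simp
  qed
  have 3: "asc_coeff (Suc n) k = ?r * (- \<beta> * Q * (1 - q * q ^ n) / q ^ n)"
  proof -
    have "Suc n - k = Suc m" by (simp add: n)
    then show ?thesis using True by (simp add: asc_coeff_def asc_entry_def asc_scale_Suc mult_ac)
  qed
  have 4: "asc_a n * asc_coeff (n - 1) k = - ?r * (Q * (1 - q ^ m) * (1 - q * q ^ m) / q ^ n)"
  proof (cases "m = 0")
    case True
    show ?thesis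
    proof (cases n)
      case 0
      then show ?thesis using True by (simp add: asc_a_def)
    next
      case (Suc n')
      then show ?thesis using True n by (simp add: asc_coeff_zero)
    qed
  next
    case False
    then obtain m' where m': "m = Suc m'" by (cases m) auto
    then obtain n' where n': "n = Suc n'" "n' - k = m'" "k \<le> n'" using n by (cases n) auto
    have "asc_a n * asc_coeff (n - 1) k = asc_a n * asc_scale n' / asc_scale k * (1 / qpoch q q m')"
      by (simp add: asc_coeff_def asc_entry_def n')
    also have "1 / qpoch q q m' = (1 - q ^ m) * (1 - q * q ^ m) / qpoch q q (Suc m)"
      using one_minus_power_nz[of m'] one_minus_power_nz[of m] by (simp add: qpoch_Suc m')
    also have "asc_a n * asc_scale n' = - asc_scale n * Q / q ^ n"
      using q_nz by (simp add: asc_a_def n' asc_scale_Suc field_simps power2_eq_square power_mult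
        flip: power_mult_distrib)
    finally show ?thesis by (simp add: divide_inverse mult_ac)
  qed
  \<comment> \<open>With \<open>?r\<close> removed, this is an identity of rational expressions in
    q^k and q^m, because n = m + k.\<close>
  have "- \<beta> * Q * q * (1 - q ^ k) / q ^ k + (1 - q * q ^ m) * (Q / q ^ k) =
      - \<beta> * Q * (1 - q * q ^ n) / q ^ n + asc_b n * (1 - q * q ^ m)
        - Q * (1 - q ^ m) * (1 - q * q ^ m) / q ^ n"
    using q_nz by (simp add: asc_b_def n power_add field_simps)
  moreover have "r * x + r * y * z = r * u + b * (r * y) + - r * v"
    if "x + y * z = u + b * y - v" for r x y z u b v :: complex
  proof -
    have "r * (x + y * z) = r * (u + b * y - v)" using that by simp
    then show ?thesis by (simp add: algebra_simps)
  qed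
  ultimately show ?thesis unfolding 1 2 3 4 by blast
next
  case False
  then show ?thesis
    by (cases "k = Suc n") (auto simp: asc_coeff_zero asc_coeff_self split: nat.split)
qed

lemma asc_poly_recurrence:
  "[:0, 1:] * asc_poly n =
    asc_poly (Suc n) + smult (asc_b n) (asc_poly n) + smult (asc_a n) (asc_poly (n - 1))"
proof -
  let ?K = "Suc (Suc n)"
  let ?p = "\<lambda>k. case k of 0 \<Rightarrow> 0 | Suc k' \<Rightarrow> asc_coeff n k'"
  have "[:0, 1:] * asc_poly n = (\<Sum>k<Suc n. smult (asc_coeff n k) ([:0, 1:] * node_poly k))"
    unfolding asc_poly_sum[of n "Suc n", OF lessI] sum_distrib_left by simp
  also have "\<dots> = (\<Sum>k<Suc n. smult (asc_coeff n k) (node_poly (Suc k))) + (\<Sum>k<Suc n. smult (asc_coeff n k * (Q / q ^ k)) (node_poly k))"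
    unfolding x_mult_node_poly by (simp add: smult_add_right sum.distrib)
  also have "(\<Sum>k<Suc n. smult (asc_coeff n k) (node_poly (Suc k))) = (\<Sum>k<?K. smult (?p k) (node_poly k))"
    by (subst (2) sum.lessThan_Suc_shift) simp
  also have "(\<Sum>k<Suc n. smult (asc_coeff n k * (Q / q ^ k)) (node_poly k)) = (\<Sum>k<?K. smult (asc_coeff n k * (Q / q ^ k)) (node_poly k))"
    by (simp add: asc_coeff_zero)
  also have "(\<Sum>k<?K. smult (?p k) (node_poly k)) + (\<Sum>k<?K. smult (asc_coeff n k * (Q / q ^ k)) (node_poly k)) =
      (\<Sum>k<?K. smult (?p k + asc_coeff n k * (Q / q ^ k)) (node_poly k))"
    by (simp only: smult_add_left sum.distrib)
  also have "\<dots> = (\<Sum>k<?K. smult (asc_coeff (Suc n) k) (node_poly k)) + smult (asc_b n) (\<Sum>k<?K. smult (asc_coeff n k) (node_poly k))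
      + smult (asc_a n) (\<Sum>k<?K. smult (asc_coeff (n - 1) k) (node_poly k))"
    unfolding asc_coeff_recurrence by (simp only: smult_add_left sum.distrib smult_sum_right smult_smult)
  finally show ?thesis
    by (simp only: asc_poly_sum[of "Suc n" ?K] asc_poly_sum[of n ?K] asc_poly_sum[of "n - 1" ?K])
qed

sublocale three_term asc_poly asc_b asc_a
  by unfold_locales (simp_all add: monic_seq_asc_poly asc_poly_recurrence asc_a_def del: mult_pCons_left)

text \<open>The exponent n * n is 1 + 3 + ... + (2n - 1), since \<open>asc_a (Suc i)\<close> carries
  q^(-(2i+1)).\<close>

lemma prod_asc_a: "(\<Prod>i<n. asc_a (Suc i)) = (Q ^ 2 * \<beta>) ^ n * qpoch q q n / q ^ (n * n)"
proof (induction n)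
  case (Suc n)
  have "asc_a (Suc n) = Q ^ 2 * \<beta> * (1 - q * q ^ n) / q ^ (2 * n + 1)"
    using q_nz by (simp add: asc_a_def)
  moreover have "Suc n * Suc n = n * n + (2 * n + 1)" by simp
  then have "q ^ (Suc n * Suc n) = q ^ (n * n) * q ^ (2 * n + 1)" by (simp only: power_add)
  ultimately show ?case
    unfolding prod.lessThan_Suc Suc qpoch_Suc power_Suc[of "Q ^ 2 * \<beta>"]
    by (simp only: times_divide_times_eq mult_ac)
qed simp

end

section \<open>Expansion in factorial Schur polynomials\<close>

definition asc_det :: "complex \<Rightarrow> (nat \<Rightarrow> nat) \<Rightarrow> (nat \<Rightarrow> nat) \<Rightarrow> complex" where
  "asc_det q lam mu = fdet (plength lam) (\<lambda>j k.
     let e = int (lam j) - int j - int (mu k) + int k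
     in if e < 0 then 0 else 1 / qpoch q q (nat e))"

abbreviation subpartitions :: "(nat \<Rightarrow> nat) \<Rightarrow> (nat \<Rightarrow> nat) set" where
  "subpartitions lam \<equiv> {mu. is_partition mu \<and> (\<forall>i. mu i \<le> lam i)}"

lemma plength_subpartition:
  assumes "is_partition lam" "mu \<in> subpartitions lam"
  shows "plength mu \<le> plength lam"
proof -
  have "lam (plength lam) = 0" using partition_zero_iff[OF assms(1)] by simp
  then have "mu (plength lam) = 0" using assms(2) by (metis (mono_tags, lifting) le_zero_eq mem_Collect_eq)
  then show ?thesis using assms(2) partition_zero_iff[of mu] by simp
qed

lemma fdet_mconst: "fdet N (\<lambda>i j. mconst (g i j)) = mconst (fdet N g)"
proof -
  have "mconst (\<Prod>i\<in>A. f i) = (\<Prod>i\<in>A. mconst (f i))" for f and A :: "nat set"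
    by (induction A rule: infinite_finite_induct) (auto simp: mconst_mult)
  moreover have "mconst (\<Sum>x\<in>A. f x) = (\<Sum>x\<in>A. mconst (f x))" for f and A :: "(nat \<Rightarrow> nat) set"
    by (induction A rule: infinite_finite_induct) (auto simp: mconst_add)
  moreover have "mconst (of_int k) = of_int k" for k by (simp add: mconst_def)
  ultimately show ?thesis by (simp add: fdet_sum mconst_mult)
qed

context asc
begin

text \<open>If \<open>mu\<close> exceeds \<open>lam\<close> in row \<open>r\<close>, the shifted
  entries of \<open>lam\<close> from \<open>r\<close> on lie below those of \<open>mu\<close> up to
  \<open>r\<close>, and triangularity of \<open>asc_coeff\<close> gives a zero block. This is why
  Cauchy-Binet leaves only \<open>mu\<close> contained in \<open>lam\<close>.\<close>

lemma fdet_asc_coeff_zero: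
  assumes lam: "is_partition lam" and mu: "is_partition mu" "plength mu \<le> N" and r: "lam r < mu r"
  shows "fdet N (\<lambda>i j. asc_coeff (shifted N lam i) (shifted N mu j)) = 0"
proof (rule fdet_zero_block)
  show "r < N" using r mu partition_zero_iff[of mu r] by (metis gr_implies_not0 le_trans not_le)
  fix i j assume ij: "r \<le> i" "i < N" "j \<le> r"
  have "shifted N lam i \<le> shifted N lam r" using ij by (intro shifted_le lam) auto
  also have "\<dots> < shifted N mu r" using r by (simp add: shifted_def)
  also have "\<dots> \<le> shifted N mu j" using ij by (intro shifted_le mu) auto
  finally show "asc_coeff (shifted N lam i) (shifted N mu j) = 0" by (rule asc_coeff_zero)
qed

lemma subpartitions_subset_bounded:
  assumes "is_partition lam" "plength lam \<le> N"
  shows "subpartitions lam \<subseteq> bounded_partitions N (Suc (lam 0 + N))"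
proof
  fix mu assume mu: "mu \<in> subpartitions lam"
  have "shifted N mu i < Suc (lam 0 + N)" for i
  proof -
    have "mu i \<le> lam i" "lam i \<le> lam 0" using mu partition_mono[OF assms(1), of 0 i] by auto
    then show ?thesis by (simp add: shifted_def)
  qed
  then show "mu \<in> bounded_partitions N (Suc (lam 0 + N))"
    using mu plength_subpartition[OF assms(1) mu] assms(2) by (auto simp: bounded_partitions_def)
qed

lemma alternant_asc_poly:
  assumes lam: "is_partition lam" "plength lam \<le> N"
  shows "alternant N (\<lambda>i. asc_poly (shifted N lam i)) =
    (\<Sum>mu\<in>subpartitions lam. mconst (fdet N (\<lambda>i j. asc_coeff (shifted N lam i) (shifted N mu j))) *
      alternant N (\<lambda>i. node_poly (shifted N mu i)))"
proof -
  let ?M = "Suc (lam 0 + N)"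
  let ?t = "\<lambda>mu. mconst (fdet N (\<lambda>i j. asc_coeff (shifted N lam i) (shifted N mu j))) *
      alternant N (\<lambda>i. node_poly (shifted N mu i))"
  have "lam \<in> subpartitions lam" using lam by simp
  then have lamM: "lam \<in> bounded_partitions N ?M"
    using subpartitions_subset_bounded[OF lam] by blast
  have "at_var j (asc_poly (shifted N lam i)) =
      (\<Sum>k<?M. mconst (asc_coeff (shifted N lam i) k) * at_var j (node_poly k))" if "i < N" for i j
  proof -
    have "shifted N lam i < ?M" using lamM that by (auto simp: bounded_partitions_def)
    then show ?thesis by (simp only: asc_poly_sum at_var_sum_distrib at_var_smult)
  qed
  then have "alternant N (\<lambda>i. asc_poly (shifted N lam i)) =
      fdet N (\<lambda>i j. \<Sum>k<?M. mconst (asc_coeff (shifted N lam i) k) * at_var j (node_poly k))"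
    unfolding alternant_def by (intro fdet_cong) simp
  also have "\<dots> = (\<Sum>mu\<in>bounded_partitions N ?M. ?t mu)"
    unfolding cauchy_binet fdet_mconst alternant_def ..
  also have "\<dots> = (\<Sum>mu\<in>subpartitions lam. ?t mu)"
  proof (rule sum.mono_neutral_right[OF finite_bounded_partitions subpartitions_subset_bounded[OF lam]])
    show "\<forall>mu\<in>bounded_partitions N ?M - subpartitions lam. ?t mu = 0"
    proof
      fix mu assume "mu \<in> bounded_partitions N ?M - subpartitions lam"
      then obtain r where "is_partition mu" "plength mu \<le> N" "lam r < mu r"
        by (auto simp: bounded_partitions_def not_le)
      then show "?t mu = 0" using fdet_asc_coeff_zero[OF lam(1)] by simp
    qed
  qed
  finally show ?thesis .
qed

lemma gschur_asc_poly:
  assumes "is_partition lam" "plength lam \<le> N"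
  shows "gschur N asc_poly lam =
    (\<Sum>mu\<in>subpartitions lam. mconst (fdet N (\<lambda>i j. asc_coeff (shifted N lam i) (shifted N mu j))) *
      gschur N node_poly mu)"
  unfolding gschur_def[of N asc_poly]
  by (rule bialternant_eqI)
     (simp add: sum_distrib_right mult.assoc gschur_def bialternant_mult_vandermonde
       alternant_asc_poly[OF assms])

text \<open>In the differences of shifted entries \<open>N\<close> cancels, so scaling rows and
  columns moves all dependence on \<open>N\<close> and Q into the product. The remaining matrix is
  unitriangular from row \<open>plength lam\<close> on and shrinks to the size used in
  \<open>sigma_ASC\<close>.\<close>

lemma fdet_asc_coeff:
  assumes lam: "is_partition lam" "plength lam \<le> N" and mu: "mu \<in> subpartitions lam"
  shows "fdet N (\<lambda>i j. asc_coeff (shifted N lam i) (shifted N mu j)) =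
    (\<Prod>i<N. asc_scale (shifted N lam i) / asc_scale (shifted N mu i)) * asc_det q lam mu"
proof -
  let ?g = "\<lambda>j k. let e = int (lam j) - int j - int (mu k) + int k
     in if e < 0 then 0 else 1 / qpoch q q (nat e)"
  have "fdet N (\<lambda>i j. asc_coeff (shifted N lam i) (shifted N mu j)) =
      fdet N (\<lambda>i j. asc_scale (shifted N lam i) * ?g i j * (1 / asc_scale (shifted N mu j)))"
  proof (rule fdet_cong)
    fix i j assume ij: "i < N" "j < N"
    then have e: "int (lam i) - int i - int (mu j) + int j = int (shifted N lam i) - int (shifted N mu j)"
      by (simp add: shifted_def)
    show "asc_coeff (shifted N lam i) (shifted N mu j) = asc_scale (shifted N lam i) * ?g i j * (1 / asc_scale (shifted N mu j))"
      unfolding e asc_coeff_def asc_entry_def by (auto simp: Let_def nat_diff_distrib)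
  qed
  also have "\<dots> = (\<Prod>i<N. asc_scale (shifted N lam i)) * (\<Prod>i<N. 1 / asc_scale (shifted N mu i)) * fdet N ?g"
    by (rule fdet_scale)
  also have "fdet N ?g = fdet (plength lam) ?g"
  proof (rule fdet_stable[OF lam(2)])
    fix i assume i: "plength lam \<le> i"
    then have l0: "lam i = 0" using partition_zero_iff[OF lam(1)] by simp
    then have "mu i = 0" using mu by (metis (mono_tags, lifting) le_zero_eq mem_Collect_eq)
    then show "?g i i = 1" using l0 by simp
    fix j assume "j < i"
    then show "?g i j = 0" using l0 by simp
  qed
  finally show ?thesis by (simp add: asc_det_def prod.distrib divide_inverse)
qed

text \<open>Arranged so that Q occurs only as Q/q^n. For Q = q^(N-1) and n = N - 1 - i this is q^i,
  and only the last factor still depends on \<open>N\<close>. The norms are treated in the same form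
  in \<open>norm_ratio\<close>.\<close>

lemma asc_scale_ratio:
  "asc_scale (l + n) / asc_scale n = (- \<beta>) ^ l * (Q / q ^ n) ^ l * (1 / q) ^ (l choose 2) *
    (qpoch q q (l + n) / qpoch q q n)"
proof (induction l)
  case 0
  then show ?case using asc_scale_nz qpoch_nz by (simp add: binomial_eq_0)
next
  case (Suc l)
  have "asc_scale (Suc l + n) / asc_scale n = asc_scale (l + n) / asc_scale n * (- \<beta> * Q * (1 - q * q ^ (l + n)) / q ^ (l + n))"
    by (simp add: asc_scale_Suc mult_ac)
  also have "\<dots> = (- \<beta>) ^ Suc l * (Q / q ^ n) ^ Suc l * (1 / q) ^ (Suc l choose 2) *
    (qpoch q q (Suc l + n) / qpoch q q n)"
    unfolding Suc by (simp add: choose_2_Suc power_add qpoch_Suc power_one_over divide_inverse power_inverse mult_ac)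
  finally show ?case .
qed

lemma norm_ratio:
  "(\<Prod>i<l + n. asc_a (Suc i)) / (\<Prod>i<n. asc_a (Suc i)) =
    \<beta> ^ l * (Q / q ^ n) ^ (2 * l) / q ^ (l * l) * (qpoch q q (l + n) / qpoch q q n)"
proof -
  have "(l + n) * (l + n) = n * n + (l * l + n * (2 * l))" by (simp add: algebra_simps)
  then have e: "q ^ ((l + n) * (l + n)) = q ^ (n * n) * (q ^ (l * l) * (q ^ n) ^ (2 * l))"
    by (simp only: power_add power_mult)
  have "(Q ^ 2 * \<beta>) ^ (l + n) = (Q ^ 2 * \<beta>) ^ n * (\<beta> ^ l * Q ^ (2 * l))"
    by (simp add: power_add power_mult_distrib power_mult)
  then show ?thesis
    unfolding prod_asc_a e
    using q_nz \<beta>_nz Q_nz qpoch_nz by (simp add: power_divide divide_simps)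
qed

lemma norm_nz: "(\<Prod>i<n. asc_a (Suc i)) \<noteq> 0"
  unfolding prod_asc_a using q_nz \<beta>_nz Q_nz qpoch_nz by simp

section \<open>The finite-dimensional expectation\<close>

text \<open>By \<open>tensor_alternant_mult\<close> the denominator is the value of the numerator at
  P = 1, the Vandermonde polynomial being the alternant of the first \<open>N\<close> orthogonal
  polynomials; so the functional is normalized to 1 at 1.\<close>

definition expect :: "nat \<Rightarrow> mpoly \<Rightarrow> complex" where
  "expect N P = tensor N (moments asc_poly) (P * vandermonde N * vandermonde N) /
     (fact N * (\<Prod>i<N. \<Prod>k<N - Suc i. asc_a (Suc k)))"

lemma expect_add: "expect N (P + R) = expect N P + expect N R"
  by (simp add: expect_def distrib_right tensor_add add_divide_distrib)

lemma expect_mconst: "expect N (mconst c * P) = c * expect N P"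
  by (simp add: expect_def mult.assoc tensor_mconst)

lemma expect_0 [simp]: "expect N 0 = 0"
  by (simp add: expect_def)

lemma expect_gschur_mult:
  assumes lam: "is_partition lam" "plength lam \<le> N" and mu: "is_partition mu" "plength mu \<le> N"
  shows "expect N (gschur N asc_poly lam * gschur N asc_poly mu) =
    (if lam = mu then \<Prod>i<N. (\<Prod>k<shifted N lam i. asc_a (Suc k)) / (\<Prod>k<N - Suc i. asc_a (Suc k)) else 0)"
proof -
  let ?s = "shifted N lam" and ?t = "shifted N mu"
  let ?B = "\<lambda>i j. L (asc_poly (?s i) * asc_poly (?t j))"
  have "gschur N asc_poly lam * gschur N asc_poly mu * vandermonde N * vandermonde N =
      (gschur N asc_poly lam * vandermonde N) * (gschur N asc_poly mu * vandermonde N)"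
    by (simp only: mult_ac)
  then have e: "expect N (gschur N asc_poly lam * gschur N asc_poly mu) =
      fdet N ?B / (\<Prod>i<N. \<Prod>k<N - Suc i. asc_a (Suc k))"
    by (simp add: expect_def gschur_def bialternant_mult_vandermonde tensor_alternant_mult)
  show ?thesis
  proof (cases "lam = mu")
    case True
    have "fdet N ?B = (\<Prod>i<N. ?B i i)"
    proof (rule fdet_upper)
      fix i j assume "j < i" "i < N"
      then have "?s i \<noteq> ?t j" using shifted_less[OF lam(1), of j i N] True by simp
      then show "?B i j = 0" by (simp add: L_mult)
    qed
    also have "\<dots> = (\<Prod>i<N. \<Prod>k<?s i. asc_a (Suc k))"
      using True by (intro prod.cong refl) (simp add: L_mult)
    finally have f: "fdet N ?B = (\<Prod>i<N. \<Prod>k<?s i. asc_a (Suc k))" .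
    show ?thesis unfolding e f using True by (simp add: prod_dividef)
  next
    case False
    \<comment> \<open>Distinct partitions give distinct sets of equal size, so some degree in the
      first alternant is missing from the second, and its row of inner products is zero.\<close>
    then have "?s ` {..<N} \<noteq> ?t ` {..<N}"
      using shifted_image_cancel[OF lam(1) mu(1) lam(2) mu(2)] by blast
    moreover have "card (?s ` {..<N}) = card (?t ` {..<N})"
      using shifted_inj[OF lam(1), of N] shifted_inj[OF mu(1), of N] by (simp add: card_image)
    ultimately have "\<not> ?s ` {..<N} \<subseteq> ?t ` {..<N}"
      using card_subset_eq[of "?t ` {..<N}"] by blast
    then obtain i where i: "i < N" "?s i \<notin> ?t ` {..<N}" by auto
    have z: "?B i j = 0" if "j < N" for j
    proof -
      have "?s i \<noteq> ?t j" using i that by auto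
      then show ?thesis by (simp add: L_mult)
    qed
    have "(\<Prod>r<N. ?B r (p r)) = 0" if "p permutes {..<N}" for p
    proof (rule prod_zero)
      have "p i < N" using i by (simp add: permutes_less[OF that])
      then show "\<exists>r\<in>{..<N}. ?B r (p r) = 0" using i z by blast
    qed simp
    then have "fdet N ?B = 0" unfolding fdet_sum by (intro sum.neutral) simp
    then show ?thesis using False by (simp add: e)
  qed
qed

lemma expect_gschur:
  assumes lam: "is_partition lam" "plength lam \<le> N"
  shows "expect N (gschur N asc_poly lam) = (if lam = (\<lambda>_. 0) then 1 else 0)"
proof -
  have "expect N (gschur N asc_poly lam * gschur N asc_poly (\<lambda>_. 0)) = (if lam = (\<lambda>_. 0) then 1 else 0)"
    using expect_gschur_mult[OF lam is_partition_zero] norm_nz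
    by (simp add: plength_def shifted_def)
  then show ?thesis by (simp add: gschur_zero[OF monic_seq_asc_poly])
qed

end

section \<open>The limit of many variables\<close>

lemma pweight_eq_sum:
  assumes "is_partition lam" "plength lam \<le> N"
  shows "pweight lam = (\<Sum>j<N. j * lam j)"
  unfolding pweight_def
  by (rule sum.mono_neutral_left) (use assms in \<open>auto simp: partition_zero_iff\<close>)

lemma sum_lessThan_eq_choose: "(\<Sum>j<n. j) = n choose 2"
  by (induction n) (simp_all add: choose_2_Suc)

text \<open>Both sides sum the column index j over the cells (i, j) of the diagram, once by columns
  and once by rows.\<close>

lemma pweight_ptranspose:
  assumes lam: "is_partition lam" and len: "plength lam \<le> N"
  shows "pweight (ptranspose lam) = (\<Sum>i<N. lam i choose 2)"
proof -
  have tr: "ptranspose lam j = (\<Sum>i<N. if j < lam i then 1 else 0)" for j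
  proof -
    have "i < N" if "j < lam i" for i
    proof (rule ccontr)
      assume "\<not> i < N"
      then have "lam i = 0" using partition_zero_iff[OF lam] len by simp
      then show False using that by simp
    qed
    then have "{i. j < lam i} = {i \<in> {..<N}. j < lam i}" by blast
    then show ?thesis unfolding ptranspose_def by (simp add: sum.If_cases Int_def conj_commute)
  qed
  have "ptranspose lam j \<noteq> 0 \<longleftrightarrow> j < lam 0" for j
  proof
    assume "ptranspose lam j \<noteq> 0"
    then obtain i where "j < lam i" unfolding tr by (metis (mono_tags, lifting) sum.neutral)
    then show "j < lam 0" using partition_mono[OF lam, of 0 i] by simp
  next
    assume j: "j < lam 0"
    then have "0 < N" using partition_zero_iff[OF lam, of 0] len by (cases N) auto
    then have "(if j < lam 0 then 1 else 0 :: nat) \<le> ptranspose lam j"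
      unfolding tr by (intro member_le_sum) auto
    then show "ptranspose lam j \<noteq> 0" using j by simp
  qed
  then have "plength (ptranspose lam) = lam 0" unfolding plength_def by (simp add: lessThan_def[symmetric])
  then have "pweight (ptranspose lam) = (\<Sum>j<lam 0. \<Sum>i<N. if j < lam i then j else 0)"
    unfolding pweight_def tr sum_distrib_left by (intro sum.cong) auto
  also have "\<dots> = (\<Sum>i<N. \<Sum>j<lam 0. if j < lam i then j else 0)" by (rule sum.swap)
  also have "\<dots> = (\<Sum>i<N. \<Sum>j<lam i. j)"
  proof (rule sum.cong[OF refl])
    fix i
    have "{..<lam 0} \<inter> {j. j < lam i} = {..<lam i}" using partition_mono[OF lam, of 0 i] by auto
    then show "(\<Sum>j<lam 0. if j < lam i then j else 0) = (\<Sum>j<lam i. j)"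
      by (simp add: sum.If_cases)
  qed
  finally show ?thesis by (simp only: sum_lessThan_eq_choose)
qed

locale asc_limit =
  fixes q \<beta> :: complex
  assumes q_norm: "norm q < 1" and q_nz: "q \<noteq> 0" and \<beta>_nz: "\<beta> \<noteq> 0"
begin

text \<open>The integer exponent keeps the value nonzero at N = 0, where it is 1/q; so the locale
  \<open>asc\<close> can be used for every \<open>N\<close>.\<close>

definition Qn :: "nat \<Rightarrow> complex" where
  "Qn N = q powi (int N - 1)"

lemma asc_Qn: "asc q \<beta> (Qn N)"
  using q_norm q_nz \<beta>_nz by unfold_locales (simp_all add: Qn_def)

abbreviation asc_schur :: "nat \<Rightarrow> (nat \<Rightarrow> nat) \<Rightarrow> mpoly" where
  "asc_schur N \<equiv> gschur N (asc.asc_poly q \<beta> (Qn N))"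

lemma qnodes_eq: "qnodes q N = (\<lambda>k. Qn N / q ^ k)"
  using q_nz by (simp add: qnodes_def Qn_def power_int_diff)

lemma Qn_div: "i < N \<Longrightarrow> Qn N / q ^ (N - Suc i) = q ^ i"
proof -
  assume i: "i < N"
  have "Qn N / q ^ (N - Suc i) = q powi (int N - 1 - int (N - Suc i))"
    using q_nz by (simp add: Qn_def power_int_diff)
  also have "int N - 1 - int (N - Suc i) = int i" using i by simp
  finally show ?thesis by simp
qed

text \<open>With n = N - 1 - i for large \<open>N\<close>, numerator and denominator differ by the
  \<open>l\<close> factors 1 - q^(n+1), ..., 1 - q^(n+l), each tending to 1.\<close>

lemma qpoch_ratio_limit:
  "(\<lambda>N. qpoch q q (l + (N - Suc i)) / qpoch q q (N - Suc i)) \<longlonglongrightarrow> 1"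
proof (induction l)
  case 0
  then show ?case using asc.qpoch_nz[OF asc_Qn] by simp
next
  case (Suc l)
  have "(\<lambda>n. q ^ n) \<longlonglongrightarrow> 0" using q_norm by (rule LIMSEQ_power_zero)
  moreover have "filterlim (\<lambda>N. l + (N - Suc i)) sequentially sequentially"
    unfolding filterlim_at_top
  proof
    fix Z
    show "\<forall>\<^sub>F N in sequentially. Z \<le> l + (N - Suc i)"
      using eventually_ge_at_top[of "Z + Suc i"] by eventually_elim simp
  qed
  ultimately have "(\<lambda>N. q ^ (l + (N - Suc i))) \<longlonglongrightarrow> 0" by (rule filterlim_compose)
  then have "(\<lambda>N. qpoch q q (l + (N - Suc i)) / qpoch q q (N - Suc i) * (1 - q * q ^ (l + (N - Suc i))))
      \<longlonglongrightarrow> 1 * (1 - q * 0)"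
    by (intro tendsto_mult tendsto_diff tendsto_const Suc)
  then show ?case by (simp add: qpoch_Suc)
qed

definition scale_lim :: "nat \<Rightarrow> nat \<Rightarrow> complex" where
  "scale_lim i l = (- \<beta>) ^ l * (q ^ i) ^ l * (1 / q) ^ (l choose 2)"

lemma scale_lim_nz: "scale_lim i l \<noteq> 0"
  using q_nz \<beta>_nz by (simp add: scale_lim_def)

lemma asc_scale_ratio_limit:
  "(\<lambda>N. asc.asc_scale q \<beta> (Qn N) (l + (N - Suc i)) / asc.asc_scale q \<beta> (Qn N) (N - Suc i)) \<longlonglongrightarrow> scale_lim i l"
proof -
  have "(\<lambda>N. scale_lim i l * (qpoch q q (l + (N - Suc i)) / qpoch q q (N - Suc i))) \<longlonglongrightarrow> scale_lim i l * 1"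
    by (intro tendsto_mult tendsto_const qpoch_ratio_limit)
  moreover have "\<forall>\<^sub>F N in sequentially. scale_lim i l * (qpoch q q (l + (N - Suc i)) / qpoch q q (N - Suc i)) =
      asc.asc_scale q \<beta> (Qn N) (l + (N - Suc i)) / asc.asc_scale q \<beta> (Qn N) (N - Suc i)"
    using eventually_gt_at_top[of i]
    by eventually_elim (simp only: asc.asc_scale_ratio[OF asc_Qn] Qn_div scale_lim_def)
  ultimately show ?thesis using Lim_transform_eventually by force
qed

definition sigma_lim :: "(nat \<Rightarrow> nat) \<Rightarrow> (nat \<Rightarrow> nat) \<Rightarrow> complex" where
  "sigma_lim lam mu = (\<Prod>i<plength lam. scale_lim i (lam i) / scale_lim i (mu i)) * asc_det q lam mu"

lemma fdet_asc_coeff_limit: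
  assumes lam: "is_partition lam" and mu: "mu \<in> subpartitions lam"
  shows "(\<lambda>N. fdet N (\<lambda>i j. asc.asc_coeff q \<beta> (Qn N) (shifted N lam i) (shifted N mu j))) \<longlonglongrightarrow> sigma_lim lam mu"
proof -
  let ?asc_scale = "\<lambda>N. asc.asc_scale q \<beta> (Qn N)"
  let ?rat = "\<lambda>N i. ?asc_scale N (lam i + (N - Suc i)) / ?asc_scale N (N - Suc i) /
      (?asc_scale N (mu i + (N - Suc i)) / ?asc_scale N (N - Suc i))"
  have "(\<lambda>N. (\<Prod>i<plength lam. ?rat N i) * asc_det q lam mu) \<longlonglongrightarrow> sigma_lim lam mu"
    unfolding sigma_lim_def
    by (intro tendsto_mult tendsto_prod tendsto_divide asc_scale_ratio_limit scale_lim_nz tendsto_const)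
  moreover have "\<forall>\<^sub>F N in sequentially. (\<Prod>i<plength lam. ?rat N i) * asc_det q lam mu =
      fdet N (\<lambda>i j. asc.asc_coeff q \<beta> (Qn N) (shifted N lam i) (shifted N mu j))"
    using eventually_ge_at_top[of "plength lam"]
  proof eventually_elim
    case (elim N)
    have nz: "?asc_scale N n \<noteq> 0" for n by (rule asc.asc_scale_nz[OF asc_Qn])
    have "(\<Prod>i<plength lam. ?rat N i) = (\<Prod>i<N. ?rat N i)"
    proof (rule prod.mono_neutral_left)
      show "\<forall>i\<in>{..<N} - {..<plength lam}. ?rat N i = 1"
      proof
        fix i assume "i \<in> {..<N} - {..<plength lam}"
        then have "lam i = 0" using partition_zero_iff[OF lam] by auto
        moreover then have "mu i = 0" using mu by (metis (mono_tags, lifting) le_zero_eq mem_Collect_eq)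
        ultimately show "?rat N i = 1" using nz by simp
      qed
    qed (use elim in auto)
    also have "\<dots> = (\<Prod>i<N. ?asc_scale N (shifted N lam i) / ?asc_scale N (shifted N mu i))"
      using nz by (simp add: shifted_def)
    finally show ?case unfolding asc.fdet_asc_coeff[OF asc_Qn lam elim mu] by simp
  qed
  ultimately show ?thesis by (rule Lim_transform_eventually)
qed

text \<open>For \<open>\<beta> = c / d\<close>, \<open>Phi_ASC\<close> is c^(-|lambda|) times this
  function with every variable multiplied by c. The limit can thus be taken in terms of \<beta>
  alone.\<close>

definition asc_fun :: "(nat \<Rightarrow> nat) \<Rightarrow> series" where
  "asc_fun lam = (\<lambda>m. \<Sum>mu\<in>subpartitions lam. sigma_lim lam mu * interp_fun q mu m)"

text \<open>The expansion runs over the same set of \<open>mu\<close> for all large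
  \<open>N\<close>, so it passes to the limit term by term.\<close>

lemma asc_schur_limit:
  assumes lam: "is_partition lam"
  shows "(\<lambda>N. Poly_Mapping.lookup (asc_schur N lam) m) \<longlonglongrightarrow> asc_fun lam m"
proof -
  let ?t = "\<lambda>N mu. fdet N (\<lambda>i j. asc.asc_coeff q \<beta> (Qn N) (shifted N lam i) (shifted N mu j))"
  have "(\<lambda>N. \<Sum>mu\<in>subpartitions lam. ?t N mu *
      Poly_Mapping.lookup (gschur N (fpow_poly (qnodes q N)) mu) m) \<longlonglongrightarrow> asc_fun lam m"
    unfolding asc_fun_def
    by (intro tendsto_sum tendsto_mult fdet_asc_coeff_limit interp_fun_limit lam q_norm) auto
  moreover have "\<forall>\<^sub>F N in sequentially. (\<Sum>mu\<in>subpartitions lam. ?t N mu *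
      Poly_Mapping.lookup (gschur N (fpow_poly (qnodes q N)) mu) m) = Poly_Mapping.lookup (asc_schur N lam) m"
    using eventually_ge_at_top[of "plength lam"]
  proof eventually_elim
    case (elim N)
    show ?case
      unfolding asc.gschur_asc_poly[OF asc_Qn lam elim] lookup_sum lookup_mconst_mult
        asc.node_poly_def[OF asc_Qn] qnodes_eq ..
  qed
  ultimately show ?thesis by (rule Lim_transform_eventually)
qed

lemma asc_schur_SymPoly_le:
  assumes "is_partition lam"
  shows "\<forall>\<^sub>F N in sequentially. asc_schur N lam \<in> SymPoly_le (psize lam) N"
  using eventually_ge_at_top[of "plength lam"]
  by eventually_elim (rule gschur_SymPoly_le[OF asc.monic_seq_asc_poly[OF asc_Qn] assms])

lemma asc_fun_Sym_le: "is_partition lam \<Longrightarrow> asc_fun lam \<in> Sym_le (psize lam)"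
  using asc_schur_SymPoly_le asc_schur_limit by (rule sym_limit_in_Sym_le)

definition norm_lim :: "(nat \<Rightarrow> nat) \<Rightarrow> complex" where
  "norm_lim lam = (\<Prod>i<plength lam. \<beta> ^ lam i * (q ^ i) ^ (2 * lam i) / q ^ (lam i * lam i))"

text \<open>Factors beyond the length of \<open>lam\<close> equal 1, which leaves a product whose
  number of factors does not depend on \<open>N\<close>.\<close>

lemma expect_asc_schur_mult_limit:
  assumes lam: "is_partition lam" and mu: "is_partition mu"
  shows "(\<lambda>N. asc.expect q \<beta> (Qn N) N (asc_schur N lam * asc_schur N mu)) \<longlonglongrightarrow> (if lam = mu then norm_lim lam else 0)"
proof (cases "lam = mu")
  case True
  let ?h = "\<lambda>N n. \<Prod>k<n. asc.asc_a q \<beta> (Qn N) (Suc k)"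
  let ?f = "\<lambda>i. \<beta> ^ lam i * (q ^ i) ^ (2 * lam i) / q ^ (lam i * lam i)"
  have "(\<lambda>N. \<Prod>i<plength lam. ?f i * (qpoch q q (lam i + (N - Suc i)) / qpoch q q (N - Suc i)))
      \<longlonglongrightarrow> (\<Prod>i<plength lam. ?f i * 1)"
    by (intro tendsto_prod tendsto_mult tendsto_const qpoch_ratio_limit)
  moreover have "\<forall>\<^sub>F N in sequentially.
      (\<Prod>i<plength lam. ?f i * (qpoch q q (lam i + (N - Suc i)) / qpoch q q (N - Suc i))) =
      asc.expect q \<beta> (Qn N) N (asc_schur N lam * asc_schur N mu)"
    using eventually_ge_at_top[of "plength lam"]
  proof eventually_elim
    case (elim N)
    have "asc.expect q \<beta> (Qn N) N (asc_schur N lam * asc_schur N mu) = (\<Prod>i<N. ?h N (lam i + (N - Suc i)) / ?h N (N - Suc i))"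
      using asc.expect_gschur_mult[OF asc_Qn lam elim lam elim] True by (simp add: shifted_def)
    also have "\<dots> = (\<Prod>i<plength lam. ?h N (lam i + (N - Suc i)) / ?h N (N - Suc i))"
    proof (rule prod.mono_neutral_right)
      show "\<forall>i\<in>{..<N} - {..<plength lam}. ?h N (lam i + (N - Suc i)) / ?h N (N - Suc i) = 1"
      proof
        fix i assume "i \<in> {..<N} - {..<plength lam}"
        then have "lam i = 0" using partition_zero_iff[OF lam] by auto
        then show "?h N (lam i + (N - Suc i)) / ?h N (N - Suc i) = 1"
          using asc.norm_nz[OF asc_Qn] by simp
      qed
    qed (use elim in auto)
    also have "\<dots> = (\<Prod>i<plength lam. ?f i * (qpoch q q (lam i + (N - Suc i)) / qpoch q q (N - Suc i)))"
    proof (rule prod.cong[OF refl])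
      fix i assume "i \<in> {..<plength lam}"
      then have "i < N" using elim by simp
      then show "?h N (lam i + (N - Suc i)) / ?h N (N - Suc i) =
          ?f i * (qpoch q q (lam i + (N - Suc i)) / qpoch q q (N - Suc i))"
        by (simp only: asc.norm_ratio[OF asc_Qn] Qn_div)
    qed
    finally show ?case ..
  qed
  ultimately show ?thesis using Lim_transform_eventually True by (force simp: norm_lim_def)
next
  case False
  have "\<forall>\<^sub>F N in sequentially. asc.expect q \<beta> (Qn N) N (asc_schur N lam * asc_schur N mu) = 0"
    using eventually_ge_at_top[of "plength lam"] eventually_ge_at_top[of "plength mu"]
    by eventually_elim (simp add: asc.expect_gschur_mult[OF asc_Qn] lam mu False)
  then show ?thesis using False by (simp add: tendsto_eventually)
qed

end

section \<open>Passing to the limit in the expectation\<close>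

lemma SymPoly_leI:
  assumes "\<And>m. Poly_Mapping.lookup P m \<noteq> 0 \<Longrightarrow> Poly_Mapping.keys m \<subseteq> {..<N} \<and> mdeg m \<le> D"
    and "\<And>p. p permutes {..<N} \<Longrightarrow> msubst (\<lambda>i. mvar (p i)) P = P"
  shows "P \<in> SymPoly_le D N"
proof -
  have "Poly_Mapping.lookup P (Poly_Mapping.map_key p m) = Poly_Mapping.lookup P m"
    if "p permutes {..<N}" for p m
    using lookup_msubst_bij[OF permutes_bij[OF that], of P m] assms(2)[OF that] by simp
  then show ?thesis using assms(1) by (simp add: SymPoly_le_def in_keys_iff)
qed

lemma SymPoly_le_msubst:
  assumes "P \<in> SymPoly_le D N" "p permutes {..<N}"
  shows "msubst (\<lambda>i. mvar (p i)) P = P"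
proof (rule poly_mapping_eqI)
  fix m
  show "Poly_Mapping.lookup (msubst (\<lambda>i. mvar (p i)) P) m = Poly_Mapping.lookup P m"
    using lookup_msubst_bij[OF permutes_bij[OF assms(2)], of P m] assms by (simp add: SymPoly_le_def)
qed

lemma SymPoly_le_mult:
  assumes P: "P \<in> SymPoly_le D N" and R: "R \<in> SymPoly_le D' N"
  shows "P * R \<in> SymPoly_le (D + D') N"
proof (rule SymPoly_leI)
  fix m assume "Poly_Mapping.lookup (P * R) m \<noteq> 0"
  then obtain a b where ab: "m = a + b" "Poly_Mapping.lookup P a \<noteq> 0" "Poly_Mapping.lookup R b \<noteq> 0"
    by (rule lookup_mult_nonzeroE)
  have "Poly_Mapping.keys (a + b) \<subseteq> {..<N}"
    using keys_add[of a b] SymPoly_le_keys[OF P ab(2)] SymPoly_le_keys[OF R ab(3)] by blast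
  moreover have "mdeg (a + b) \<le> D + D'"
    unfolding mdeg_add using SymPoly_le_mdeg[OF P ab(2)] SymPoly_le_mdeg[OF R ab(3)] by (rule add_mono)
  ultimately show "Poly_Mapping.keys m \<subseteq> {..<N} \<and> mdeg m \<le> D + D'" by (simp add: ab(1))
next
  fix p assume "p permutes {..<N}"
  then show "msubst (\<lambda>i. mvar (p i)) (P * R) = P * R"
    by (simp add: msubst_mult SymPoly_le_msubst[OF P] SymPoly_le_msubst[OF R])
qed

lemma SymPoly_le_diff_mconst:
  assumes "P \<in> SymPoly_le D N" "R \<in> SymPoly_le D' N" "D' \<le> D"
  shows "P - mconst c * R \<in> SymPoly_le D N"
proof (rule SymPoly_leI)
  fix m assume "Poly_Mapping.lookup (P - mconst c * R) m \<noteq> 0"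
  then have "Poly_Mapping.lookup P m \<noteq> 0 \<or> Poly_Mapping.lookup R m \<noteq> 0"
    by (auto simp: lookup_minus)
  then show "Poly_Mapping.keys m \<subseteq> {..<N} \<and> mdeg m \<le> D"
    using SymPoly_le_keys[OF assms(1), of m] SymPoly_le_keys[OF assms(2), of m]
      SymPoly_le_mdeg[OF assms(1), of m] SymPoly_le_mdeg[OF assms(2), of m] assms(3) by auto
next
  fix p assume "p permutes {..<N}"
  then show "msubst (\<lambda>i. mvar (p i)) (P - mconst c * R) = P - mconst c * R"
    by (simp add: msubst_diff msubst_mult SymPoly_le_msubst[OF assms(1)] SymPoly_le_msubst[OF assms(2)])
qed

text \<open>Symmetry moves any monomial to one with weakly decreasing exponents, so the coefficients
  at these monomials determine a symmetric polynomial of degree at most \<open>D\<close>. The set is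
  finite and does not involve \<open>N\<close>, so one elimination scheme serves all
  \<open>N\<close>.\<close>

definition part_mons :: "nat \<Rightarrow> monom set" where
  "part_mons D = {part_mon kap | kap. is_partition kap \<and> psize kap \<le> D}"

lemma finite_part_mons: "finite (part_mons D)"
proof -
  let ?S = "{f :: nat \<Rightarrow> nat. \<forall>i. (i \<in> {..<D} \<longrightarrow> f i \<in> {..D}) \<and> (i \<notin> {..<D} \<longrightarrow> f i = 0)}"
  have "finite ?S" by (rule finite_set_of_finite_funs) auto
  moreover have "part_mons D \<subseteq> part_mon ` ?S"
  proof
    fix m assume "m \<in> part_mons D"
    then obtain kap where kap: "m = part_mon kap" "is_partition kap" "psize kap \<le> D"
      by (auto simp: part_mons_def)
    have md: "mdeg (part_mon kap) \<le> D" using kap by (simp add: mdeg_part_mon)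
    have "kap i \<le> D" for i
      using lookup_le_mdeg[of "part_mon kap" i] md by (simp add: lookup_part_mon[OF kap(2)])
    moreover have "kap i = 0" if "\<not> i < D" for i
    proof -
      have "Poly_Mapping.keys (part_mon kap) = {j. kap j \<noteq> 0}"
        by (auto simp: in_keys_iff lookup_part_mon[OF kap(2)])
      then have "plength kap \<le> D"
        using card_keys_le_mdeg[of "part_mon kap"] md by (simp add: plength_def)
      then show ?thesis using that partition_zero_iff[OF kap(2)] by simp
    qed
    ultimately have "kap \<in> ?S" by simp
    then show "m \<in> part_mon ` ?S" using kap(1) by blast
  qed
  ultimately show ?thesis using finite_surj by blast
qed

lemma SymPoly_le_eq_0:
  assumes P: "P \<in> SymPoly_le D N" and zero: "\<And>k. k \<in> part_mons D \<Longrightarrow> Poly_Mapping.lookup P k = 0"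
  shows "P = 0"
proof (rule poly_mapping_eqI)
  fix m
  show "Poly_Mapping.lookup P m = Poly_Mapping.lookup 0 m"
  proof (rule ccontr)
    assume "\<not> ?thesis"
    then have nz: "Poly_Mapping.lookup P m \<noteq> 0" by simp
    obtain p kap where p: "p permutes {..<N}" and kap: "is_partition kap" "plength kap \<le> N"
      "Poly_Mapping.map_key p m = part_mon kap"
      using SymPoly_le_keys[OF P nz] by (rule ex_map_key_partition)
    have "mdeg (part_mon kap) \<le> D"
      using mdeg_map_key[OF permutes_bij[OF p], of m] SymPoly_le_mdeg[OF P nz] kap(3) by simp
    then have "part_mon kap \<in> part_mons D"
      using kap(1) by (auto simp: part_mons_def mdeg_part_mon)
    then have "Poly_Mapping.lookup P (part_mon kap) = 0" by (rule zero)
    moreover have "Poly_Mapping.lookup P (Poly_Mapping.map_key p m) = Poly_Mapping.lookup P m"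
      using P p by (simp add: SymPoly_le_def)
    ultimately show False using nz kap(3) by simp
  qed
qed

lemma Sym_le_Sym: "F \<in> Sym_le d \<Longrightarrow> F \<in> Sym"
  by (auto simp: Sym_def)

lemma linear_functional_diff:
  assumes E: "linear_functional_on_Sym E" and F: "F \<in> Sym" and G: "G \<in> Sym_le d"
  shows "E (\<lambda>m. F m - a * G m) = E F - a * E G"
proof -
  have "smult_series (- a) G \<in> Sym_le d"
    using G by (auto simp: Sym_le_def smult_series_def)
  then have "smult_series (- a) G \<in> Sym" by (rule Sym_le_Sym)
  then have "E (add_series F (smult_series (- a) G)) = E F + E (smult_series (- a) G)"
    using E F by (simp add: linear_functional_on_Sym_def)
  also have "E (smult_series (- a) G) = - a * E G"
    using E Sym_le_Sym[OF G] unfolding linear_functional_on_Sym_def by blast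
  finally show ?thesis by (simp add: add_series_def smult_series_def)
qed

lemma linear_functional_zero:
  assumes "linear_functional_on_Sym E"
  shows "E (\<lambda>_. 0) = 0"
proof -
  have "(\<lambda>_. 0) \<in> Sym" by (rule Sym_le_Sym[of _ 0]) (simp add: Sym_le_def)
  then have "E (smult_series 0 (\<lambda>_. 0)) = 0 * E (\<lambda>_. 0)"
    using assms unfolding linear_functional_on_Sym_def by blast
  then show ?thesis by (simp add: smult_series_def)
qed

context asc_limit
begin

text \<open>
  Subtracting from \<open>P N\<close> the multiple of the polynomial with the lexicographically largest
  leading monomial removes that monomial; both sides of the limit are known on what is subtracted.
\<close>

lemma expect_limit_aux:
  assumes E: "linear_functional_on_Sym E"
    and E_asc_fun: "\<And>nu. is_partition nu \<Longrightarrow> E (asc_fun nu) = (if nu = (\<lambda>_. 0) then 1 else 0)"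
    and "finite A" "A \<subseteq> part_mons D" "\<And>x y. x \<in> part_mons D \<Longrightarrow> y \<in> A \<Longrightarrow> x < y \<Longrightarrow> x \<in> A"
    and "\<forall>\<^sub>F N in sequentially. P N \<in> SymPoly_le D N"
    and "\<And>m. (\<lambda>N. Poly_Mapping.lookup (P N) m) \<longlonglongrightarrow> G m"
    and "\<And>k. k \<in> part_mons D - A \<Longrightarrow> \<forall>\<^sub>F N in sequentially. Poly_Mapping.lookup (P N) k = 0"
  shows "(\<lambda>N. asc.expect q \<beta> (Qn N) N (P N)) \<longlonglongrightarrow> E G"
  using assms(3-)
proof (induction A arbitrary: P G rule: finite_linorder_max_induct)
  case empty
  have "\<forall>\<^sub>F N in sequentially. \<forall>k\<in>part_mons D. Poly_Mapping.lookup (P N) k = 0"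
    using empty.prems(5) by (intro eventually_ball_finite finite_part_mons) auto
  then have P0: "\<forall>\<^sub>F N in sequentially. P N = 0"
    using empty.prems(3) by eventually_elim (rule SymPoly_le_eq_0, auto)
  have "G m = 0" for m
  proof -
    have "(\<lambda>N. Poly_Mapping.lookup (P N) m) \<longlonglongrightarrow> 0"
      using P0 by (intro tendsto_eventually) (auto elim: eventually_mono)
    then show ?thesis using empty.prems(4) LIMSEQ_unique by blast
  qed
  then have "G = (\<lambda>_. 0)" by blast
  then have "E G = 0" using linear_functional_zero[OF E] by simp
  moreover have "\<forall>\<^sub>F N in sequentially. asc.expect q \<beta> (Qn N) N (P N) = 0"
    using P0 by eventually_elim (simp add: asc.expect_0[OF asc_Qn])
  ultimately show ?case by (simp add: tendsto_eventually)
next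
  case (insert b A)
  obtain kap where kap: "b = part_mon kap" "is_partition kap" "psize kap \<le> D"
    using insert.prems(1) by (auto simp: part_mons_def)
  let ?a = "\<lambda>N. Poly_Mapping.lookup (P N) b"
  define P' where "P' N = P N - mconst (?a N) * asc_schur N kap" for N
  define G' where "G' m = G m - G b * asc_fun kap m" for m
  have len: "\<forall>\<^sub>F N in sequentially. plength kap \<le> N" by (rule eventually_ge_at_top)
  have lm: "\<forall>\<^sub>F N in sequentially. lmonic (asc_schur N kap) b"
    using len unfolding kap(1)
    by eventually_elim (rule lmonic_gschur[OF asc.monic_seq_asc_poly[OF asc_Qn] kap(2)])
  have P': "\<forall>\<^sub>F N in sequentially. P' N \<in> SymPoly_le D N"
    using insert.prems(3) asc_schur_SymPoly_le[OF kap(2)] unfolding P'_def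
    by eventually_elim (rule SymPoly_le_diff_mconst[OF _ _ kap(3)])
  have lim': "(\<lambda>N. Poly_Mapping.lookup (P' N) m) \<longlonglongrightarrow> G' m" for m
    unfolding P'_def G'_def lookup_minus lookup_mconst_mult
    by (intro tendsto_diff tendsto_mult insert.prems(4) asc_schur_limit kap)
  have zero: "\<forall>\<^sub>F N in sequentially. Poly_Mapping.lookup (P' N) k = 0" if k: "k \<in> part_mons D - A" for k
  proof (cases "k = b")
    case True
    show ?thesis using lm unfolding P'_def True by eventually_elim (simp add: lookup_minus lmonic_def)
  next
    case False
    then have "\<forall>\<^sub>F N in sequentially. Poly_Mapping.lookup (P N) k = 0"
      using k by (intro insert.prems(5)) simp
    then show ?thesis using lm
    proof eventually_elim
      case (elim N)
      \<comment> \<open>\<open>k\<close> lies outside the down-closed set \<open>insert b A\<close>,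
        hence not below \<open>b\<close>; so the subtraction does not disturb coefficients that are
        already zero.\<close>
      have "Poly_Mapping.lookup (asc_schur N kap) k = 0"
      proof (rule ccontr)
        assume "Poly_Mapping.lookup (asc_schur N kap) k \<noteq> 0"
        then have "k < b" using elim(2) False by (auto simp: lmonic_def less_le)
        then have "k \<in> insert b A" using insert.prems(2)[of k b] k by simp
        then show False using k False by simp
      qed
      then show ?case using elim(1) by (simp add: P'_def lookup_minus)
    qed
  qed
  have down: "x \<in> A" if "x \<in> part_mons D" "y \<in> A" "x < y" for x y
  proof -
    have "x \<in> insert b A" using insert.prems(2)[of x y] that by simp
    moreover have "x \<noteq> b" using insert.hyps(2) that by force
    ultimately show ?thesis by simp
  qed
  have ih: "(\<lambda>N. asc.expect q \<beta> (Qn N) N (P' N)) \<longlonglongrightarrow> E G'"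
    by (rule insert.IH[OF _ down P' lim' zero]) (use insert.prems(1) in auto)
  \<comment> \<open>\<open>E\<close> and all finite expectations take this same value on what is
    subtracted, so it can be added back with the coefficients \<open>?a N\<close> before the limit
    and with \<open>G b\<close> after it.\<close>
  let ?d = "if kap = (\<lambda>_. 0) then 1 else 0 :: complex"
  have "(\<lambda>N. asc.expect q \<beta> (Qn N) N (P' N) + ?a N * ?d) \<longlonglongrightarrow> E G' + G b * ?d"
    by (intro tendsto_add tendsto_mult ih insert.prems(4) tendsto_const)
  moreover have "\<forall>\<^sub>F N in sequentially. asc.expect q \<beta> (Qn N) N (P' N) + ?a N * ?d =
      asc.expect q \<beta> (Qn N) N (P N)"
    using len
  proof eventually_elim
    case (elim N)
    have "P N = P' N + mconst (?a N) * asc_schur N kap" by (simp add: P'_def)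
    then have "asc.expect q \<beta> (Qn N) N (P N) =
        asc.expect q \<beta> (Qn N) N (P' N + mconst (?a N) * asc_schur N kap)" by (rule arg_cong)
    then show ?case
      by (simp only: asc.expect_add[OF asc_Qn] asc.expect_mconst[OF asc_Qn]
          asc.expect_gschur[OF asc_Qn kap(2) elim])
  qed
  moreover have "E G' + G b * ?d = E G"
  proof -
    have "G \<in> Sym" by (rule Sym_le_Sym[OF sym_limit_in_Sym_le[OF insert.prems(3,4)]])
    then have "E G' = E G - G b * E (asc_fun kap)"
      unfolding G'_def by (rule linear_functional_diff[OF E _ asc_fun_Sym_le[OF kap(2)]])
    then show ?thesis using E_asc_fun[OF kap(2)] by simp
  qed
  ultimately show ?case by (simp only: Lim_transform_eventually)
qed

lemma expect_limit:
  assumes "linear_functional_on_Sym E"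
    and "\<And>nu. is_partition nu \<Longrightarrow> E (asc_fun nu) = (if nu = (\<lambda>_. 0) then 1 else 0)"
    and "\<forall>\<^sub>F N in sequentially. P N \<in> SymPoly_le D N"
    and "\<And>m. (\<lambda>N. Poly_Mapping.lookup (P N) m) \<longlonglongrightarrow> G m"
  shows "(\<lambda>N. asc.expect q \<beta> (Qn N) N (P N)) \<longlonglongrightarrow> E G"
  by (rule expect_limit_aux[OF assms(1,2) finite_part_mons subset_refl _ assms(3,4)]) auto

text \<open>A coefficient of a product is a finite convolution, so products of the finite
  polynomials converge to the product of their limits. Their expectations have one limit through
  \<open>E\<close> and another through the computed norms, and the two must agree.\<close>

lemma asc_fun_orthogonal:
  assumes E: "linear_functional_on_Sym E"
    and E_asc_fun: "\<And>nu. is_partition nu \<Longrightarrow> E (asc_fun nu) = (if nu = (\<lambda>_. 0) then 1 else 0)"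
    and lam: "is_partition lam" and mu: "is_partition mu"
  shows "E (mult_series (asc_fun lam) (asc_fun mu)) = (if lam = mu then norm_lim lam else 0)"
proof -
  have sp: "\<forall>\<^sub>F N in sequentially. asc_schur N lam * asc_schur N mu \<in> SymPoly_le (psize lam + psize mu) N"
    using asc_schur_SymPoly_le[OF lam] asc_schur_SymPoly_le[OF mu] by eventually_elim (rule SymPoly_le_mult)
  have lim: "(\<lambda>N. Poly_Mapping.lookup (asc_schur N lam * asc_schur N mu) m) \<longlonglongrightarrow> mult_series (asc_fun lam) (asc_fun mu) m" for m
    unfolding lookup_mult_splits mult_series_def split_beta
    by (intro tendsto_sum tendsto_mult asc_schur_limit lam mu)
  have "(\<lambda>N. asc.expect q \<beta> (Qn N) N (asc_schur N lam * asc_schur N mu)) \<longlonglongrightarrow>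
      E (mult_series (asc_fun lam) (asc_fun mu))"
    by (rule expect_limit[OF E E_asc_fun sp lim])
  then show ?thesis using expect_asc_schur_mult_limit[OF lam mu] by (rule LIMSEQ_unique)
qed

section \<open>Closed forms of the limiting constants\<close>

lemma powi_diff: "q powi (int a - int b) = q ^ a / q ^ b"
  using q_nz by (simp add: power_int_diff)

lemma prod_scale_lim:
  assumes "is_partition lam" "plength lam \<le> n"
  shows "(\<Prod>i<n. scale_lim i (lam i)) =
    (- \<beta>) powi int (psize lam) * q powi (int (pweight lam) - int (pweight (ptranspose lam)))"
proof -
  have "(\<Prod>i<n. scale_lim i (lam i)) = (- \<beta>) ^ (\<Sum>i<n. lam i) * q ^ (\<Sum>i<n. i * lam i) *
      (1 / q) ^ (\<Sum>i<n. lam i choose 2)"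
    by (simp add: scale_lim_def prod.distrib power_sum power_mult)
  then show ?thesis
    unfolding powi_diff power_int_of_nat psize_eq_sum[OF assms] pweight_eq_sum[OF assms]
      pweight_ptranspose[OF assms]
    by (simp add: power_one_over divide_inverse power_inverse)
qed

text \<open>In each row l^2 is twice the binomial coefficient C(l, 2) plus l. The binomials add up
  to \<open>pweight (ptranspose lam)\<close>, and the remaining l gives one factor 1/q for every
  cell of the diagram.\<close>

lemma norm_lim_eq:
  assumes lam: "is_partition lam"
  shows "norm_lim lam = (\<beta> / q) ^ psize lam *
    q powi (2 * (int (pweight lam) - int (pweight (ptranspose lam))))"
proof -
  let ?n = "plength lam"
  have sq: "l * l = 2 * (l choose 2) + l" for l :: nat
    by (induction l) (simp_all add: choose_2_Suc)
  have "(\<Sum>i<?n. lam i * lam i) = 2 * pweight (ptranspose lam) + psize lam"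
    by (subst sq) (simp add: sum.distrib sum_distrib_left pweight_ptranspose[OF lam order_refl]
        psize_def)
  moreover have "(\<Sum>i<?n. i * (2 * lam i)) = 2 * pweight lam"
    by (simp add: pweight_def sum_distrib_left mult_ac)
  moreover have "norm_lim lam = \<beta> ^ (\<Sum>i<?n. lam i) * q ^ (\<Sum>i<?n. i * (2 * lam i)) / q ^ (\<Sum>i<?n. lam i * lam i)"
    unfolding norm_lim_def by (simp add: prod_dividef prod.distrib power_sum power_mult)
  ultimately have "norm_lim lam = \<beta> ^ psize lam * q ^ (2 * pweight lam) /
      (q ^ (2 * pweight (ptranspose lam)) * q ^ psize lam)"
    by (simp add: psize_def power_add)
  moreover have "q powi (2 * (int (pweight lam) - int (pweight (ptranspose lam)))) =
      q ^ (2 * pweight lam) / q ^ (2 * pweight (ptranspose lam))"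
  proof -
    have "2 * (int (pweight lam) - int (pweight (ptranspose lam))) =
        int (2 * pweight lam) - int (2 * pweight (ptranspose lam))" by simp
    then show ?thesis by (simp only: powi_diff)
  qed
  ultimately show ?thesis by (simp add: power_divide)
qed

text \<open>Apart from the prefactor, c and d enter only through their quotient; the prefactor is
  left to the rescaling of the variables.\<close>

lemma sigma_ASC_eq:
  assumes lam: "is_partition lam" and mu: "mu \<in> subpartitions lam" and cd: "\<beta> = c / d"
  shows "sigma_ASC lam mu q c d = c powi (- int (psize lam)) * sigma_lim lam mu"
proof -
  have part: "is_partition mu" and len: "plength mu \<le> plength lam"
    using mu plength_subpartition[OF lam mu] by auto
  have cd': "- c / d = - \<beta>" using cd by simp
  have "(\<Prod>i<plength lam. scale_lim i (lam i) / scale_lim i (mu i)) =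
      (- c / d) powi (int (psize lam) - int (psize mu)) *
     q powi (int (pweight (ptranspose mu)) - int (pweight mu)
             - int (pweight (ptranspose lam)) + int (pweight lam))"
    unfolding prod_dividef prod_scale_lim[OF lam order_refl] prod_scale_lim[OF part len] cd'
    using q_nz \<beta>_nz by (simp add: power_int_diff power_int_add divide_simps)
  then show ?thesis
    unfolding sigma_ASC_def sigma_lim_def asc_det_def fdet_def by (simp add: mult.assoc)
qed

end

section \<open>Rescaling of the variables\<close>

definition scale_sym :: "complex \<Rightarrow> (series \<Rightarrow> complex) \<Rightarrow> series \<Rightarrow> complex" where
  "scale_sym c E F = E (scale_vars c F)"

lemma scale_vars_Sym_le: "F \<in> Sym_le d \<Longrightarrow> scale_vars c F \<in> Sym_le d"
  by (auto simp: Sym_le_def scale_vars_def mdeg_map_key)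

text \<open>Transporting \<open>E\<close> along the rescaling by c produces a functional with the
  values on \<open>asc_fun\<close> that \<open>asc_fun_orthogonal\<close> requires.\<close>

lemma linear_functional_scale_sym:
  assumes "linear_functional_on_Sym E"
  shows "linear_functional_on_Sym (scale_sym c E)"
proof -
  have sym: "scale_vars c F \<in> Sym" if "F \<in> Sym" for F
    using that scale_vars_Sym_le unfolding Sym_def by blast
  have "scale_vars c (add_series F G) = add_series (scale_vars c F) (scale_vars c G)" for F G
    by (simp add: scale_vars_def add_series_def distrib_left)
  moreover have "scale_vars c (smult_series a F) = smult_series a (scale_vars c F)" for a F
    by (simp add: scale_vars_def smult_series_def mult_ac)
  ultimately show ?thesis
    using assms sym by (simp add: linear_functional_on_Sym_def scale_sym_def)
qed

lemma scale_vars_mult: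
  "scale_vars c (mult_series F G) = mult_series (scale_vars c F) (scale_vars c G)"
proof
  fix m
  have "c ^ mdeg m * (F a * G b) = c ^ mdeg a * F a * (c ^ mdeg b * G b)" if "a + b = m" for a b
    using that by (auto simp: mdeg_add power_add)
  then show "scale_vars c (mult_series F G) m = mult_series (scale_vars c F) (scale_vars c G) m"
    unfolding scale_vars_def mult_series_def sum_distrib_left
    by (intro sum.cong) auto
qed

lemma mult_smult_series:
  "mult_series (smult_series a F) (smult_series b G) = smult_series (a * b) (mult_series F G)"
  by (simp add: mult_series_def smult_series_def sum_distrib_left split_beta mult_ac)

text \<open>Linearity of \<open>E\<close> is available on \<open>Sym\<close> only, so scalars may be
  pulled out once the product is known to lie there.\<close>

lemma mult_series_Sym:
  assumes F: "F \<in> Sym_le d" and G: "G \<in> Sym_le e"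
  shows "mult_series F G \<in> Sym"
proof (rule Sym_le_Sym[of _ "d + e"], unfold Sym_le_def, intro CollectI conjI allI impI)
  fix m assume "mult_series F G m \<noteq> 0"
  then obtain x where "x \<in> {(a, b). a + b = m}" "(case x of (a, b) \<Rightarrow> F a * G b) \<noteq> 0"
    unfolding mult_series_def by (rule sum.not_neutral_contains_not_neutral)
  then obtain a b where ab: "a + b = m" "F a * G b \<noteq> 0" by auto
  then have "mdeg a \<le> d" "mdeg b \<le> e" using F G by (auto simp: Sym_le_def)
  then show "mdeg m \<le> d + e" using ab(1) by (auto simp: mdeg_add)
next
  fix p :: "nat \<Rightarrow> nat" and m assume p: "bij p"
  let ?k = "Poly_Mapping.map_key p" and ?i = "Poly_Mapping.map_key (Hilbert_Choice.inv p)"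
  note add = map_key_plus[OF bij_is_inj[OF p]] map_key_plus[OF bij_is_inj[OF bij_imp_bij_inv[OF p]]]
  show "mult_series F G (?k m) = mult_series F G m"
    unfolding mult_series_def
  proof (rule sum.reindex_bij_witness[of _ "\<lambda>(a, b). (?k a, ?k b)" "\<lambda>(a, b). (?i a, ?i b)"])
    fix x assume "x \<in> {(a, b). a + b = m}"
    then show "(case x of (a, b) \<Rightarrow> (?k a, ?k b)) \<in> {(a, b). a + b = ?k m}"
      by (auto simp: add)
  next
    fix x assume x: "x \<in> {(a, b). a + b = ?k m}"
    then show "(case x of (a, b) \<Rightarrow> (?i a, ?i b)) \<in> {(a, b). a + b = m}"
      by (auto simp: add[symmetric] map_key_inv[OF p])
    have "F (?i a) = F a" "G (?i a) = G a" for a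
      using F G bij_imp_bij_inv[OF p] by (auto simp: Sym_le_def)
    then show "(case (case x of (a, b) \<Rightarrow> (?i a, ?i b)) of (a, b) \<Rightarrow> F a * G b) =
        (case x of (a, b) \<Rightarrow> F a * G b)"
      by (simp add: split_beta)
  qed (auto simp: map_key_inv[OF p])
qed

lemma admissible_pair_nonzero:
  assumes "admissible_pair q c d"
  shows "c \<noteq> 0" "d \<noteq> 0"
  using assms by (auto simp: admissible_pair_def)

theorem theorem6p5:
  fixes q :: real and c d :: complex
    and E :: "series \<Rightarrow> complex"
    and lam mu :: "nat \<Rightarrow> nat"
  assumes q: "0 < q" "q < 1"
    and adm: "admissible_pair q c d"
    and E_lin: "linear_functional_on_Sym E"
    and E_Phi: "\<And>nu. is_partition nu \<Longrightarrow>
                  E (Phi_ASC (of_real q) c d nu) = (if nu = (\<lambda>_. 0) then 1 else 0)"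
    and lam: "is_partition lam" and mu: "is_partition mu"
  shows "E (mult_series (Phi_ASC (of_real q) c d lam) (Phi_ASC (of_real q) c d mu)) =
           (if lam = mu then h_ASC (of_real q) c d lam else 0)"
proof -
  have cd: "c \<noteq> 0" "d \<noteq> 0" using admissible_pair_nonzero[OF adm] by auto
  interpret asc_limit "of_real q" "c / d"
    using q cd by unfold_locales auto
  let ?k = "\<lambda>nu. c powi (- int (psize nu))"
  let ?E = "scale_sym c E"
  have Phi: "Phi_ASC (of_real q) c d nu = smult_series (?k nu) (scale_vars c (asc_fun nu))"
    if "is_partition nu" for nu
  proof
    fix m
    have "Phi_ASC (of_real q) c d nu m =
        (\<Sum>rho\<in>subpartitions nu. ?k nu * sigma_lim nu rho * scale_vars c (interp_fun (of_real q) rho) m)"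
      unfolding Phi_ASC_def by (intro sum.cong refl) (simp add: sigma_ASC_eq[OF that])
    then show "Phi_ASC (of_real q) c d nu m = smult_series (?k nu) (scale_vars c (asc_fun nu)) m"
      by (simp add: smult_series_def scale_vars_def asc_fun_def sum_distrib_left mult_ac)
  qed
  have E_smult: "E (smult_series a F) = a * E F" if "F \<in> Sym" for a F
    using E_lin that by (simp add: linear_functional_on_Sym_def)
  have sc: "scale_vars c (asc_fun nu) \<in> Sym_le (psize nu)" if "is_partition nu" for nu
    using asc_fun_Sym_le[OF that] by (rule scale_vars_Sym_le)
  have "?E (asc_fun nu) = (if nu = (\<lambda>_. 0) then 1 else 0)" if nu: "is_partition nu" for nu
  proof -
    have "?k nu * ?E (asc_fun nu) = (if nu = (\<lambda>_. 0) then 1 else 0)"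
      using E_Phi[OF nu] unfolding Phi[OF nu] E_smult[OF Sym_le_Sym[OF sc[OF nu]]] scale_sym_def .
    \<comment> \<open>The power of c is nonzero, and it equals 1 for the empty partition, the only
      case with a nonzero value.\<close>
    then show ?thesis using cd by (auto simp: psize_def plength_def split: if_splits)
  qed
  then have orth: "?E (mult_series (asc_fun lam) (asc_fun mu)) = (if lam = mu then norm_lim lam else 0)"
    by (rule asc_fun_orthogonal[OF linear_functional_scale_sym[OF E_lin] _ lam mu])
  have "E (mult_series (Phi_ASC (of_real q) c d lam) (Phi_ASC (of_real q) c d mu)) =
      ?k lam * ?k mu * ?E (mult_series (asc_fun lam) (asc_fun mu))"
    unfolding Phi[OF lam] Phi[OF mu] mult_smult_series scale_sym_def scale_vars_mult
    by (rule E_smult) (rule mult_series_Sym[OF sc[OF lam] sc[OF mu]])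
  also have "\<dots> = (if lam = mu then h_ASC (of_real q) c d lam else 0)"
  proof (cases "lam = mu")
    case True
    \<comment> \<open>The constants combine as c^(-2|lambda|) (c/(dq))^|lambda| =
      (cdq)^(-|lambda|).\<close>
    have "?k lam * ?k lam * norm_lim lam = h_ASC (of_real q) c d lam"
      unfolding norm_lim_eq[OF lam] h_ASC_def using cd q
      by (simp add: power_int_minus power_divide power_mult_distrib divide_simps)
    then show ?thesis using True orth by simp
  qed (simp add: orth)
  finally show ?thesis .
qed

end
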